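(* Let $2<p<3$ and $u_0\in H^2(\mathbb{T}^2)\cap W^{1,\infty}(\mathbb{T}^2)$ with $E(u_0)<0$, and let $T_{\max}<\infty$ be the maximal time of existence of the $W^{1,\infty}$-mild solution $u$ of $\partial_t u+\Delta^2u=-\nabla\cdot(|\nabla u|^{p-2}\nabla u)$, $u(0)=u_0$. Then $\|u(t)\|_{L^2}$ blows up at $T_{\max}$, and moreover $$\liminf_{t\nearrow T_{\max}}(T_{\max}-t)^{\frac{3-p}{2(p-2)}}\|u(t)\|_{L^2}>0.$$
   Context: $\mathbb{T}^2=[0,1]^2$ periodic; $\mathcal{L}=\Delta^2$, $e^{-t\mathcal{L}}f=\mathcal{F}^{-1}(e^{-t|\mathbf k|^4}\hat f(\mathbf k))$. Energy: $E(\phi)=\frac12\|\Delta\phi\|_{L^2}^2-\frac1p\|\nabla\phi\|_{L^p}^p$. $W^{1,\infty}$-mild solution on $(0,T]$: $u\in C((0,T];W^{1,\infty}(\mathbb{T}^2))$ with $u(t)=e^{-t\mathcal{L}}u_0-\int_0^t\nabla\cdot e^{-(t-s)\mathcal{L}}(|\nabla u(s)|^{p-2}\nabla u(s))\,ds$ in $W^{1,\infty}$ for every $0<t\le T$; the maximal time of existence is the supremum of such $T$ (it is finite under the hypothesis $E(u_0)<0$). *)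

theory Defs
  imports "HOL-Analysis.Analysis"
begin

text \<open>Functions on the torus T^2 = [0,1]^2 are represented as 1-periodic functions
  real^2 \<Rightarrow> real. Fourier modes are indexed by k in Z^2, with wave vector 2 pi k.\<close>

definition periodic2 :: "(real^2 \<Rightarrow> 'b) \<Rightarrow> bool" where
  "periodic2 f \<longleftrightarrow> (\<forall>x i. f (x + axis i 1) = f x)"

definition freq :: "int^2 \<Rightarrow> real^2" where
  "freq k = (2 * pi) *\<^sub>R (\<chi> i. real_of_int (k $ i))"

definition fcoef :: "(real^2 \<Rightarrow> real) \<Rightarrow> int^2 \<Rightarrow> complex" where
  "fcoef f k = integral (cbox 0 1) (\<lambda>x. complex_of_real (f x) * cis (- (freq k \<bullet> x)))"

definition semigroup :: "real \<Rightarrow> (real^2 \<Rightarrow> real) \<Rightarrow> real^2 \<Rightarrow> real" where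
  "semigroup t f x = Re (\<Sum>\<^sub>\<infinity>k. complex_of_real (exp (- t * norm (freq k) ^ 4))
                             * fcoef f k * cis (freq k \<bullet> x))"

definition div_semigroup :: "real \<Rightarrow> (real^2 \<Rightarrow> real^2) \<Rightarrow> real^2 \<Rightarrow> real" where
  "div_semigroup t G x = Re (\<Sum>\<^sub>\<infinity>k. complex_of_real (exp (- t * norm (freq k) ^ 4))
        * (\<i> * (\<Sum>j\<in>UNIV. complex_of_real (freq k $ j) * fcoef (\<lambda>y. G y $ j) k))
        * cis (freq k \<bullet> x))"

text \<open>Pointwise gradient (defined where f is differentiable, 0 elsewhere;
  for Lipschitz f this is the a.e. gradient by Rademacher).\<close>
definition grad :: "(real^2 \<Rightarrow> real) \<Rightarrow> real^2 \<Rightarrow> real^2" where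
  "grad f x = (if f differentiable (at x)
               then (\<chi> i. frechet_derivative f (at x) (axis i 1)) else 0)"

text \<open>W^{1,\<infinity>}(T^2): bounded Lipschitz periodic functions, with norm
  sup|f| + Lipschitz constant (= sup|f| + ||grad f||_\<infinity>).\<close>
definition W1inf :: "(real^2 \<Rightarrow> real) \<Rightarrow> bool" where
  "W1inf f \<longleftrightarrow> periodic2 f \<and> bounded (range f) \<and> (\<exists>L. L-lipschitz_on UNIV f)"

definition W1inf_norm :: "(real^2 \<Rightarrow> real) \<Rightarrow> real" where
  "W1inf_norm f = (SUP x. \<bar>f x\<bar>) +
     (SUP xy \<in> {(x, y). x \<noteq> y}. \<bar>f (fst xy) - f (snd xy)\<bar> / dist (fst xy) (snd xy))"

definition H2 :: "(real^2 \<Rightarrow> real) \<Rightarrow> bool" where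
  "H2 f \<longleftrightarrow> periodic2 f \<and> f \<in> borel_measurable lebesgue
     \<and> (\<lambda>x. (f x)^2) integrable_on cbox 0 1
     \<and> (\<lambda>k. (1 + norm (freq k)^2)^2 * (cmod (fcoef f k))^2) summable_on UNIV"

definition L2norm :: "(real^2 \<Rightarrow> real) \<Rightarrow> real" where
  "L2norm f = sqrt (integral (cbox 0 1) (\<lambda>x. (f x)^2))"

text \<open>||Delta f||_{L^2}^2 via Parseval.\<close>
definition lap_L2sq :: "(real^2 \<Rightarrow> real) \<Rightarrow> real" where
  "lap_L2sq f = (\<Sum>\<^sub>\<infinity>k. norm (freq k)^4 * (cmod (fcoef f k))^2)"

definition energy :: "real \<Rightarrow> (real^2 \<Rightarrow> real) \<Rightarrow> real" where
  "energy p f = lap_L2sq f / 2 - (1 / p) * integral (cbox 0 1) (\<lambda>x. norm (grad f x) powr p)"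

definition nonlin :: "real \<Rightarrow> (real^2 \<Rightarrow> real) \<Rightarrow> real^2 \<Rightarrow> real^2" where
  "nonlin p v x = (norm (grad v x) powr (p - 2)) *\<^sub>R grad v x"

definition mild_solution :: "real \<Rightarrow> (real^2 \<Rightarrow> real) \<Rightarrow> (real \<Rightarrow> real^2 \<Rightarrow> real) \<Rightarrow> real \<Rightarrow> bool" where
  "mild_solution p u0 u T \<longleftrightarrow> 0 < T
    \<and> (\<forall>t\<in>{0<..T}. W1inf (u t))
    \<and> (\<forall>t\<in>{0<..T}. ((\<lambda>s. W1inf_norm (\<lambda>x. u s x - u t x)) \<longlongrightarrow> 0) (at t within {0<..T}))
    \<and> (\<forall>t\<in>{0<..T}. \<forall>x.
         (\<lambda>s. div_semigroup (t - s) (nonlin p (u s)) x) integrable_on {0..t}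
       \<and> u t x = semigroup t u0 x - integral {0..t} (\<lambda>s. div_semigroup (t - s) (nonlin p (u s)) x))"

definition max_time :: "real \<Rightarrow> (real^2 \<Rightarrow> real) \<Rightarrow> real" where
  "max_time p u0 = Sup {T. \<exists>v. mild_solution p u0 v T}"

end

theory Submission
  imports Defs
begin

text \<open>
  The bound is a lower bound on the lifespan in terms of the \<open>L\<^sup>2\<close> norm. Restart the equation at time \<open>r\<close>
  with \<open>m = \<parallel>u(r)\<parallel>\<close> in \<open>L\<^sup>2\<close> and measure \<open>u\<close> by the weighted quantities \<open>(t - r)\<^bsup>1/2\<^esup> \<Sum> |k| |u\<^sub>k(t)|\<close> and
  \<open>(t - r)\<^bsup>1/4\<^esup> (\<Sum> |k|\<^sup>2 |u\<^sub>k(t)|\<^sup>2)\<^bsup>1/2\<^esup>\<close>. For \<open>p < 3\<close> Duhamel's formula closes on them, and both stay below \<open>36 m\<close> as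
  long as \<open>m\<^bsup>p-2\<^esup> (t - r)\<^bsup>(3-p)/2\<^esup>\<close> is small. If this held up to \<open>T\<^sub>m\<^sub>a\<^sub>x\<close>, a Banach fixed point
  argument whose time step depends only on \<open>\<Sum> |k| |u\<^sub>k|\<close> would continue the solution beyond \<open>T\<^sub>m\<^sub>a\<^sub>x\<close>.

  The definition of a mild solution only asserts, for each point \<open>x\<close>, that the Duhamel integral exists as a
  gauge integral, with no bound as \<open>s \<rightarrow> 0\<close>. Restarting at \<open>r > 0\<close> therefore needs an argument: Baire's theorem
  bounds the truncated integrals on some space-time box, and an observability inequality for \<open>e\<^bsup>-t\<Delta>\<^sup>2\<^esup>\<close> turns this
  into a bound on all Fourier coefficients.
\<close>

section \<open>Sums over the frequency lattice\<close>

text \<open>The rate is an exponent count. For an L2 datum of size m, the multiplier |k| e^{-t|k|^4}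
  costs t^{-1/2} in l^1 (1/4 for the derivative, 1/4 for Cauchy-Schwarz over a two-dimensional
  lattice) and t^{-1/4} in l^2; these are the two weights. With |grad u|^{p-2} taken in the supremum
  norm and the other factor in L2, the nonlinearity has L2 size (s-r)^{-mu}, mu = (p-2)/2 + 1/4, and
  its divergence costs (t-s)^{-3/4} or (t-s)^{-1/2}. The Beta integrals differ from the linear terms
  by a factor (t-r)^{(3-p)/2}; the root of order p-2 of 1 <= C m^{p-2} (Tm-r)^{(3-p)/2} is the
  claimed rate. Absolutely convergent Fourier series, rather than suprema of gradients, reduce
  kernel estimates to Cauchy-Schwarz and Bessel and make each exchange of sum and integral a
  dominated one. Baire's theorem only bounds values on a small box. For target time t1 + sigma,
  however, the integral over [eps, t1] is the free evolution for time sigma of one coefficient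
  family, which is why observability of the free flow applies.\<close>

lemma summable_on_boundI:
  fixes f :: "'k \<Rightarrow> real"
  assumes "\<And>F. finite F \<Longrightarrow> sum f F \<le> B" and "\<And>k. 0 \<le> f k"
  shows "f summable_on UNIV" and "infsum f UNIV \<le> B"
proof -
  show s: "f summable_on UNIV"
    by (rule nonneg_bdd_above_summable_on) (auto intro!: bdd_aboveI[of _ B] assms)
  show "infsum f UNIV \<le> B"
    by (rule infsum_le_finite_sums[OF s]) (auto intro: assms)
qed

lemma summable_on_real_comparison:
  fixes f g :: "'k \<Rightarrow> real"
  assumes "g summable_on UNIV" "\<And>k. 0 \<le> f k" "\<And>k. f k \<le> g k"
  shows "f summable_on UNIV"
  by (rule summable_on_comparison_test[OF assms(1)]) (use assms in auto)

lemma summable_on_norm_comparison: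
  fixes f :: "'k \<Rightarrow> 'a::banach"
  assumes "g summable_on UNIV" "\<And>k. norm (f k) \<le> g k"
  shows "f summable_on UNIV" and "norm (infsum f UNIV) \<le> infsum g UNIV"
proof -
  have n: "(\<lambda>k. norm (f k)) summable_on UNIV"
    by (rule summable_on_real_comparison[OF assms(1)]) (use assms in auto)
  show "f summable_on UNIV" by (rule abs_summable_summable[OF n])
  have "norm (infsum f UNIV) \<le> infsum (\<lambda>k. norm (f k)) UNIV"
    by (rule norm_infsum_bound[OF n])
  also have "\<dots> \<le> infsum g UNIV"
    by (rule infsum_mono[OF n assms(1)]) (use assms in auto)
  finally show "norm (infsum f UNIV) \<le> infsum g UNIV" .
qed

lemma summable_on_max_zero_tail:
  fixes h :: "'k \<Rightarrow> real"
  assumes "h summable_on UNIV" "\<And>k. 0 \<le> h k" "0 < e"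
  obtains A where "finite A" "infsum h (-A) < e"
proof -
  have "(h has_sum infsum h UNIV) UNIV" using assms by simp
  then have "eventually (\<lambda>A. dist (sum h A) (infsum h UNIV) < e) (finite_subsets_at_top UNIV)"
    using assms(3) unfolding has_sum_def tendsto_iff by blast
  then obtain A where A: "finite A" "dist (sum h A) (infsum h UNIV) < e"
    unfolding eventually_finite_subsets_at_top by blast
  have s: "h summable_on A" "h summable_on (-A)"
    using A assms(1) summable_on_subset_banach by blast+
  have "infsum h UNIV = infsum h A + infsum h (-A)"
    using infsum_Un_disjoint[OF s] by simp
  with A have "infsum h (-A) < e"
    by (auto simp: dist_real_def)
  with A that show thesis by blast
qed

text \<open>Dominated convergence for unordered series: a finite set carries all but e/2 of the
  majorant, and on it the convergence is termwise. The filter is arbitrary because later uses range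
  over \<open>at_right 0\<close>, neighbourhoods within intervals, and \<open>at 0\<close> in the
  plane.\<close>

lemma infsum_tendsto_zero_dominated:
  fixes d :: "'n \<Rightarrow> 'k \<Rightarrow> real"
  assumes lim: "\<And>k. ((\<lambda>n. d n k) \<longlongrightarrow> 0) F"
    and ev: "eventually (\<lambda>n. \<forall>k. 0 \<le> d n k \<and> d n k \<le> h k) F"
    and h: "h summable_on UNIV"
  shows "((\<lambda>n. infsum (d n) UNIV) \<longlongrightarrow> 0) F"
proof (cases "F = bot")
  case False
  have h0: "0 \<le> h k" for k
  proof -
    from eventually_happens[OF ev] False obtain n where "\<forall>k. 0 \<le> d n k \<and> d n k \<le> h k" by auto
    then show ?thesis by (meson order_trans)
  qed
  show ?thesis
  proof (rule tendstoI)
    fix e :: real assume e: "0 < e"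
    obtain A where A: "finite A" "infsum h (-A) < e/2"
      using summable_on_max_zero_tail[OF h h0, of "e/2"] e by auto
    have "((\<lambda>n. \<Sum>k\<in>A. d n k) \<longlongrightarrow> (\<Sum>k\<in>A. 0)) F"
      by (intro tendsto_sum lim)
    then have "((\<lambda>n. \<Sum>k\<in>A. d n k) \<longlongrightarrow> 0) F" by simp
    then have "eventually (\<lambda>n. dist (\<Sum>k\<in>A. d n k) 0 < e/2) F"
      using e by (intro tendstoD) auto
    with ev show "eventually (\<lambda>n. dist (infsum (d n) UNIV) 0 < e) F"
    proof eventually_elim
      case (elim n)
      have s: "d n summable_on UNIV"
        by (rule summable_on_real_comparison[OF h]) (use elim in auto)
      have sA: "d n summable_on A" "d n summable_on (-A)" "h summable_on (-A)"
        using A s h summable_on_subset_banach by blast+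
      have "infsum (d n) UNIV = infsum (d n) A + infsum (d n) (-A)"
        using infsum_Un_disjoint[OF sA(1,2)] by simp
      also have "infsum (d n) (-A) \<le> infsum h (-A)"
        by (rule infsum_mono[OF sA(2,3)]) (use elim in auto)
      finally have "infsum (d n) UNIV \<le> (\<Sum>k\<in>A. d n k) + infsum h (-A)"
        using A by simp
      moreover have "0 \<le> infsum (d n) UNIV" by (rule infsum_nonneg) (use elim in auto)
      ultimately show ?case using elim A by (auto simp: dist_real_def)
    qed
  qed
qed simp

lemma infsum_tendsto_dominated:
  fixes f :: "'n \<Rightarrow> 'k \<Rightarrow> 'a::banach"
  assumes lim: "\<And>k. ((\<lambda>n. f n k) \<longlongrightarrow> g k) F"
    and ev: "eventually (\<lambda>n. \<forall>k. norm (f n k) \<le> h k) F"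
    and h: "h summable_on UNIV"
  shows "((\<lambda>n. infsum (f n) UNIV) \<longlongrightarrow> infsum g UNIV) F"
proof (cases "F = bot")
  case False
  have gh: "norm (g k) \<le> h k" for k
    by (rule tendsto_le[OF False tendsto_const tendsto_norm[OF lim]])
       (use ev in \<open>auto elim: eventually_mono\<close>)
  have gs: "g summable_on UNIV" by (rule summable_on_norm_comparison(1)[OF h gh])
  have d0: "((\<lambda>n. infsum (\<lambda>k. norm (f n k - g k)) UNIV) \<longlongrightarrow> 0) F"
  proof (rule infsum_tendsto_zero_dominated)
    show "((\<lambda>n. norm (f n k - g k)) \<longlongrightarrow> 0) F" for k
      using lim[of k] by (simp add: tendsto_norm_zero LIM_zero)
    show "(\<lambda>k. 2 * h k) summable_on UNIV" using h by (rule summable_on_cmult_right)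
    show "eventually (\<lambda>n. \<forall>k. 0 \<le> norm (f n k - g k) \<and> norm (f n k - g k) \<le> 2 * h k) F"
      using ev
    proof eventually_elim
      case (elim n)
      show ?case
      proof (intro allI conjI)
        fix k show "norm (f n k - g k) \<le> 2 * h k"
          using norm_triangle_ineq4[of "f n k" "g k"] elim gh[of k] by (smt (verit))
      qed auto
    qed
  qed
  have "((\<lambda>n. infsum (f n) UNIV - infsum g UNIV) \<longlongrightarrow> 0) F"
  proof (rule Lim_null_comparison[OF _ d0])
    show "eventually (\<lambda>n. norm (infsum (f n) UNIV - infsum g UNIV) \<le> infsum (\<lambda>k. norm (f n k - g k)) UNIV) F"
      using ev
    proof eventually_elim
      case (elim n)
      have fs: "f n summable_on UNIV" by (rule summable_on_norm_comparison(1)[OF h]) (use elim in auto)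
      have e: "infsum (f n) UNIV - infsum g UNIV = infsum (\<lambda>k. f n k - g k) UNIV"
        using infsum_add[OF fs summable_on_uminus[THEN iffD2, OF gs]] by (simp add: infsum_uminus)
      have "norm (f n k - g k) \<le> 2 * h k" for k
        using norm_triangle_ineq4[of "f n k" "g k"] elim gh[of k] by (smt (verit))
      then have "(\<lambda>k. norm (f n k - g k)) summable_on UNIV"
        by (intro summable_on_real_comparison[OF summable_on_cmult_right[OF h, of 2]]) auto
      then show ?case unfolding e by (rule norm_infsum_bound)
    qed
  qed
  then show ?thesis by (rule LIM_zero_cancel)
qed simp

lemma infsum_diff_banach:
  fixes f g :: "'k \<Rightarrow> 'a::banach"
  assumes "f summable_on UNIV" "g summable_on UNIV"
  shows "infsum f UNIV - infsum g UNIV = infsum (\<lambda>k. f k - g k) UNIV"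
  using infsum_add[OF assms(1) summable_on_uminus[THEN iffD2, OF assms(2)]] by (simp add: infsum_uminus)

text \<open>Dominated convergence for gauge integrals is a statement about sequences, so unordered
  sums over Z^2 are run through along a bijection with \<open>nat\<close>.\<close>

lemma int2_enumeration:
  obtains \<phi> :: "nat \<Rightarrow> int^2" where "bij \<phi>"
proof -
  have "inj (\<lambda>k::int^2. (k $ 1, k $ 2))" by (auto simp: inj_def vec_eq_iff forall_2)
  then have c: "countable (UNIV :: (int^2) set)" by (metis countableI_type countable_image_inj_eq)
  have "inj (\<lambda>n::nat. \<chi> i::2. int n)" by (auto simp: inj_def vec_eq_iff)
  then have "infinite (UNIV :: (int^2) set)"
    by (metis finite_imageD finite_subset infinite_UNIV_nat subset_UNIV)
  with c have "bij (from_nat_into (UNIV :: (int^2) set))"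
    using bij_betw_from_nat_into by blast
  then show thesis by (rule that)
qed

text \<open>Termwise integration: the partial sums along an enumeration of Z^2 are dominated by
  \<open>g\<close>. The bound on finite sums of norms also makes the integrals absolutely summable,
  so the enumeration does not affect the value.\<close>

lemma integral_infsum_dominated:
  fixes f :: "int^2 \<Rightarrow> 'n::euclidean_space \<Rightarrow> 'm::euclidean_space"
  assumes f: "\<And>k. f k integrable_on S" and g: "g integrable_on S"
    and le: "\<And>F x. finite F \<Longrightarrow> x \<in> S \<Longrightarrow> (\<Sum>k\<in>F. norm (f k x)) \<le> g x"
  shows "(\<lambda>x. \<Sum>\<^sub>\<infinity>k. f k x) integrable_on S"
    and "(\<lambda>k. norm (integral S (f k))) summable_on UNIV"
    and "integral S (\<lambda>x. \<Sum>\<^sub>\<infinity>k. f k x) = (\<Sum>\<^sub>\<infinity>k. integral S (f k))"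
proof -
  obtain \<phi> :: "nat \<Rightarrow> int^2" where b: "bij \<phi>" by (rule int2_enumeration)
  have inj: "inj \<phi>" using b by (rule bij_is_inj)
  have s: "(\<lambda>k. norm (f k x)) summable_on UNIV" if "x \<in> S" for x
    by (rule summable_on_boundI[where B="g x"]) (use le that in auto)
  \<comment> \<open>A gauge integrable function dominated by an integrable one is absolutely
    integrable, so the norms may be integrated as well.\<close>
  have ab: "f k absolutely_integrable_on S" for k
  proof (rule absolutely_integrable_integrable_bound[OF _ f g])
    show "norm (f k x) \<le> g x" if "x \<in> S" for x using le[of "{k}" x] that by simp
  qed
  have ni: "(\<lambda>x. norm (f k x)) integrable_on S" for k
    using ab[of k] by (simp add: absolutely_integrable_on_def)
  show s2: "(\<lambda>k. norm (integral S (f k))) summable_on UNIV"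
  proof (rule summable_on_boundI)
    fix F :: "(int^2) set" assume F: "finite F"
    have "(\<Sum>k\<in>F. norm (integral S (f k))) \<le> (\<Sum>k\<in>F. integral S (\<lambda>x. norm (f k x)))"
      by (intro sum_mono integral_norm_bound_integral f ni) auto
    also have "\<dots> = integral S (\<lambda>x. \<Sum>k\<in>F. norm (f k x))"
      by (rule integral_sum[symmetric]) (use F ni in auto)
    also have "\<dots> \<le> integral S g"
      by (rule integral_le) (use F le g in \<open>auto intro!: integrable_sum ni\<close>)
    finally show "(\<Sum>k\<in>F. norm (integral S (f k))) \<le> integral S g" .
  qed auto
  have lim: "(\<lambda>n. \<Sum>i<n. f (\<phi> i) x) \<longlonglongrightarrow> (\<Sum>\<^sub>\<infinity>k. f k x)" if "x \<in> S" for x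
  proof -
    have "((\<lambda>k. f k x) has_sum (\<Sum>\<^sub>\<infinity>k. f k x)) UNIV"
      using abs_summable_summable[OF s[OF that]] by simp
    then have "((\<lambda>i. f (\<phi> i) x) has_sum (\<Sum>\<^sub>\<infinity>k. f k x)) UNIV"
      using has_sum_reindex_bij_betw[OF b, of "\<lambda>k. f k x"] by simp
    then show ?thesis using has_sum_imp_sums sums_def by blast
  qed
  have le': "norm (\<Sum>i<n. f (\<phi> i) x) \<le> g x" if "x \<in> S" for n x
  proof -
    have "norm (\<Sum>i<n. f (\<phi> i) x) \<le> (\<Sum>i<n. norm (f (\<phi> i) x))" by (rule norm_sum)
    also have "\<dots> = (\<Sum>k\<in>\<phi> ` {..<n}. norm (f k x))"
      by (subst sum.reindex) (auto intro: inj_on_subset[OF inj])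
    also have "\<dots> \<le> g x" by (rule le) (use that in auto)
    finally show ?thesis .
  qed
  have dc: "(\<lambda>x. \<Sum>\<^sub>\<infinity>k. f k x) integrable_on S"
    "(\<lambda>n. integral S (\<lambda>x. \<Sum>i<n. f (\<phi> i) x)) \<longlonglongrightarrow> integral S (\<lambda>x. \<Sum>\<^sub>\<infinity>k. f k x)"
    by (rule dominated_convergence[OF _ g, where f="\<lambda>n x. \<Sum>i<n. f (\<phi> i) x"];
        use le' lim in \<open>auto intro!: integrable_sum f\<close>)+
  show "(\<lambda>x. \<Sum>\<^sub>\<infinity>k. f k x) integrable_on S" by (rule dc)
  have "((\<lambda>k. integral S (f k)) has_sum (\<Sum>\<^sub>\<infinity>k. integral S (f k))) UNIV"
    using abs_summable_summable[OF s2] by simp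
  then have "((\<lambda>i. integral S (f (\<phi> i))) has_sum (\<Sum>\<^sub>\<infinity>k. integral S (f k))) UNIV"
    using has_sum_reindex_bij_betw[OF b, of "\<lambda>k. integral S (f k)"] by simp
  then have "(\<lambda>n. \<Sum>i<n. integral S (f (\<phi> i))) \<longlonglongrightarrow> (\<Sum>\<^sub>\<infinity>k. integral S (f k))"
    using has_sum_imp_sums sums_def by blast
  moreover have "(\<Sum>i<n. integral S (f (\<phi> i))) = integral S (\<lambda>x. \<Sum>i<n. f (\<phi> i) x)" for n
    by (rule integral_sum[symmetric]) (use f in auto)
  ultimately show "integral S (\<lambda>x. \<Sum>\<^sub>\<infinity>k. f k x) = (\<Sum>\<^sub>\<infinity>k. integral S (f k))"
    using dc(2) LIMSEQ_unique by auto
qed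

section \<open>Eigenvalues of the bilaplacian and lattice sums of its heat factor\<close>

definition lam :: "int^2 \<Rightarrow> real" where "lam k = norm (freq k) ^ 4"

lemma lam_nonneg [simp]: "0 \<le> lam k" by (simp add: lam_def)

lemma freq_nth: "freq k $ i = 2 * pi * real_of_int (k $ i)"
  by (simp add: freq_def)

lemma freq_0 [simp]: "freq 0 = 0" by (simp add: vec_eq_iff freq_nth)
lemma freq_minus: "freq (- k) = - freq k" by (simp add: vec_eq_iff freq_nth)
lemma lam_minus [simp]: "lam (- k) = lam k" by (simp add: lam_def freq_minus)
lemma lam_0 [simp]: "lam 0 = 0" by (simp add: lam_def)

lemma norm_freq_ge_nth: "\<bar>real_of_int (k $ i)\<bar> \<le> norm (freq k)"
proof -
  have "\<bar>real_of_int (k $ i)\<bar> \<le> 2 * pi * \<bar>real_of_int (k $ i)\<bar>"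
    using pi_gt3 mult_right_mono[of 1 "2 * pi" "\<bar>real_of_int (k $ i)\<bar>"] by auto
  also have "\<dots> = \<bar>freq k $ i\<bar>" by (simp add: abs_mult freq_nth)
  also have "\<dots> \<le> norm (freq k)" by (rule component_le_norm_cart)
  finally show ?thesis .
qed

lemma norm_freq_ge_1:
  assumes "k \<noteq> 0" shows "1 \<le> norm (freq k)"
proof -
  obtain i where "k $ i \<noteq> 0" using assms by (auto simp: vec_eq_iff)
  then have "1 \<le> \<bar>real_of_int (k $ i)\<bar>" by linarith
  then show ?thesis using norm_freq_ge_nth[of k i] by linarith
qed

text \<open>The mixed term is dropped and \<open>2 * pi\<close> replaced by 1, so that
  \<open>exp (- t * lam k)\<close> is below a product of one-dimensional factors.\<close>

lemma lam_ge: "(real_of_int (k $ 1))^4 + (real_of_int (k $ 2))^4 \<le> lam k"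
proof -
  let ?a = "real_of_int (k $ 1)" and ?b = "real_of_int (k $ 2)"
  have "norm (freq k)^2 = (2*pi)^2 * (?a^2 + ?b^2)"
    unfolding power2_norm_eq_inner inner_vec_def by (simp add: freq_nth sum_2 power2_eq_square algebra_simps)
  moreover have "1 \<le> (2*pi)^2" using pi_gt3 by (intro one_le_power) auto
  ultimately have "?a^2 + ?b^2 \<le> norm (freq k)^2"
    using mult_right_mono[of 1 "(2*pi)^2" "?a^2 + ?b^2"] by simp
  then have "(?a^2 + ?b^2)^2 \<le> (norm (freq k)^2)^2" by (intro power_mono) auto
  moreover have "(norm (freq k)^2)^2 = lam k" by (simp add: lam_def flip: power_mult)
  moreover have "?a^4 + ?b^4 \<le> (?a^2 + ?b^2)^2"
  proof -
    have "(?a^2 + ?b^2)^2 = ?a^4 + ?b^4 + 2 * (?a * ?b)^2"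
      by (simp add: power2_eq_square power4_eq_xxxx algebra_simps)
    then show ?thesis by (smt (verit) zero_le_power2)
  qed
  ultimately show ?thesis by linarith
qed

text \<open>In the scaled variable y = x t^{1/4} this is y^a <= 1 + y^4 <= 2 exp(y^4/2). Half of the
  exponential is kept, to be summed over the lattice afterwards.\<close>

lemma powr_exp_bound:
  fixes x :: real
  assumes "0 < t" "0 \<le> x" "0 \<le> a" "a \<le> 4"
  shows "x powr a * exp (- t * x^4) \<le> 2 * t powr (- a / 4) * exp (- t * x^4 / 2)"
proof (cases "x = 0")
  case False
  then have x: "0 < x" using assms by auto
  define y where "y = x * t powr (1/4)"
  have y: "0 < y" using x assms by (simp add: y_def)
  have y4: "y^4 = t * x^4"
    using assms by (simp add: y_def power_mult_distrib powr_power mult.commute)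
  have xa: "x powr a = y powr a * t powr (- a / 4)"
    using x assms by (simp add: y_def powr_mult powr_powr flip: powr_add)
  have "y powr a \<le> 1 + y^4"
  proof (cases "y \<le> 1")
    case True
    then have "y powr a \<le> 1" using y assms by (simp add: powr_le1)
    then show ?thesis by (smt (verit) zero_le_even_power even_numeral)
  next
    case False
    then have "y powr a \<le> y powr 4" using assms by (intro powr_mono) auto
    also have "y powr 4 = y^4" using y by (simp flip: powr_numeral)
    finally show ?thesis by simp
  qed
  also have "1 + y^4 \<le> 2 * exp (y^4/2)"
    using exp_ge_add_one_self[of "y^4/2"] by (simp only: mult_2)
  finally have "y powr a * exp (- (y^4)) \<le> 2 * exp (y^4/2) * exp (- (y^4))"
    by (intro mult_right_mono) auto
  also have "\<dots> = 2 * exp (- (y^4) / 2)" by (simp flip: exp_add)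
  finally have "y powr a * exp (- (y^4)) \<le> 2 * exp (- (y^4) / 2)" .
  then have "t powr (- a / 4) * (y powr a * exp (- (y^4))) \<le> t powr (- a / 4) * (2 * exp (- (y^4) / 2))"
    by (intro mult_left_mono) auto
  then show ?thesis by (simp add: xa y4 mult_ac)
qed (use assms in auto)

text \<open>Comparison with the integral of 1/(1 + x^2): each term times theta is at most an
  increment of arctan, and the increments telescope to less than pi/2 < 2.\<close>

lemma sum_inverse_square_bound:
  assumes "0 < \<theta>"
  shows "(\<Sum>n=1..N. 1 / (1 + \<theta>^2 * (real n)^2)) \<le> 2 / \<theta>"
proof -
  have step: "\<theta> / (1 + \<theta>^2 * (real (Suc n))^2) \<le> arctan (\<theta> * real (Suc n)) - arctan (\<theta> * real n)" for n
  proof -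
    have "\<theta> * real n < \<theta> * real (Suc n)" using assms by simp
    from MVT2[OF this, of arctan "\<lambda>x. inverse (1 + x^2)"] DERIV_arctan
    obtain z where z: "\<theta> * real n < z" "z < \<theta> * real (Suc n)"
      "arctan (\<theta> * real (Suc n)) - arctan (\<theta> * real n) = (\<theta> * real (Suc n) - \<theta> * real n) * inverse (1 + z^2)"
      by blast
    have "0 \<le> z" using z(1) assms by (smt (verit) mult_nonneg_nonneg of_nat_0_le_iff)
    then have "z^2 \<le> (\<theta> * real (Suc n))^2" using z by (intro power_mono) auto
    then have "1 + z^2 \<le> 1 + \<theta>^2 * (real (Suc n))^2" by (simp add: power_mult_distrib)
    then have "inverse (1 + \<theta>^2 * (real (Suc n))^2) \<le> inverse (1 + z^2)"
      by (intro le_imp_inverse_le) (auto intro: add_pos_nonneg)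
    then have "\<theta> * inverse (1 + \<theta>^2 * (real (Suc n))^2) \<le> \<theta> * inverse (1 + z^2)"
      using assms by (intro mult_left_mono) auto
    then show ?thesis unfolding z(3) by (simp add: divide_inverse algebra_simps)
  qed
  have "(\<Sum>n=1..N. \<theta> / (1 + \<theta>^2 * (real n)^2)) \<le> arctan (\<theta> * real N)"
  proof (induction N)
    case (Suc N) then show ?case using step[of N] by simp
  qed simp
  also have "\<dots> \<le> 2" using arctan_ubound[of "\<theta> * real N"] pi_less_4 by linarith
  finally have "\<theta> * (\<Sum>n=1..N. 1 / (1 + \<theta>^2 * (real n)^2)) \<le> 2"
    by (simp add: sum_distrib_left)
  then show ?thesis using assms by (simp add: field_simps)
qed

text \<open>The exponential is replaced by 2/(1 + theta^2 x^2) with theta = t^{1/4}. The term n = 0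
  and the two half lines give 1 + 8/theta, and theta <= 1 turns this into 9/theta.\<close>

lemma sum_exp_quartic_bound:
  assumes "0 < t" "t \<le> 1"
  shows "(\<Sum>n\<in>{-int N..int N}. exp (- t * (real_of_int n)^4)) \<le> 9 * t powr (-1/4)"
proof -
  define \<theta> where "\<theta> = t powr (1/4)"
  have th: "0 < \<theta>" "\<theta> \<le> 1" using assms by (auto simp: \<theta>_def powr_le1)
  have t4: "t = \<theta>^4" using assms by (simp add: \<theta>_def powr_power)
  have b: "exp (- t * x^4) \<le> 2 * (1 / (1 + \<theta>^2 * x^2))" for x :: real
  proof -
    define z where "z = \<theta>^2 * x^2"
    have z: "0 \<le> z" "t * x^4 = z^2" by (auto simp: z_def t4 power_mult_distrib simp flip: power_mult)
    have "1 + z \<le> 2 * (1 + z^2)" using z zero_le_power2[of "z - 1/4"] by (simp add: power2_eq_square algebra_simps)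
    also have "\<dots> \<le> 2 * exp (z^2)" using exp_ge_add_one_self[of "z^2"] by (intro mult_left_mono) auto
    finally have "(1+z) * exp (- (z^2)) \<le> 2 * exp (z^2) * exp (-(z^2))" by (intro mult_right_mono) auto
    also have "\<dots> = 2" by (simp flip: exp_add)
    finally have "exp (-(z^2)) \<le> 2 / (1+z)" using z by (simp add: field_simps)
    then show ?thesis using z by (simp add: z_def)
  qed
  have "(\<Sum>n\<in>{-int N..int N}. exp (- t * (real_of_int n)^4)) \<le> 1 + 2 * (\<Sum>n=1..N. exp (- t * (real n)^4))"
  proof (induction N)
    case (Suc N)
    have "{-int (Suc N)..int (Suc N)} = insert (- int (Suc N)) (insert (int (Suc N)) {-int N..int N})" by auto
    then have "(\<Sum>n\<in>{-int (Suc N)..int (Suc N)}. exp (- t * (real_of_int n)^4))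
       = 2 * exp (- t * (real (Suc N))^4) + (\<Sum>n\<in>{-int N..int N}. exp (- t * (real_of_int n)^4))"
    proof -
      have "(real_of_int (- int (Suc N)))^4 = (real (Suc N))^4"
      proof -
        have e: "real_of_int (- int (Suc N)) = - real (Suc N)" by simp
        show ?thesis unfolding e by (subst uminus_power_if) simp
      qed
      with \<open>{-int (Suc N)..int (Suc N)} = _\<close> show ?thesis by simp
    qed
    then show ?case using Suc by (simp add: algebra_simps)
  qed simp
  also have "(\<Sum>n=1..N. exp (- t * (real n)^4)) \<le> (\<Sum>n=1..N. 2 * (1 / (1 + \<theta>^2 * (real n)^2)))"
    by (intro sum_mono b)
  also have "\<dots> = 2 * (\<Sum>n=1..N. (1 / (1 + \<theta>^2 * (real n)^2)))" by (simp add: sum_distrib_left)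
  also have "\<dots> \<le> 2 * (2 / \<theta>)" by (intro mult_left_mono sum_inverse_square_bound th) auto
  also have "1 + 2 * (2 * (2 / \<theta>)) \<le> 9 / \<theta>" using th by (simp add: field_simps)
  also have "9 / \<theta> = 9 * t powr (-1/4)" by (simp add: \<theta>_def powr_minus_divide)
  finally show ?thesis by simp
qed

lemma finite_int2_in_box:
  assumes "finite (F :: (int^2) set)"
  obtains N :: nat where "\<And>k i. k \<in> F \<Longrightarrow> \<bar>k $ i\<bar> \<le> int N"
proof -
  have "\<exists>N::nat. \<forall>k\<in>F. \<forall>i. \<bar>k $ i\<bar> \<le> int N"
    using assms
  proof (induction F)
    case (insert k F)
    then obtain N where N: "\<forall>k\<in>F. \<forall>i. \<bar>k $ i\<bar> \<le> int N" by auto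
    let ?N = "max N (max (nat \<bar>k $ 1\<bar>) (nat \<bar>k $ 2\<bar>))"
    have "\<forall>l\<in>insert k F. \<forall>i. \<bar>l $ i\<bar> \<le> int ?N"
    proof (intro ballI allI)
      fix l :: "int^2" and i :: 2 assume l: "l \<in> insert k F"
      have "i = 1 \<or> i = 2" by (rule exhaust_2)
      then have "nat \<bar>l $ i\<bar> \<le> ?N"
        using l N by (auto simp: le_max_iff_disj nat_le_iff)
      then show "\<bar>l $ i\<bar> \<le> int ?N" by (simp only: nat_le_iff)
    qed
    then show ?case by blast
  qed auto
  then show thesis using that by blast
qed

text \<open>Squares rather than discs, so that sums over them are iterated sums and one-dimensional
  estimates apply in each variable.\<close>

definition int2_box :: "nat \<Rightarrow> (int^2) set" where
  "int2_box N = {k. \<forall>i. \<bar>k $ i\<bar> \<le> int N}"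

lemma sum_int2_box:
  "(\<Sum>k\<in>int2_box N. f k) = (\<Sum>m\<in>{-int N..int N}. \<Sum>n\<in>{-int N..int N}. f (vector [m, n]))"
proof -
  have "(\<Sum>m\<in>{-int N..int N}. \<Sum>n\<in>{-int N..int N}. f (vector [m, n]))
     = (\<Sum>(m,n)\<in>{-int N..int N} \<times> {-int N..int N}. f (vector [m, n]))"
    by (rule sum.cartesian_product)
  also have "\<dots> = (\<Sum>k\<in>int2_box N. f k)"
    by (rule sum.reindex_bij_witness[where i="\<lambda>k. (k $ 1, k $ 2)" and j="\<lambda>(m,n). vector [m, n]"])
       (auto simp: int2_box_def forall_2 vec_eq_iff abs_le_iff)
  finally show ?thesis by simp
qed

lemma finite_int2_box [simp]: "finite (int2_box N)"
proof -
  have "int2_box N \<subseteq> (\<lambda>(m,n). vector [m, n]) ` ({-int N..int N} \<times> {-int N..int N})"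
  proof
    fix k assume "k \<in> int2_box N"
    then have "\<bar>k $ 1\<bar> \<le> int N" "\<bar>k $ 2\<bar> \<le> int N" by (auto simp: int2_box_def)
    moreover have "k = vector [k $ 1, k $ 2]" by (simp add: vec_eq_iff forall_2)
    ultimately show "k \<in> (\<lambda>(m,n). vector [m, n]) ` ({-int N..int N} \<times> {-int N..int N})"
      by (intro image_eqI[where x="(k $ 1, k $ 2)"]) auto
  qed
  then show ?thesis by (rule finite_subset) auto
qed

text \<open>The square of the one-dimensional bound: 81 = 9^2, and the exponent 1/2 is dimension
  over order, 2/4.\<close>

lemma sum_exp_lam_bound:
  assumes "0 < t" "t \<le> 1" "finite F"
  shows "(\<Sum>k\<in>F. exp (- t * lam k)) \<le> 81 * t powr (-1/2)"
proof -
  obtain N where N: "\<And>k i. k \<in> F \<Longrightarrow> \<bar>k $ i\<bar> \<le> int N" using finite_int2_in_box[OF assms(3)] by blast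
  let ?g = "\<lambda>n. exp (- t * (real_of_int n)^4)"
  have "(\<Sum>k\<in>F. exp (- t * lam k)) \<le> (\<Sum>k\<in>int2_box N. exp (- t * lam k))"
    by (rule sum_mono2) (use N in \<open>auto simp: int2_box_def intro: finite_int2_box[unfolded int2_box_def]\<close>)
  also have "\<dots> \<le> (\<Sum>k\<in>int2_box N. ?g (k $ 1) * ?g (k $ 2))"
  proof (rule sum_mono)
    fix k :: "int^2"
    have "t * ((real_of_int (k $ 1))^4 + (real_of_int (k $ 2))^4) \<le> t * lam k"
      using lam_ge[of k] assms by (intro mult_left_mono) auto
    then show "exp (- t * lam k) \<le> ?g (k $ 1) * ?g (k $ 2)"
      by (simp flip: exp_add add: algebra_simps)
  qed
  also have "\<dots> = (\<Sum>n\<in>{-int N..int N}. ?g n)^2"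
    unfolding sum_int2_box by (simp add: power2_eq_square sum_product)
  also have "\<dots> \<le> (9 * t powr (-1/4))^2"
    by (intro power_mono sum_exp_quartic_bound assms sum_nonneg) auto
  also have "\<dots> = 81 * t powr (-1/2)"
    using assms by (simp add: power_mult_distrib powr_power)
  finally show ?thesis .
qed

lemma summable_exp_lam:
  assumes "0 < t" shows "(\<lambda>k. exp (- t * lam k)) summable_on UNIV"
proof -
  have s: "(\<lambda>k. exp (- min t 1 * lam k)) summable_on UNIV"
    by (rule summable_on_boundI(1)[where B="81 * (min t 1) powr (-1/2)"])
       (use assms in \<open>auto intro: sum_exp_lam_bound[of "min t 1", simplified]\<close>)
  show ?thesis
    by (rule summable_on_real_comparison[OF s]) (use assms in \<open>auto intro: mult_right_mono\<close>)
qed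

lemma freq_exp_bound:
  assumes "0 < t" "0 \<le> a" "a \<le> 4"
  shows "norm (freq k) powr a * exp (- t * lam k) \<le> 2 * t powr (- a / 4) * exp (- (t/2) * lam k)"
  using powr_exp_bound[OF assms(1) norm_ge_zero assms(2,3), of "freq k"] by (simp add: lam_def)

lemma summable_freq_exp_lam:
  assumes "0 < t" "0 \<le> a" "a \<le> 4"
  shows "(\<lambda>k. norm (freq k) powr a * exp (- t * lam k)) summable_on UNIV"
  by (rule summable_on_real_comparison[OF summable_on_cmult_right[OF summable_exp_lam[of "t/2"], of "2 * t powr (- a / 4)"]])
     (use assms freq_exp_bound[OF assms] in auto)

text \<open>Half of the heat factor absorbs the weight at the price 2 t^{-a/4}; the other half has
  l^2 norm at most 9 t^{-1/4}, and Cauchy-Schwarz over the lattice combines it with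
  \<open>q\<close>. Passing from l^2 to l^1 in dimension two thus costs t^{-1/4}, and 18 = 2 *
  9.\<close>

lemma smoothing_l1_short:
  assumes "0 < t" "t \<le> 1" "0 \<le> a" "a \<le> 4" "finite F" and q: "\<And>k. 0 \<le> q k"
    and B: "(\<Sum>k\<in>F. (q k)^2) \<le> B^2" "0 \<le> B"
  shows "(\<Sum>k\<in>F. norm (freq k) powr a * exp (- t * lam k) * q k) \<le> 18 * t powr (- (a + 1) / 4) * B"
proof -
  have "(\<Sum>k\<in>F. norm (freq k) powr a * exp (- t * lam k) * q k)
     \<le> (\<Sum>k\<in>F. (2 * t powr (- a / 4) * exp (- (t/2) * lam k)) * q k)"
    by (intro sum_mono mult_right_mono freq_exp_bound assms)
  also have "\<dots> = 2 * t powr (- a / 4) * (\<Sum>k\<in>F. exp (- (t/2) * lam k) * q k)"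
    by (simp add: sum_distrib_left mult_ac)
  also have "(\<Sum>k\<in>F. exp (- (t/2) * lam k) * q k) \<le> 9 * t powr (-1/4) * B"
  proof -
    have "(\<Sum>k\<in>F. exp (- (t/2) * lam k) * q k)^2 \<le> (\<Sum>k\<in>F. (exp (- (t/2) * lam k))^2) * (\<Sum>k\<in>F. (q k)^2)"
      by (rule Cauchy_Schwarz_ineq_sum)
    also have "(\<Sum>k\<in>F. (exp (- (t/2) * lam k))^2) = (\<Sum>k\<in>F. exp (- t * lam k))"
      by (simp flip: exp_double)
    also have "\<dots> * (\<Sum>k\<in>F. (q k)^2) \<le> (81 * t powr (-1/2)) * B^2"
      by (intro mult_mono sum_exp_lam_bound assms B) (auto intro: sum_nonneg)
    also have "\<dots> = (9 * t powr (-1/4) * B)^2"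
      using assms by (simp add: power_mult_distrib powr_power)
    finally show ?thesis by (rule power2_le_imp_le) (use B in auto)
  qed
  also have "2 * t powr (- a / 4) * (9 * t powr (-1/4) * B) = 18 * (t powr (- a / 4) * t powr (-1/4)) * B"
    by (simp add: mult_ac)
  also have "t powr (- a / 4) * t powr (-1/4) = t powr (- (a + 1) / 4)"
    by (simp flip: powr_add add: field_simps)
  finally show ?thesis by (simp add: mult_left_mono)
qed

text \<open>For a = 0 the power law fails at large t, since the zero mode does not decay; the time
  is therefore capped at 1.\<close>

lemma smoothing_l1:
  assumes t: "0 < t" and a: "0 \<le> a" "a \<le> 4" and F: "finite F" and q: "\<And>k. 0 \<le> q k"
    and B: "(\<Sum>k\<in>F. (q k)^2) \<le> B^2" "0 \<le> B"
  shows "(\<Sum>k\<in>F. norm (freq k) powr a * exp (- t * lam k) * q k) \<le> 18 * (min t 1) powr (- (a + 1) / 4) * B"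
proof -
  have "(\<Sum>k\<in>F. norm (freq k) powr a * exp (- t * lam k) * q k) \<le> (\<Sum>k\<in>F. norm (freq k) powr a * exp (- min t 1 * lam k) * q k)"
    by (intro sum_mono mult_right_mono mult_left_mono q) (auto intro: mult_right_mono)
  also have "\<dots> \<le> 18 * (min t 1) powr (- (a + 1) / 4) * B"
    by (rule smoothing_l1_short[OF _ _ a F q B]) (use t in auto)
  finally show ?thesis .
qed

text \<open>The multiplier is only bounded here, not summed, so the loss t^{-1/4} of the l^1
  estimate is absent and the time needs no cap.\<close>

lemma smoothing_l2:
  assumes "0 < t" "0 \<le> a" "a \<le> 4" "finite F" and q: "\<And>k. 0 \<le> q k"
    and B: "(\<Sum>k\<in>F. (q k)^2) \<le> B^2" "0 \<le> B"
  shows "(\<Sum>k\<in>F. (norm (freq k) powr a * exp (- t * lam k) * q k)^2) \<le> (2 * t powr (- a / 4) * B)^2"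
proof -
  have "norm (freq k) powr a * exp (- t * lam k) \<le> 2 * t powr (- a / 4)" for k
    by (rule order_trans[OF freq_exp_bound[OF assms(1-3)]]) (use assms in \<open>auto intro: mult_left_le\<close>)
  then have "(\<Sum>k\<in>F. (norm (freq k) powr a * exp (- t * lam k) * q k)^2) \<le> (\<Sum>k\<in>F. (2 * t powr (- a / 4) * q k)^2)"
    by (intro sum_mono power_mono mult_right_mono q mult_nonneg_nonneg) auto
  also have "\<dots> = (2 * t powr (- a / 4))^2 * (\<Sum>k\<in>F. (q k)^2)"
    by (simp add: power_mult_distrib sum_distrib_left)
  also have "\<dots> \<le> (2 * t powr (- a / 4))^2 * B^2"
    by (intro mult_left_mono B) auto
  finally show ?thesis by (simp add: power_mult_distrib)
qed

section \<open>Fourier series on the torus\<close>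

lemma unit_square_images:
  "(\<lambda>(a,b). vector [a, b] :: real^2) ` cbox (u1,u2) (v1,v2) = cbox (vector [u1,u2]) (vector [v1,v2])"
  "(\<lambda>x :: real^2. (x $ 1, x $ 2)) ` cbox u v = cbox (u $ 1, u $ 2) (v $ 1, v $ 2)"
proof -
  show "(\<lambda>(a,b). vector [a, b] :: real^2) ` cbox (u1,u2) (v1,v2) = cbox (vector [u1,u2]) (vector [v1,v2])"
  proof (rule set_eqI)
    fix x :: "real^2"
    have x: "x = vector [x $ 1, x $ 2]" by (simp add: vec_eq_iff forall_2)
    show "x \<in> (\<lambda>(a,b). vector [a, b]) ` cbox (u1,u2) (v1,v2) \<longleftrightarrow> x \<in> cbox (vector [u1,u2]) (vector [v1,v2])"
    proof
      assume "x \<in> cbox (vector [u1,u2]) (vector [v1,v2])"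
      then have "(x $ 1, x $ 2) \<in> cbox (u1,u2) (v1,v2)"
        by (auto simp: mem_box_cart forall_2 cbox_Pair_eq)
      then show "x \<in> (\<lambda>(a,b). vector [a, b]) ` cbox (u1,u2) (v1,v2)"
        using x by (intro image_eqI[where x="(x $ 1, x $ 2)"]) auto
    qed (auto simp: mem_box_cart forall_2 cbox_Pair_eq)
  qed
  show "(\<lambda>x :: real^2. (x $ 1, x $ 2)) ` cbox u v = cbox (u $ 1, u $ 2) (v $ 1, v $ 2)"
  proof (rule set_eqI, clarify)
    fix a b
    show "(a, b) \<in> (\<lambda>x :: real^2. (x $ 1, x $ 2)) ` cbox u v \<longleftrightarrow> (a, b) \<in> cbox (u $ 1, u $ 2) (v $ 1, v $ 2)"
    proof
      assume "(a, b) \<in> cbox (u $ 1, u $ 2) (v $ 1, v $ 2)"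
      then have "vector [a, b] \<in> cbox u v" by (auto simp: mem_box_cart forall_2 cbox_Pair_eq)
      then show "(a, b) \<in> (\<lambda>x :: real^2. (x $ 1, x $ 2)) ` cbox u v"
        by (intro image_eqI[where x="vector [a, b]"]) auto
    qed (auto simp: mem_box_cart forall_2 cbox_Pair_eq)
  qed
qed

lemma content_vector2:
  "measure lborel (cbox (vector [u1,u2] :: real^2) (vector [v1,v2])) = measure lborel (cbox (u1,u2) (v1,v2) :: (real \<times> real) set)"
proof (cases "u1 \<le> v1 \<and> u2 \<le> v2")
  case True
  then have ne: "cbox (vector [u1,u2] :: real^2) (vector [v1,v2]) \<noteq> {}"
    by (auto simp: interval_ne_empty_cart forall_2)
  show ?thesis using True by (simp add: content_cbox_cart[OF ne] content_Pair UNIV_2)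
next
  case False
  then have "cbox (vector [u1,u2] :: real^2) (vector [v1,v2]) = {}"
    by (auto simp: mem_box_cart forall_2 set_eq_iff not_le)
  moreover have "cbox (u1,u2) (v1,v2) = {}" using False by (auto simp: cbox_Pair_eq)
  ultimately show ?thesis by simp
qed

lemma one_vec_eq: "(1::real^2) = vector [1, 1]" "(0::real^2) = vector [0, 0]"
  by (auto simp: vec_eq_iff forall_2)

lemma content_unit_square [simp]: "measure lborel (cbox 0 (1::real^2)) = 1"
  unfolding one_vec_eq content_vector2 by (simp add: content_Pair)

lemma continuous_vector2 [continuous_intros]:
  assumes "continuous_on S f" "continuous_on S g"
  shows "continuous_on S (\<lambda>x. vector [f x, g x] :: real^2)"
proof -
  have e: "(\<lambda>x. vector [f x, g x] :: real^2) = (\<lambda>x. \<chi> i. if i = 1 then f x else g x)"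
    by (rule ext) (auto simp: vec_eq_iff forall_2)
  show ?thesis unfolding e
  proof (rule continuous_on_vec_lambda)
    show "continuous_on S (\<lambda>x. if i = 1 then f x else g x)" for i :: 2
      using assms by (cases "i = 1") auto
  qed
qed

text \<open>Iterated integration takes place on the product \<open>real \<times> real\<close>; the
  identification with \<open>real^2\<close> maps boxes to boxes of the same content, which is what
  the change of variables for gauge integrals asks for.\<close>

lemma integral_unit_square:
  fixes f :: "real^2 \<Rightarrow> 'a::euclidean_space"
  assumes "continuous_on UNIV f"
  shows "integral (cbox 0 1) f = integral {0..1} (\<lambda>a. integral {0..1} (\<lambda>b. f (vector [a, b])))"
proof -
  let ?g = "\<lambda>(a,b). vector [a, b] :: real^2" and ?h = "\<lambda>x :: real^2. (x $ 1, x $ 2)"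
  have cg: "continuous_on UNIV ?g"
    unfolding split_def by (intro continuous_intros)
  have "f integrable_on cbox 0 1" by (intro integrable_continuous continuous_on_subset[OF assms]) auto
  then have hi: "(f has_integral integral (cbox 0 1) f) (cbox 0 1)" by auto
  have "((\<lambda>x. f (?g x)) has_integral (1 / 1) *\<^sub>R integral (cbox 0 1) f) (?h ` cbox 0 1)"
  proof (rule has_integral_twiddle[OF _ _ _ _ _ _ _ hi])
    show "continuous (at x) ?g" for x
      using cg continuous_on_eq_continuous_at[OF open_UNIV, of ?g] by blast
    show "\<exists>w z. ?g ` cbox u v = cbox w z" for u v :: "real \<times> real"
      using unit_square_images(1)[of "fst u" "snd u" "fst v" "snd v"] by auto
    show "\<exists>w z. ?h ` cbox u v = cbox w z" for u v
      unfolding unit_square_images(2) by blast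
    show "measure lborel (?g ` cbox u v) = 1 * measure lborel (cbox u v)" for u v :: "real \<times> real"
      using unit_square_images(1)[of "fst u" "snd u" "fst v" "snd v"]
        content_vector2[of "fst u" "snd u" "fst v" "snd v"] by simp
  qed (auto simp: vec_eq_iff forall_2)
  then have "integral (cbox 0 1) f = integral (cbox (0,0) (1,1)) (\<lambda>x. f (?g x))"
    unfolding unit_square_images(2) by (simp add: integral_unique)
  also have "\<dots> = integral (cbox 0 1) (\<lambda>a. integral (cbox 0 1) (\<lambda>b. f (?g (a, b))))"
    by (rule integral_prod_continuous) (rule continuous_on_compose2[OF assms continuous_on_subset[OF cg]], auto)
  finally show ?thesis by simp
qed

lemma integral_cis_int:
  "integral {0..1} (\<lambda>a. cis (2 * pi * real_of_int n * a)) = (if n = 0 then 1 else 0)"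
proof (cases "n = 0")
  case False
  define c where "c = 2 * pi * real_of_int n"
  have c: "c \<noteq> 0" using False by (simp add: c_def)
  have "((\<lambda>a. cis (c * a)) has_integral (cis (c * 1) / (\<i> * c) - cis (c * 0) / (\<i> * c))) {0..1}"
  proof (rule fundamental_theorem_of_calculus)
    fix x :: real
    show "((\<lambda>a. cis (c * a) / (\<i> * c)) has_vector_derivative cis (c * x)) (at x within {0..1})"
      unfolding has_vector_derivative_def
      by (rule derivative_eq_intros refl | simp)+ (use c in \<open>auto simp: scaleR_conv_of_real field_simps\<close>)
  qed simp
  moreover have "cis (c * 1) = 1" unfolding c_def by (simp only: mult_1_right) (rule cis_multiple_2pi, simp)
  ultimately have "((\<lambda>a. cis (c * a)) has_integral 0) {0..1}" by simp
  then show ?thesis using False by (simp add: c_def integral_unique)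
qed simp

lemma cis_freq_split: "cis (freq k \<bullet> vector [a, b]) = cis (2 * pi * real_of_int (k $ 1) * a) * cis (2 * pi * real_of_int (k $ 2) * b)"
  by (simp add: cis_mult inner_vec_def sum_2 freq_nth)

lemma integral_cis_freq: "integral (cbox 0 1) (\<lambda>x. cis (freq k \<bullet> x)) = (if k = 0 then 1 else 0)"
proof -
  have "integral (cbox 0 1) (\<lambda>x. cis (freq k \<bullet> x))
     = integral {0..1} (\<lambda>a. cis (2 * pi * real_of_int (k $ 1) * a)) * integral {0..1} (\<lambda>b. cis (2 * pi * real_of_int (k $ 2) * b))"
    by (subst integral_unit_square) (auto intro!: continuous_intros simp: cis_freq_split)
  then show ?thesis unfolding integral_cis_int by (auto simp: vec_eq_iff forall_2)
qed

lemma freq_diff: "freq (k - l) = freq k - freq l" by (simp add: vec_eq_iff algebra_simps freq_nth)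

lemma cis_freq_mult_cnj: "cis (freq k \<bullet> x) * cis (- (freq l \<bullet> x)) = cis (freq (k - l) \<bullet> x)"
  by (simp add: cis_mult freq_diff inner_diff_left)

lemma integral_cis_orthonormal:
  "integral (cbox 0 1) (\<lambda>x. cis (freq k \<bullet> x) * cis (- (freq l \<bullet> x))) = (if k = l then 1 else 0)"
  unfolding cis_freq_mult_cnj integral_cis_freq by simp

lemma norm_cis_diff_le: "norm (cis x - cis y) \<le> \<bar>x - y\<bar>"
proof -
  have "norm (cis x - cis y) \<le> 1 * norm (x - y)"
  proof (rule differentiable_bound[of UNIV cis "\<lambda>x h. h *\<^sub>R (\<i> * cis x)"])
    show "(cis has_derivative (\<lambda>h. h *\<^sub>R (\<i> * cis x))) (at x within UNIV)" for x
      by (rule derivative_eq_intros refl | simp)+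
    show "onorm (\<lambda>h. h *\<^sub>R (\<i> * cis x)) \<le> 1" for x
      by (rule onorm_le) (simp add: norm_mult)
  qed auto
  then show ?thesis by simp
qed

text \<open>Mean value inequality for cis x - i x, whose derivative i (cis y - 1) is at most |x|
  between -|x| and |x|. The quadratic remainder serves both the differentiability of Fourier series
  and the lower bound \<open>norm_cis_diff_ge\<close>.\<close>

lemma norm_cis_taylor: "norm (cis x - 1 - \<i> * of_real x) \<le> x^2"
proof -
  have "norm ((cis x - \<i> * of_real x) - (cis 0 - \<i> * of_real 0)) \<le> \<bar>x\<bar> * norm (x - 0)"
  proof (rule differentiable_bound[of "{-\<bar>x\<bar>..\<bar>x\<bar>}" "\<lambda>x. cis x - \<i> * of_real x" "\<lambda>x h. h *\<^sub>R (\<i> * (cis x - 1))"])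
    show "((\<lambda>x. cis x - \<i> * of_real x) has_derivative (\<lambda>h. h *\<^sub>R (\<i> * (cis y - 1)))) (at y within {-\<bar>x\<bar>..\<bar>x\<bar>})" for y
      by (rule derivative_eq_intros refl | simp)+ (simp add: scaleR_conv_of_real algebra_simps)
    show "onorm (\<lambda>h. h *\<^sub>R (\<i> * (cis y - 1))) \<le> \<bar>x\<bar>" if y: "y \<in> {-\<bar>x\<bar>..\<bar>x\<bar>}" for y
    proof (rule onorm_le)
      fix h :: real
      have "norm (cis y - 1) \<le> \<bar>x\<bar>" using norm_cis_diff_le[of y 0] y by auto
      then show "norm (h *\<^sub>R (\<i> * (cis y - 1))) \<le> \<bar>x\<bar> * norm h"
        by (simp add: norm_mult mult.commute mult_left_mono)
    qed
  qed auto
  then show ?thesis by (simp add: power2_eq_square algebra_simps)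
qed

section \<open>Synthesis of functions from Fourier coefficients, Bessel and Parseval bounds\<close>

definition csyn :: "(int^2 \<Rightarrow> complex) \<Rightarrow> real^2 \<Rightarrow> complex" where
  "csyn a x = (\<Sum>\<^sub>\<infinity>k. a k * cis (freq k \<bullet> x))"

definition syn :: "(int^2 \<Rightarrow> complex) \<Rightarrow> real^2 \<Rightarrow> real" where
  "syn a x = Re (csyn a x)"

text \<open>The series of \<open>syn a\<close> differentiated term by term; the real vector
  \<open>freq k\<close> is factored out so that the values lie in \<open>real^2\<close>.\<close>

definition gsyn :: "(int^2 \<Rightarrow> complex) \<Rightarrow> real^2 \<Rightarrow> real^2" where
  "gsyn a x = (\<Sum>\<^sub>\<infinity>k. Re (\<i> * a k * cis (freq k \<bullet> x)) *\<^sub>R freq k)"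

text \<open>The symmetry of the coefficients of a real function; under it the series is already real
  and \<open>syn\<close> discards nothing by taking the real part.\<close>

definition hermitian_coeffs :: "(int^2 \<Rightarrow> complex) \<Rightarrow> bool" where
  "hermitian_coeffs a \<longleftrightarrow> (\<forall>k. a (- k) = cnj (a k))"

text \<open>Coefficients of the distributional divergence of \<open>G\<close>, whose components need
  not be differentiable.\<close>

definition div_coef :: "(real^2 \<Rightarrow> real^2) \<Rightarrow> int^2 \<Rightarrow> complex" where
  "div_coef G k = \<i> * (\<Sum>j\<in>UNIV. complex_of_real (freq k $ j) * fcoef (\<lambda>y. G y $ j) k)"

lemma semigroup_eq_syn: "semigroup t f = syn (\<lambda>k. exp (- t * lam k) * fcoef f k)"
  by (rule ext) (simp add: semigroup_def syn_def csyn_def lam_def)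

lemma div_semigroup_eq_syn: "div_semigroup t G = syn (\<lambda>k. exp (- t * lam k) * div_coef G k)"
  by (rule ext) (simp add: div_semigroup_def syn_def csyn_def lam_def div_coef_def)

lemma csyn_summable:
  assumes "(\<lambda>k. norm (a k)) summable_on UNIV"
  shows "(\<lambda>k. a k * cis (freq k \<bullet> x)) summable_on UNIV"
  by (rule summable_on_norm_comparison(1)[OF assms]) (simp add: norm_mult)

lemma norm_csyn_le:
  assumes "(\<lambda>k. norm (a k)) summable_on UNIV"
  shows "norm (csyn a x) \<le> (\<Sum>\<^sub>\<infinity>k. norm (a k))"
  unfolding csyn_def by (rule summable_on_norm_comparison(2)[OF assms]) (simp add: norm_mult)

lemma abs_syn_le:
  assumes "(\<lambda>k. norm (a k)) summable_on UNIV"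
  shows "\<bar>syn a x\<bar> \<le> (\<Sum>\<^sub>\<infinity>k. norm (a k))"
  using norm_csyn_le[OF assms, of x] abs_Re_le_cmod[of "csyn a x"] by (simp add: syn_def)

lemma continuous_on_csyn:
  assumes "(\<lambda>k. norm (a k)) summable_on UNIV"
  shows "continuous_on S (csyn a)"
proof -
  have "uniform_limit S (\<lambda>X y. \<Sum>k\<in>X. a k * cis (freq k \<bullet> y)) (csyn a) (finite_subsets_at_top UNIV)"
    unfolding csyn_def by (rule Weierstrass_m_test_general[OF _ assms]) (simp add: norm_mult)
  then show ?thesis
    by (rule uniform_limit_theorem[rotated]) (auto intro!: always_eventually continuous_intros)
qed

lemma csyn_has_coeff:
  assumes "(\<lambda>k. norm (a k)) summable_on UNIV"
  shows "integral (cbox 0 1) (\<lambda>x. csyn a x * cis (- (freq l \<bullet> x))) = a l"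
proof -
  let ?f = "\<lambda>k x. a k * cis (freq k \<bullet> x) * cis (- (freq l \<bullet> x))"
  have i: "?f k integrable_on cbox 0 1" for k
    by (intro integrable_continuous continuous_intros)
  have "integral (cbox 0 1) (\<lambda>x. csyn a x * cis (- (freq l \<bullet> x))) = integral (cbox 0 1) (\<lambda>x. \<Sum>\<^sub>\<infinity>k. ?f k x)"
    by (simp add: csyn_def infsum_cmult_left')
  also have "\<dots> = (\<Sum>\<^sub>\<infinity>k. integral (cbox 0 1) (?f k))"
  proof (rule integral_infsum_dominated(3)[OF i, where g="\<lambda>_. \<Sum>\<^sub>\<infinity>k. norm (a k)"])
    show "(\<Sum>k\<in>F. norm (?f k x)) \<le> (\<Sum>\<^sub>\<infinity>k. norm (a k))" if "finite F" for F x
      using that assms by (auto simp: norm_mult intro!: finite_sum_le_infsum)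
  qed auto
  also have "\<dots> = (\<Sum>\<^sub>\<infinity>k. if k = l then a l else 0)"
    by (rule infsum_cong) (auto simp: mult.assoc integral_cis_orthonormal)
  also have "\<dots> = (\<Sum>\<^sub>\<infinity>k\<in>{l}. a l)" by (rule infsum_cong_neutral) auto
  finally show ?thesis by simp
qed

lemma csyn_eq_of_real_syn:
  assumes "hermitian_coeffs a"
  shows "csyn a x = of_real (syn a x)"
proof -
  have "cnj (csyn a x) = (\<Sum>\<^sub>\<infinity>k. cnj (a k * cis (freq k \<bullet> x)))" by (simp only: csyn_def infsum_cnj)
  also have "\<dots> = (\<Sum>\<^sub>\<infinity>k. a (- k) * cis (freq (- k) \<bullet> x))"
    using assms by (simp add: hermitian_coeffs_def freq_minus cis_cnj)
  also have "\<dots> = csyn a x"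
    unfolding csyn_def by (rule infsum_reindex_bij_witness[of _ uminus uminus]) auto
  finally show ?thesis by (simp add: syn_def complex_eq_iff)
qed

lemma fcoef_syn:
  assumes "hermitian_coeffs a" "(\<lambda>k. norm (a k)) summable_on UNIV"
  shows "fcoef (syn a) k = a k"
  using csyn_has_coeff[OF assms(2)] by (simp add: fcoef_def flip: csyn_eq_of_real_syn[OF assms(1)])

text \<open>True without integrability as well: conjugation preserves integrability in both
  directions, and otherwise both sides are the default value 0. The symmetry of \<open>fcoef\<close>
  is thereby unconditional.\<close>

lemma integral_cnj_HK: "integral S (\<lambda>x. cnj (f x)) = cnj (integral S f)"
proof (cases "f integrable_on S")
  case True
  then show ?thesis
    using integral_linear[OF True bounded_linear_cnj] by (simp add: o_def)
next
  case False
  have "\<not> (\<lambda>x. cnj (f x)) integrable_on S"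
  proof
    assume "(\<lambda>x. cnj (f x)) integrable_on S"
    from integrable_linear[OF this bounded_linear_cnj] False show False by (simp add: o_def)
  qed
  then show ?thesis using False by (simp add: not_integrable_integral)
qed

lemma fcoef_minus: "fcoef f (- k) = cnj (fcoef f k)"
proof -
  have "cnj (fcoef f k) = integral (cbox 0 1) (\<lambda>x. cnj (complex_of_real (f x) * cis (- (freq k \<bullet> x))))"
    unfolding fcoef_def by (simp only: integral_cnj_HK)
  then show ?thesis by (simp add: fcoef_def freq_minus cis_cnj)
qed

lemma hermitian_fcoef: "hermitian_coeffs (\<lambda>k. fcoef f k)"
  by (simp add: hermitian_coeffs_def fcoef_minus)

lemma hermitian_div_coef: "hermitian_coeffs (div_coef G)"
  by (simp add: hermitian_coeffs_def div_coef_def fcoef_minus sum_2 freq_minus algebra_simps)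

lemma hermitian_exp: "hermitian_coeffs a \<Longrightarrow> hermitian_coeffs (\<lambda>k. of_real (exp (c * lam k)) * a k)"
  by (simp add: hermitian_coeffs_def)

lemma div_coef_0 [simp]: "div_coef G 0 = 0" by (simp add: div_coef_def)

lemma periodic2_syn: "periodic2 (syn a)"
proof -
  have "cis (freq k \<bullet> (x + axis i 1)) = cis (freq k \<bullet> x)" for k x i
  proof -
    have "freq k \<bullet> (x + axis i 1) = freq k \<bullet> x + 2 * pi * real_of_int (k $ i)"
      by (simp add: inner_add_right inner_axis freq_nth)
    then show ?thesis by (simp flip: cis_mult)
  qed
  then show ?thesis by (simp add: periodic2_def syn_def csyn_def)
qed

lemma fcoef_bound:
  assumes "\<And>x. x \<in> cbox 0 1 \<Longrightarrow> \<bar>f x\<bar> \<le> M"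
  shows "norm (fcoef f k) \<le> M"
proof -
  have M: "0 \<le> M" using assms[of 0] by (simp add: mem_box_cart)
  show ?thesis
  proof (cases "(\<lambda>x. complex_of_real (f x) * cis (- (freq k \<bullet> x))) integrable_on cbox 0 1")
    case True
    then have "norm (fcoef f k) \<le> integral (cbox 0 (1::real^2)) (\<lambda>x. M)"
      unfolding fcoef_def by (intro integral_norm_bound_integral) (auto simp: norm_mult assms)
    then show ?thesis by simp
  next
    case False
    then show ?thesis unfolding fcoef_def using M by (simp add: not_integrable_integral)
  qed
qed

lemma integrable_mult_cis:
  assumes "f integrable_on cbox 0 (1::real^2)" "\<And>x. x \<in> cbox 0 1 \<Longrightarrow> norm (f x :: complex) \<le> M"
    and c: "continuous_on (cbox 0 1) g" and g: "\<And>x. x \<in> cbox 0 1 \<Longrightarrow> norm (g x :: complex) \<le> K"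
  shows "(\<lambda>x. f x * g x) integrable_on cbox 0 1"
proof (rule measurable_bounded_by_integrable_imp_integrable[where g="\<lambda>_. M * K"])
  have "f \<in> borel_measurable (lebesgue_on (cbox 0 1))" by (rule integrable_imp_measurable[OF assms(1)])
  moreover have "g \<in> borel_measurable (lebesgue_on (cbox 0 1))"
    using integrable_imp_measurable[OF integrable_continuous[OF c]] .
  ultimately show "(\<lambda>x. f x * g x) \<in> borel_measurable (lebesgue_on (cbox 0 1))" by simp
  show "norm (f x * g x) \<le> M * K" if "x \<in> cbox 0 1" for x
    using assms(2)[OF that] g[OF that] order_trans[OF norm_ge_zero assms(2)[OF that]]
    unfolding norm_mult by (intro mult_mono) auto
qed auto

text \<open>Multiplying back by the conjugate character would recover \<open>f\<close> as an
  integrable function. Hence no product with a character is integrable and every coefficient takes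
  the default value 0.\<close>

lemma fcoef_nonintegrable:
  assumes "\<not> f integrable_on cbox 0 1" and b: "\<And>x. x \<in> cbox 0 1 \<Longrightarrow> \<bar>f x\<bar> \<le> M"
  shows "fcoef f k = 0"
proof -
  have "\<not> (\<lambda>x. complex_of_real (f x) * cis (- (freq k \<bullet> x))) integrable_on cbox 0 1"
  proof
    assume i: "(\<lambda>x. complex_of_real (f x) * cis (- (freq k \<bullet> x))) integrable_on cbox 0 1"
    have "(\<lambda>x. (complex_of_real (f x) * cis (- (freq k \<bullet> x))) * cis (freq k \<bullet> x)) integrable_on cbox 0 1"
      by (rule integrable_mult_cis[OF i, where M=M and K=1]) (auto simp: norm_mult b intro!: continuous_intros)
    then have "(\<lambda>x. complex_of_real (f x)) integrable_on cbox 0 1"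
      by (simp add: mult.assoc cis_mult)
    from integrable_linear[OF this bounded_linear_Re] assms show False by (simp add: o_def)
  qed
  then show ?thesis by (simp add: fcoef_def not_integrable_integral)
qed

lemma fcoef_integrable:
  assumes "f integrable_on cbox 0 1" and b: "\<And>x. x \<in> cbox 0 1 \<Longrightarrow> \<bar>f x\<bar> \<le> M"
  shows "(\<lambda>x. complex_of_real (f x) * cis (- (freq k \<bullet> x))) integrable_on cbox 0 1"
proof (rule integrable_mult_cis[where M=M and K=1])
  show "(\<lambda>x. complex_of_real (f x)) integrable_on cbox 0 1"
    using integrable_linear[OF assms(1) bounded_linear_of_real] by (simp add: o_def)
qed (auto simp: b intro!: continuous_intros)

lemma integral_norm2_trig_poly:
  assumes "finite F"
  shows "integral (cbox 0 1) (\<lambda>x. (norm (\<Sum>k\<in>F. c k * cis (freq k \<bullet> x)))^2) = (\<Sum>k\<in>F. (norm (c k))^2)"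
proof -
  have "complex_of_real (integral (cbox 0 1) (\<lambda>x. (norm (\<Sum>k\<in>F. c k * cis (freq k \<bullet> x)))^2))
     = integral (cbox 0 1) (\<lambda>x. complex_of_real ((norm (\<Sum>k\<in>F. c k * cis (freq k \<bullet> x)))^2))"
  proof -
    have "(\<lambda>x. (norm (\<Sum>k\<in>F. c k * cis (freq k \<bullet> x)))^2) integrable_on cbox 0 (1::real^2)"
      by (intro integrable_continuous continuous_intros)
    from integral_linear[OF this bounded_linear_of_real[where 'a=complex]] show ?thesis by (simp add: o_def)
  qed
  also have "\<dots> = integral (cbox 0 1) (\<lambda>x. \<Sum>k\<in>F. \<Sum>l\<in>F. (c k * cnj (c l)) * (cis (freq k \<bullet> x) * cis (- (freq l \<bullet> x))))"
    by (simp only: complex_norm_square) (simp add: sum_product cis_cnj mult_ac)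
  also have "\<dots> = (\<Sum>k\<in>F. \<Sum>l\<in>F. (c k * cnj (c l)) * (if k = l then 1 else 0))"
    by (subst integral_sum integral_mult_right integral_cis_orthonormal | rule assms integrable_sum integrable_continuous continuous_intros sum.cong refl)+
  also have "\<dots> = (\<Sum>k\<in>F. complex_of_real ((norm (c k))^2))"
    using assms by (simp add: complex_norm_square[symmetric] if_distrib sum.delta cong: if_cong)
  also have "\<dots> = complex_of_real (\<Sum>k\<in>F. (norm (c k))^2)" by simp
  finally show ?thesis by (simp only: of_real_eq_iff)
qed

text \<open>Expansion of the nonnegative integral of |f - P|^2, where P is the partial Fourier sum
  over \<open>F\<close>; the integral of f times the conjugate of P and that of |P|^2 both equal the
  sum of the squared coefficients.\<close>

lemma bessel:
  assumes i: "f integrable_on cbox 0 1" and b: "\<And>x. x \<in> cbox 0 1 \<Longrightarrow> \<bar>f x\<bar> \<le> M" and F: "finite F"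
  shows "(\<Sum>k\<in>F. (norm (fcoef f k))^2) \<le> integral (cbox 0 1) (\<lambda>x. (f x)^2)"
proof -
  define P where "P x = (\<Sum>k\<in>F. fcoef f k * cis (freq k \<bullet> x))" for x
  let ?S = "\<Sum>k\<in>F. (norm (fcoef f k))^2"
  have cP: "continuous_on S P" for S unfolding P_def by (intro continuous_intros)
  have f2: "(\<lambda>x. (f x)^2) integrable_on cbox 0 1"
  proof (rule measurable_bounded_by_integrable_imp_integrable_real[where g="\<lambda>_. M^2"])
    show "(\<lambda>x. (f x)^2) \<in> borel_measurable (lebesgue_on (cbox 0 1))"
      using integrable_imp_measurable[OF i] by simp
    show "\<bar>(f x)^2\<bar> \<le> M^2" if "x \<in> cbox 0 1" for x
      using power_mono[OF b[OF that], of 2] by simp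
  qed auto
  have ik: "(\<lambda>x. complex_of_real (f x) * cis (- (freq k \<bullet> x))) integrable_on cbox 0 1" for k
    by (rule fcoef_integrable[OF i b])
  have fP: "(\<lambda>x. complex_of_real (f x) * cnj (P x)) integrable_on cbox 0 1"
    and fPi: "integral (cbox 0 1) (\<lambda>x. complex_of_real (f x) * cnj (P x)) = of_real ?S"
  proof -
    have e: "complex_of_real (f x) * cnj (P x) = (\<Sum>k\<in>F. cnj (fcoef f k) * (complex_of_real (f x) * cis (- (freq k \<bullet> x))))" for x
      by (simp add: P_def sum_distrib_left cis_cnj mult_ac)
    show "(\<lambda>x. complex_of_real (f x) * cnj (P x)) integrable_on cbox 0 1"
      unfolding e by (intro integrable_sum F integrable_on_mult_right ik)
    have "integral (cbox 0 1) (\<lambda>x. complex_of_real (f x) * cnj (P x)) = (\<Sum>k\<in>F. cnj (fcoef f k) * fcoef f k)"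
      unfolding e by (subst integral_sum) (auto intro!: F integrable_on_mult_right ik simp: fcoef_def)
    also have "\<dots> = of_real ?S" by (simp add: complex_norm_square mult.commute del: of_real_power)
    finally show "integral (cbox 0 1) (\<lambda>x. complex_of_real (f x) * cnj (P x)) = of_real ?S" .
  qed
  have R: "(\<lambda>x. Re (complex_of_real (f x) * cnj (P x))) integrable_on cbox 0 1"
    "integral (cbox 0 1) (\<lambda>x. Re (complex_of_real (f x) * cnj (P x))) = ?S"
    using integrable_linear[OF fP bounded_linear_Re] integral_linear[OF fP bounded_linear_Re] fPi by (simp_all add: o_def)
  have P2: "(\<lambda>x. (norm (P x))^2) integrable_on cbox 0 1"
    by (intro integrable_continuous continuous_intros cP)
  have e: "(f x)^2 - 2 * Re (complex_of_real (f x) * cnj (P x)) + (norm (P x))^2 = (norm (complex_of_real (f x) - P x))^2" for x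
    unfolding cmod_power2 by (simp add: power2_eq_square algebra_simps)
  have "0 \<le> integral (cbox 0 1) (\<lambda>x. (f x)^2 - 2 * Re (complex_of_real (f x) * cnj (P x)) + (norm (P x))^2)"
    unfolding e
  proof (rule integral_nonneg)
    show "(\<lambda>x. (norm (complex_of_real (f x) - P x))^2) integrable_on cbox 0 1"
      unfolding e[symmetric] by (intro integrable_add integrable_diff integrable_on_mult_right f2 R P2)
  qed simp
  also have "\<dots> = integral (cbox 0 1) (\<lambda>x. (f x)^2) - 2 * ?S + ?S"
    using integral_norm2_trig_poly[OF F, of "fcoef f"]
    by (subst integral_add integral_diff integral_mult_right | intro integrable_add integrable_diff integrable_on_mult_right f2 R P2)+
       (simp only: R(2), simp add: P_def)
  finally show ?thesis by simp
qed

text \<open>Boundedness alone suffices: if \<open>f\<close> is not integrable, its coefficients are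
  all 0. The nonlinearity of a Lipschitz function can thus be estimated before anything is known
  about the measurability of its gradient.\<close>

lemma bessel_bounded:
  assumes b: "\<And>x. x \<in> cbox 0 1 \<Longrightarrow> \<bar>f x\<bar> \<le> M" and F: "finite F"
  shows "(\<Sum>k\<in>F. (norm (fcoef f k))^2) \<le> M^2"
proof (cases "f integrable_on cbox 0 1")
  case True
  have "(\<Sum>k\<in>F. (norm (fcoef f k))^2) \<le> integral (cbox 0 1) (\<lambda>x. (f x)^2)"
    by (rule bessel[OF True b F])
  also have "\<dots> \<le> integral (cbox 0 (1::real^2)) (\<lambda>x. M^2)"
  proof (rule integral_le)
    show "(f x)^2 \<le> M^2" if "x \<in> cbox 0 1" for x
      using power_mono[OF b[OF that], of 2] by simp
    show "(\<lambda>x. (f x)^2) integrable_on cbox 0 1"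
      by (rule measurable_bounded_by_integrable_imp_integrable_real[where g="\<lambda>_. M^2"])
         (use integrable_imp_measurable[OF True] power_mono[OF b, of _ 2] in auto)
  qed auto
  finally show ?thesis by simp
next
  case False
  then show ?thesis by (simp add: fcoef_nonintegrable[OF False b])
qed

text \<open>Parseval for the partial sums along an enumeration, passed to the limit by dominated
  convergence with a constant majorant, the squared l^1 norm.\<close>

lemma integral_norm2_csyn_le:
  assumes s: "(\<lambda>k. norm (b k)) summable_on UNIV"
    and B: "\<And>F. finite F \<Longrightarrow> (\<Sum>k\<in>F. (norm (b k))^2) \<le> B"
  shows "integral (cbox 0 1) (\<lambda>x. (norm (csyn b x))^2) \<le> B"
proof -
  obtain \<phi> :: "nat \<Rightarrow> int^2" where bij: "bij \<phi>" by (rule int2_enumeration)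
  let ?P = "\<lambda>n x. \<Sum>k\<in>\<phi> ` {..<n}. b k * cis (freq k \<bullet> x)"
  let ?K = "\<Sum>\<^sub>\<infinity>k. norm (b k)"
  have inj: "inj_on \<phi> {..<n}" for n using bij by (meson bij_is_inj inj_on_subset subset_UNIV)
  have lim: "(\<lambda>n. ?P n x) \<longlonglongrightarrow> csyn b x" for x
  proof -
    have "((\<lambda>k. b k * cis (freq k \<bullet> x)) has_sum csyn b x) UNIV"
      unfolding csyn_def by (rule has_sum_infsum[OF csyn_summable[OF s]])
    then have "((\<lambda>i. b (\<phi> i) * cis (freq (\<phi> i) \<bullet> x)) has_sum csyn b x) UNIV"
      using has_sum_reindex_bij_betw[OF bij, of "\<lambda>k. b k * cis (freq k \<bullet> x)"] by simp
    then have "(\<lambda>n. \<Sum>i<n. b (\<phi> i) * cis (freq (\<phi> i) \<bullet> x)) \<longlonglongrightarrow> csyn b x"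
      using has_sum_imp_sums sums_def by blast
    then show ?thesis by (simp add: sum.reindex[OF inj])
  qed
  have "(\<lambda>n. integral (cbox 0 1) (\<lambda>x. (norm (?P n x))^2)) \<longlonglongrightarrow> integral (cbox 0 1) (\<lambda>x. (norm (csyn b x))^2)"
  proof (rule dominated_convergence(2)[where h="\<lambda>_. ?K^2"])
    show "(\<lambda>x. (norm (?P n x))^2) integrable_on cbox 0 1" for n
      by (intro integrable_continuous continuous_intros)
    show "norm ((norm (?P n x))^2) \<le> ?K^2" for n x
    proof -
      have "norm (?P n x) \<le> (\<Sum>k\<in>\<phi> ` {..<n}. norm (b k * cis (freq k \<bullet> x)))" by (rule norm_sum)
      also have "\<dots> \<le> ?K" using s by (auto simp: norm_mult intro!: finite_sum_le_infsum)
      finally show ?thesis by (simp add: power_mono)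
    qed
    show "(\<lambda>n. (norm (?P n x))^2) \<longlonglongrightarrow> (norm (csyn b x))^2" for x
      by (intro tendsto_intros lim)
  qed auto
  then show ?thesis
    by (rule LIMSEQ_le_const2) (auto simp: integral_norm2_trig_poly B)
qed

section \<open>Series whose gradient converges absolutely\<close>

lemma weighted_summableD:
  fixes a :: "int^2 \<Rightarrow> complex"
  assumes "(\<lambda>k. (1 + norm (freq k)) * norm (a k)) summable_on UNIV"
  shows "(\<lambda>k. norm (a k)) summable_on UNIV" "(\<lambda>k. norm (freq k) * norm (a k)) summable_on UNIV"
  by (rule summable_on_real_comparison[OF assms]; simp add: algebra_simps)+

text \<open>Only the zero mode escapes the weight: all other wave vectors have length at least
  1.\<close>

lemma weighted_summableI:
  fixes a :: "int^2 \<Rightarrow> complex"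
  assumes "(\<lambda>k. norm (freq k) * norm (a k)) summable_on UNIV"
  shows "(\<lambda>k. (1 + norm (freq k)) * norm (a k)) summable_on UNIV"
proof -
  have "(\<lambda>k. 2 * (norm (freq k) * norm (a k))) summable_on UNIV"
    by (rule summable_on_cmult_right[OF assms])
  moreover have "(\<lambda>k. (if k = 0 then norm (a 0) else 0)) summable_on UNIV"
    by (rule finite_nonzero_values_imp_summable_on) (auto intro: finite_subset[of _ "{0}"])
  ultimately have s: "(\<lambda>k. 2 * (norm (freq k) * norm (a k)) + (if k = 0 then norm (a 0) else 0)) summable_on UNIV"
    by (rule summable_on_add)
  show ?thesis
  proof (rule summable_on_real_comparison[OF s])
    fix k
    show "(1 + norm (freq k)) * norm (a k) \<le> 2 * (norm (freq k) * norm (a k)) + (if k = 0 then norm (a 0) else 0)"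
    proof (cases "k = 0")
      case False
      then have "norm (a k) \<le> norm (freq k) * norm (a k)"
        using mult_right_mono[OF norm_freq_ge_1, of k "norm (a k)"] by simp
      then show ?thesis using False by (simp add: algebra_simps)
    qed simp
  qed auto
qed

lemma gsyn_summable:
  assumes "(\<lambda>k. norm (freq k) * norm (a k)) summable_on UNIV"
  shows "(\<lambda>k. Re (\<i> * a k * cis (freq k \<bullet> x)) *\<^sub>R freq k) summable_on UNIV"
    and "norm (gsyn a x) \<le> (\<Sum>\<^sub>\<infinity>k. norm (freq k) * norm (a k))"
proof -
  have b: "norm (Re (\<i> * a k * cis (freq k \<bullet> x)) *\<^sub>R freq k) \<le> norm (freq k) * norm (a k)" for k
    using mult_right_mono[OF abs_Re_le_cmod[of "\<i> * a k * cis (freq k \<bullet> x)"], of "norm (freq k)"]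
    by (simp only: norm_scaleR norm_mult) (simp add: mult.commute)
  show "(\<lambda>k. Re (\<i> * a k * cis (freq k \<bullet> x)) *\<^sub>R freq k) summable_on UNIV"
    "norm (gsyn a x) \<le> (\<Sum>\<^sub>\<infinity>k. norm (freq k) * norm (a k))"
    unfolding gsyn_def using summable_on_norm_comparison[OF assms b] by auto
qed

lemma gsyn_nth:
  assumes "(\<lambda>k. norm (freq k) * norm (a k)) summable_on UNIV"
  shows "gsyn a x $ j = Re (csyn (\<lambda>k. \<i> * freq k $ j * a k) x)"
    and "(\<lambda>k. norm (\<i> * freq k $ j * a k)) summable_on UNIV"
proof -
  have n: "norm (\<i> * freq k $ j * a k) \<le> norm (freq k) * norm (a k)" for k
    using mult_right_mono[OF component_le_norm_cart[of "freq k" j], of "norm (a k)"]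
    by (simp add: norm_mult)
  show s: "(\<lambda>k. norm (\<i> * freq k $ j * a k)) summable_on UNIV"
    by (rule summable_on_real_comparison[OF assms _ n]) simp
  have "gsyn a x $ j = (\<Sum>\<^sub>\<infinity>k. (Re (\<i> * a k * cis (freq k \<bullet> x)) *\<^sub>R freq k) $ j)"
    unfolding gsyn_def
    by (rule infsumI[symmetric], rule has_sum_bounded_linear[OF bounded_linear_vec_nth has_sum_infsum[OF gsyn_summable(1)[OF assms]]])
  also have "\<dots> = (\<Sum>\<^sub>\<infinity>k. Re (\<i> * freq k $ j * a k * cis (freq k \<bullet> x)))"
    by (rule infsum_cong) (simp add: algebra_simps)
  also have "\<dots> = Re (csyn (\<lambda>k. \<i> * freq k $ j * a k) x)"
    unfolding csyn_def by (rule infsum_Re) (rule csyn_summable[OF s])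
  finally show "gsyn a x $ j = Re (csyn (\<lambda>k. \<i> * freq k $ j * a k) x)" .
qed

lemma continuous_on_gsyn:
  assumes "(\<lambda>k. norm (freq k) * norm (a k)) summable_on UNIV"
  shows "continuous_on S (gsyn a)"
proof -
  have "gsyn a = (\<lambda>x. \<chi> j. Re (csyn (\<lambda>k. \<i> * freq k $ j * a k) x))"
    by (rule ext) (simp add: vec_eq_iff gsyn_nth[OF assms])
  then show ?thesis
    using gsyn_nth(2)[OF assms] by (auto intro!: continuous_on_vec_lambda continuous_intros continuous_on_csyn)
qed

lemma gsyn_diff:
  assumes "(\<lambda>k. norm (freq k) * norm (a k)) summable_on UNIV" "(\<lambda>k. norm (freq k) * norm (b k)) summable_on UNIV"
  shows "gsyn a x - gsyn b x = gsyn (\<lambda>k. a k - b k) x"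
  unfolding gsyn_def infsum_diff_banach[OF gsyn_summable(1)[OF assms(1)] gsyn_summable(1)[OF assms(2)]]
  by (rule infsum_cong) (simp add: algebra_simps)

lemma syn_diff:
  assumes "(\<lambda>k. norm (a k)) summable_on UNIV" "(\<lambda>k. norm (b k)) summable_on UNIV"
  shows "syn a x - syn b x = syn (\<lambda>k. a k - b k) x"
proof -
  have "csyn a x - csyn b x = csyn (\<lambda>k. a k - b k) x"
    unfolding csyn_def infsum_diff_banach[OF csyn_summable[OF assms(1)] csyn_summable[OF assms(2)]]
    by (rule infsum_cong) (simp add: algebra_simps)
  then show ?thesis by (metis syn_def minus_complex.simps(1))
qed

lemma summable_diff_weighted:
  fixes a b :: "int^2 \<Rightarrow> complex"
  assumes "(\<lambda>k. w k * norm (a k)) summable_on UNIV" "(\<lambda>k. w k * norm (b k)) summable_on UNIV" "\<And>k. 0 \<le> w k"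
  shows "(\<lambda>k. w k * norm (a k - b k)) summable_on UNIV"
proof (rule summable_on_real_comparison[OF summable_on_add[OF assms(1,2)]])
  fix k
  have "w k * norm (a k - b k) \<le> w k * (norm (a k) + norm (b k))"
    by (intro mult_left_mono norm_triangle_ineq4 assms)
  then show "w k * norm (a k - b k) \<le> w k * norm (a k) + w k * norm (b k)" by (simp add: algebra_simps)
qed (use assms in auto)

text \<open>Each of the two components of the gradient has coefficients below |k| |a_k| and
  contributes at most \<open>B\<close>.\<close>

lemma integral_norm2_gsyn_le:
  assumes s: "(\<lambda>k. norm (freq k) * norm (a k)) summable_on UNIV"
    and B: "\<And>F. finite F \<Longrightarrow> (\<Sum>k\<in>F. (norm (freq k) * norm (a k))^2) \<le> B"
  shows "integral (cbox 0 1) (\<lambda>x. (norm (gsyn a x))^2) \<le> 2 * B"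
proof -
  let ?b = "\<lambda>j k. \<i> * freq k $ j * a k"
  have c: "continuous_on S (\<lambda>x. (norm (csyn (?b j) x))^2)" for S j
    by (intro continuous_intros continuous_on_csyn gsyn_nth(2)[OF s])
  have j: "integral (cbox 0 1) (\<lambda>x. (norm (csyn (?b j) x))^2) \<le> B" for j
  proof (rule integral_norm2_csyn_le[OF gsyn_nth(2)[OF s]])
    fix F :: "(int^2) set" assume F: "finite F"
    have "(\<Sum>k\<in>F. (norm (?b j k))^2) \<le> (\<Sum>k\<in>F. (norm (freq k) * norm (a k))^2)"
    proof (intro sum_mono power_mono)
      fix k show "norm (?b j k) \<le> norm (freq k) * norm (a k)"
        using mult_right_mono[OF component_le_norm_cart[of "freq k" j], of "norm (a k)"] by (simp add: norm_mult)
    qed simp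
    then show "(\<Sum>k\<in>F. (norm (?b j k))^2) \<le> B" using B[OF F] by linarith
  qed
  have "integral (cbox 0 1) (\<lambda>x. (norm (gsyn a x))^2)
     \<le> integral (cbox 0 1) (\<lambda>x. (norm (csyn (?b 1) x))^2 + (norm (csyn (?b 2) x))^2)"
  proof (rule integral_le)
    show "(norm (gsyn a x))^2 \<le> (norm (csyn (?b 1) x))^2 + (norm (csyn (?b 2) x))^2" for x
    proof -
      have "(norm (gsyn a x))^2 = (gsyn a x $ 1)^2 + (gsyn a x $ 2)^2"
        unfolding power2_norm_eq_inner inner_vec_def by (simp add: sum_2 power2_eq_square)
      also have "\<dots> \<le> (norm (csyn (?b 1) x))^2 + (norm (csyn (?b 2) x))^2"
        unfolding gsyn_nth(1)[OF s] cmod_power2 by (intro add_mono) auto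
      finally show ?thesis .
    qed
  qed (auto intro!: integrable_continuous continuous_intros continuous_on_gsyn[OF s] continuous_on_csyn gsyn_nth(2)[OF s])
  also have "\<dots> = integral (cbox 0 1) (\<lambda>x. (norm (csyn (?b 1) x))^2) + integral (cbox 0 1) (\<lambda>x. (norm (csyn (?b 2) x))^2)"
    by (intro integral_add integrable_continuous c)
  finally show ?thesis using j[of 1] j[of 2] by linarith
qed

text \<open>The first-order Taylor remainder of each mode, divided by |h|, tends to 0 by the
  quadratic bound and is dominated by 2 |k| |a_k| by the linear bound, so dominated convergence asks
  for one summable derivative and not two.\<close>

lemma syn_has_derivative:
  assumes "(\<lambda>k. (1 + norm (freq k)) * norm (a k)) summable_on UNIV"
  shows "(syn a has_derivative (\<lambda>h. gsyn a x \<bullet> h)) (at x)"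
proof -
  note s = weighted_summableD[OF assms]
  let ?d = "\<lambda>h k. norm (a k) * (norm (cis (freq k \<bullet> h) - 1 - \<i> * of_real (freq k \<bullet> h)) / norm h)"
  have dle: "norm (cis (freq k \<bullet> h) - 1 - \<i> * of_real (freq k \<bullet> h)) \<le> 2 * norm (freq k) * norm h" for k h
  proof -
    have "norm (cis (freq k \<bullet> h) - 1 - \<i> * of_real (freq k \<bullet> h)) \<le> norm (cis (freq k \<bullet> h) - cis 0) + norm (\<i> * of_real (freq k \<bullet> h) :: complex)"
      using norm_triangle_ineq4[of "cis (freq k \<bullet> h) - 1"] by simp
    also have "\<dots> \<le> 2 * \<bar>freq k \<bullet> h\<bar>" using norm_cis_diff_le[of "freq k \<bullet> h" 0] by (simp add: norm_mult)
    also have "\<dots> \<le> 2 * (norm (freq k) * norm h)" by (intro mult_left_mono Cauchy_Schwarz_ineq2) auto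
    finally show ?thesis by simp
  qed
  have dle': "?d h k \<le> 2 * (norm (freq k) * norm (a k))" if "h \<noteq> 0" for h k
  proof -
    have "norm (cis (freq k \<bullet> h) - 1 - \<i> * of_real (freq k \<bullet> h)) / norm h \<le> 2 * norm (freq k)"
      using dle[of k h] that by (simp add: divide_le_eq)
    from mult_left_mono[OF this, of "norm (a k)"] show ?thesis by (simp add: mult_ac)
  qed
  have lim: "((\<lambda>h. ?d h k) \<longlongrightarrow> 0) (at 0)" for k
  proof (rule Lim_null_comparison)
    have "((\<lambda>h::real^2. norm (a k) * (norm (freq k))^2 * norm h) \<longlongrightarrow> norm (a k) * (norm (freq k))^2 * norm (0::real^2)) (at 0)"
      by (intro tendsto_intros tendsto_norm tendsto_ident_at)
    then show "((\<lambda>h::real^2. norm (a k) * (norm (freq k))^2 * norm h) \<longlongrightarrow> 0) (at 0)" by simp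
    have "norm (?d h k) \<le> norm (a k) * (norm (freq k))^2 * norm h" if "h \<noteq> 0" for h
    proof -
      have "norm (cis (freq k \<bullet> h) - 1 - \<i> * of_real (freq k \<bullet> h)) \<le> \<bar>freq k \<bullet> h\<bar>^2" using norm_cis_taylor by simp
      also have "\<dots> \<le> (norm (freq k) * norm h)^2" by (intro power_mono Cauchy_Schwarz_ineq2) auto
      finally have "norm (cis (freq k \<bullet> h) - 1 - \<i> * of_real (freq k \<bullet> h)) / norm h \<le> (norm (freq k))^2 * norm h"
        using that by (simp add: divide_le_eq power2_eq_square mult_ac)
      from mult_left_mono[OF this, of "norm (a k)"] show ?thesis by (simp add: mult_ac)
    qed
    then show "\<forall>\<^sub>F h in at 0. norm (?d h k) \<le> norm (a k) * (norm (freq k))^2 * norm h"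
      by (auto simp: eventually_at_filter)
  qed
  have lim0: "((\<lambda>h. infsum (?d h) UNIV) \<longlongrightarrow> 0) (at 0)"
    by (rule infsum_tendsto_zero_dominated[OF lim _ summable_on_cmult_right[OF s(2), of 2]])
       (use dle' in \<open>auto simp: eventually_at_filter\<close>)
  have le: "norm (syn a (x + h) - syn a x - gsyn a x \<bullet> h) / norm h \<le> infsum (?d h) UNIV" if "h \<noteq> 0" for h
  proof -
    let ?t = "\<lambda>k. a k * cis (freq k \<bullet> x) * (cis (freq k \<bullet> h) - 1 - \<i> * of_real (freq k \<bullet> h))"
    have ds: "?d h summable_on UNIV"
      by (rule summable_on_real_comparison[OF summable_on_cmult_right[OF s(2), of 2] _ dle'[OF that]]) simp
    have tn: "norm (?t k) \<le> norm h * ?d h k" for k using that by (simp add: norm_mult)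
    have ts: "?t summable_on UNIV" "norm (infsum ?t UNIV) \<le> norm h * infsum (?d h) UNIV"
      using summable_on_norm_comparison[OF summable_on_cmult_right[OF ds, of "norm h"] tn] by (simp_all only: infsum_cmult_right')
    have g: "gsyn a x \<bullet> h = (\<Sum>\<^sub>\<infinity>k. Re (\<i> * a k * cis (freq k \<bullet> x)) * (freq k \<bullet> h))"
      unfolding gsyn_def
      using infsumI[OF has_sum_bounded_linear[OF bounded_linear_inner_left[of h] has_sum_infsum[OF gsyn_summable(1)[OF s(2), of x]]]]
      by (simp only: inner_scaleR_left)
    have gs: "(\<lambda>k. Re (\<i> * a k * cis (freq k \<bullet> x)) * (freq k \<bullet> h)) summable_on UNIV"
      using summable_on_bounded_linear[OF bounded_linear_inner_left[of h] gsyn_summable(1)[OF s(2), of x]] by simp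
    have r: "syn a y = (\<Sum>\<^sub>\<infinity>k. Re (a k * cis (freq k \<bullet> y)))" "(\<lambda>k. Re (a k * cis (freq k \<bullet> y))) summable_on UNIV" for y
      unfolding syn_def csyn_def using infsum_Re[OF csyn_summable[OF s(1)]] summable_on_Re[OF csyn_summable[OF s(1)]] by auto
    have "syn a (x + h) - syn a x - gsyn a x \<bullet> h
       = (\<Sum>\<^sub>\<infinity>k. Re (a k * cis (freq k \<bullet> (x + h))) - Re (a k * cis (freq k \<bullet> x)) - Re (\<i> * a k * cis (freq k \<bullet> x)) * (freq k \<bullet> h))"
      unfolding r(1) g infsum_diff_banach[OF r(2) r(2)]
    proof (rule infsum_diff_banach[OF _ gs])
      have "(\<lambda>k. Re (a k * cis (freq k \<bullet> (x + h))) + - Re (a k * cis (freq k \<bullet> x))) summable_on UNIV"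
        by (intro summable_on_add r(2) summable_on_uminus[THEN iffD2])
      then show "(\<lambda>k. Re (a k * cis (freq k \<bullet> (x + h))) - Re (a k * cis (freq k \<bullet> x))) summable_on UNIV"
        by (simp only: add_uminus_conv_diff)
    qed
    also have "\<dots> = (\<Sum>\<^sub>\<infinity>k. Re (?t k))"
      by (rule infsum_cong) (simp add: inner_add_right algebra_simps flip: cis_mult)
    also have "\<dots> = Re (infsum ?t UNIV)" by (rule infsum_Re[OF ts(1)])
    finally have "\<bar>syn a (x + h) - syn a x - gsyn a x \<bullet> h\<bar> \<le> norm h * infsum (?d h) UNIV"
      using abs_Re_le_cmod[of "infsum ?t UNIV"] ts(2) by linarith
    then show ?thesis using that by (simp add: divide_le_eq mult.commute)
  qed
  have "((\<lambda>h. norm (syn a (x + h) - syn a x - gsyn a x \<bullet> h) / norm h) \<longlongrightarrow> 0) (at 0)"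
  proof (rule tendsto_sandwich[OF _ _ tendsto_const lim0])
    show "\<forall>\<^sub>F h in at 0. 0 \<le> norm (syn a (x + h) - syn a x - gsyn a x \<bullet> h) / norm h"
      by (rule always_eventually) (intro allI divide_nonneg_nonneg norm_ge_zero)
    show "\<forall>\<^sub>F h in at 0. norm (syn a (x + h) - syn a x - gsyn a x \<bullet> h) / norm h \<le> infsum (?d h) UNIV"
      unfolding eventually_at_filter by (rule always_eventually) (intro allI impI le)
  qed
  then show ?thesis unfolding has_derivative_at by (intro conjI bounded_linear_inner_right)
qed

lemma grad_eq:
  assumes "(f has_derivative (\<lambda>h. g \<bullet> h)) (at x)"
  shows "grad f x = g"
proof -
  have "f differentiable (at x)" using assms unfolding differentiable_def by blast
  moreover have "frechet_derivative f (at x) = (\<lambda>h. g \<bullet> h)" by (rule frechet_derivative_at[OF assms, symmetric])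
  ultimately show ?thesis by (simp add: grad_def vec_eq_iff inner_axis)
qed

lemma grad_syn:
  assumes "(\<lambda>k. (1 + norm (freq k)) * norm (a k)) summable_on UNIV"
  shows "grad (syn a) = gsyn a"
  by (rule ext) (rule grad_eq[OF syn_has_derivative[OF assms]])

lemma syn_lipschitz:
  assumes "(\<lambda>k. (1 + norm (freq k)) * norm (a k)) summable_on UNIV"
  shows "\<bar>syn a x - syn a y\<bar> \<le> (\<Sum>\<^sub>\<infinity>k. norm (freq k) * norm (a k)) * dist x y"
proof -
  note s = weighted_summableD[OF assms]
  have "csyn a x - csyn a y = (\<Sum>\<^sub>\<infinity>k. a k * cis (freq k \<bullet> x) - a k * cis (freq k \<bullet> y))"
    unfolding csyn_def by (rule infsum_diff_banach) (rule csyn_summable[OF s(1)])+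
  also have "norm \<dots> \<le> (\<Sum>\<^sub>\<infinity>k. norm (freq k) * norm (a k) * dist x y)"
  proof (rule summable_on_norm_comparison(2)[OF summable_on_cmult_left[OF s(2)]])
    fix k
    have "norm (cis (freq k \<bullet> x) - cis (freq k \<bullet> y)) \<le> \<bar>freq k \<bullet> (x - y)\<bar>"
      using norm_cis_diff_le by (simp add: inner_diff_right)
    also have "\<dots> \<le> norm (freq k) * dist x y" unfolding dist_norm by (rule Cauchy_Schwarz_ineq2)
    finally have "norm (a k) * norm (cis (freq k \<bullet> x) - cis (freq k \<bullet> y)) \<le> norm (a k) * (norm (freq k) * dist x y)"
      by (intro mult_left_mono) auto
    then show "norm (a k * cis (freq k \<bullet> x) - a k * cis (freq k \<bullet> y)) \<le> norm (freq k) * norm (a k) * dist x y"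
      by (simp add: norm_mult mult_ac flip: right_diff_distrib)
  qed
  also have "\<dots> = (\<Sum>\<^sub>\<infinity>k. norm (freq k) * norm (a k)) * dist x y" by (rule infsum_cmult_left')
  finally have "norm (csyn a x - csyn a y) \<le> (\<Sum>\<^sub>\<infinity>k. norm (freq k) * norm (a k)) * dist x y" .
  then show ?thesis using abs_Re_le_cmod[of "csyn a x - csyn a y"] by (simp add: syn_def)
qed

section \<open>The space W^{1,infinity}, its norm, and pointwise gradients\<close>

lemma W1inf_syn:
  assumes "(\<lambda>k. (1 + norm (freq k)) * norm (a k)) summable_on UNIV"
  shows "W1inf (syn a)"
  unfolding W1inf_def
proof (intro conjI exI)
  show "periodic2 (syn a)" by (rule periodic2_syn)
  show "bounded (range (syn a))"
    using abs_syn_le[OF weighted_summableD(1)[OF assms]] by (auto simp: bounded_iff)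
  show "(\<Sum>\<^sub>\<infinity>k. norm (freq k) * norm (a k))-lipschitz_on UNIV (syn a)"
    using syn_lipschitz[OF assms] by (auto simp: lipschitz_on_def dist_real_def intro!: infsum_nonneg)
qed

lemma W1inf_norm_bounds:
  assumes "W1inf f"
  shows "\<bar>f x\<bar> \<le> W1inf_norm f" and "\<bar>f x - f y\<bar> \<le> W1inf_norm f * dist x y" and "0 \<le> W1inf_norm f"
proof -
  let ?Q = "\<lambda>xy. \<bar>f (fst xy) - f (snd xy)\<bar> / dist (fst xy) (snd xy)"
  obtain L where L: "L-lipschitz_on UNIV f" using assms by (auto simp: W1inf_def)
  obtain B where B: "\<And>x. \<bar>f x\<bar> \<le> B" using assms by (auto simp: W1inf_def bounded_iff)
  have b1: "bdd_above (range (\<lambda>x. \<bar>f x\<bar>))" by (rule bdd_aboveI[of _ B]) (use B in auto)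
  have b2: "bdd_above (?Q ` {(x, y). x \<noteq> y})"
  proof (rule bdd_aboveI[of _ L], clarify)
    fix x y :: "real^2" assume "x \<noteq> y"
    then show "?Q (x, y) \<le> L" using lipschitz_onD[OF L, of x y] by (simp add: dist_real_def divide_le_eq)
  qed
  have s1: "\<bar>f x\<bar> \<le> (SUP x. \<bar>f x\<bar>)" for x by (rule cSUP_upper[OF _ b1]) simp
  have s2: "?Q (x, y) \<le> (SUP xy \<in> {(x, y). x \<noteq> y}. ?Q xy)" if "x \<noteq> y" for x y
    by (rule cSUP_upper[OF _ b2]) (use that in auto)
  have p1: "0 \<le> (SUP x. \<bar>f x\<bar>)" using s1[of 0] by (meson abs_ge_zero order_trans)
  have "(0::real^2) \<noteq> 1" by simp
  from s2[OF this] have p2: "0 \<le> (SUP xy \<in> {(x, y). x \<noteq> y}. ?Q xy)"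
    by (rule order_trans[rotated]) simp
  show "\<bar>f x\<bar> \<le> W1inf_norm f" unfolding W1inf_norm_def using s1[of x] p2 by linarith
  show "0 \<le> W1inf_norm f" unfolding W1inf_norm_def using p1 p2 by linarith
  show "\<bar>f x - f y\<bar> \<le> W1inf_norm f * dist x y"
  proof (cases "x = y")
    case False
    have "?Q (x, y) \<le> W1inf_norm f" unfolding W1inf_norm_def using s2[OF False] p1 by linarith
    then show ?thesis using False by (simp add: divide_le_eq)
  qed simp
qed

lemma W1inf_norm_leI:
  assumes "\<And>x. \<bar>f x\<bar> \<le> A" "\<And>x y. \<bar>f x - f y\<bar> \<le> B * dist x y"
  shows "W1inf_norm f \<le> A + B"
  unfolding W1inf_norm_def
proof (rule add_mono)
  show "(SUP x. \<bar>f x\<bar>) \<le> A" by (rule cSUP_least) (use assms in auto)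
  have "((0::real^2), (1::real^2)) \<in> {(x, y). x \<noteq> y}" by simp
  then show "(SUP xy \<in> {(x, y). x \<noteq> y}. \<bar>f (fst xy) - f (snd xy)\<bar> / dist (fst xy) (snd xy)) \<le> B"
    by (intro cSUP_least) (use assms in \<open>auto simp: divide_le_eq\<close>)
qed

lemma W1inf_norm_syn_le:
  assumes "(\<lambda>k. (1 + norm (freq k)) * norm (a k)) summable_on UNIV"
  shows "W1inf_norm (syn a) \<le> (\<Sum>\<^sub>\<infinity>k. (1 + norm (freq k)) * norm (a k))"
proof -
  note s = weighted_summableD[OF assms]
  have "W1inf_norm (syn a) \<le> (\<Sum>\<^sub>\<infinity>k. norm (a k)) + (\<Sum>\<^sub>\<infinity>k. norm (freq k) * norm (a k))"
    by (rule W1inf_norm_leI[OF abs_syn_le[OF s(1)] syn_lipschitz[OF assms]])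
  also have "\<dots> = (\<Sum>\<^sub>\<infinity>k. norm (a k) + norm (freq k) * norm (a k))" by (rule infsum_add[OF s, symmetric])
  finally show ?thesis by (simp add: algebra_simps)
qed

lemma W1inf_diff:
  assumes "W1inf f" "W1inf g" shows "W1inf (\<lambda>x. f x - g x)"
proof -
  obtain L K where "L-lipschitz_on UNIV f" "K-lipschitz_on UNIV g" using assms by (auto simp: W1inf_def)
  then have "(L + K)-lipschitz_on UNIV (\<lambda>x. f x - g x)" by (rule lipschitz_on_diff)
  moreover have "bounded (range (\<lambda>x. f x - g x))"
    using assms unfolding W1inf_def bounded_iff by (fastforce intro: order_trans[OF norm_triangle_ineq4] add_mono)
  ultimately show ?thesis using assms by (auto simp: W1inf_def periodic2_def)
qed

text \<open>Both the supremum and the Lipschitz quotient are bounded by the sum of the two full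
  norms, whence the factor 2.\<close>

lemma W1inf_norm_triangle:
  assumes "W1inf f" "W1inf g"
  shows "W1inf_norm f \<le> 2 * W1inf_norm (\<lambda>x. f x - g x) + 2 * W1inf_norm g"
proof -
  note f = W1inf_norm_bounds[OF W1inf_diff[OF assms]] and g = W1inf_norm_bounds[OF assms(2)]
  have "W1inf_norm f \<le> (W1inf_norm (\<lambda>x. f x - g x) + W1inf_norm g) + (W1inf_norm (\<lambda>x. f x - g x) + W1inf_norm g)"
  proof (rule W1inf_norm_leI)
    show "\<bar>f x\<bar> \<le> W1inf_norm (\<lambda>x. f x - g x) + W1inf_norm g" for x
      using f(1)[of x] g(1)[of x] by linarith
    show "\<bar>f x - f y\<bar> \<le> (W1inf_norm (\<lambda>x. f x - g x) + W1inf_norm g) * dist x y" for x y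
      using f(2)[of x y] g(2)[of x y] by (simp add: distrib_right)
  qed
  then show ?thesis by simp
qed

text \<open>Difference quotients along the axes bound each partial derivative by \<open>L\<close>,
  and the two components are added. Where \<open>f\<close> is not differentiable \<open>grad\<close>
  is 0 by definition, so the bound holds at every point.\<close>

lemma norm_grad_le:
  assumes "\<And>x y. \<bar>f x - f y\<bar> \<le> L * dist x y" "0 \<le> L"
  shows "norm (grad f x) \<le> 2 * L"
proof (cases "f differentiable (at x)")
  case True
  then have d: "(f has_derivative frechet_derivative f (at x)) (at x)" by (simp add: frechet_derivative_works)
  have c: "\<bar>grad f x $ i\<bar> \<le> L" for i
  proof -
    let ?D = "frechet_derivative f (at x) (axis i 1)"
    have "((\<lambda>t::real. f (x + t *\<^sub>R axis i 1)) has_real_derivative ?D) (at 0)"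
    proof -
      have "((\<lambda>t::real. x + t *\<^sub>R axis i 1) has_derivative (\<lambda>t. t *\<^sub>R axis i 1)) (at 0)"
        by (auto intro!: derivative_eq_intros)
      moreover have "(f has_derivative frechet_derivative f (at x)) (at (x + (0::real) *\<^sub>R axis i 1))" using d by simp
      ultimately have "((\<lambda>t::real. f (x + t *\<^sub>R axis i 1)) has_derivative (\<lambda>t. frechet_derivative f (at x) (t *\<^sub>R axis i 1))) (at 0)"
        by (rule has_derivative_compose)
      moreover have "(\<lambda>t. frechet_derivative f (at x) (t *\<^sub>R axis i 1)) = (*) ?D"
        using linear_scale[OF has_derivative_linear[OF d]] by (auto simp: mult.commute)
      ultimately show ?thesis unfolding has_field_derivative_def by simp
    qed
    then have "((\<lambda>h. (f (x + h *\<^sub>R axis i 1) - f x) / h) \<longlongrightarrow> ?D) (at 0)"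
      by (simp add: DERIV_def)
    then have "((\<lambda>h. \<bar>(f (x + h *\<^sub>R axis i 1) - f x) / h\<bar>) \<longlongrightarrow> \<bar>?D\<bar>) (at 0)" by (rule tendsto_rabs)
    then have "\<bar>?D\<bar> \<le> L"
    proof (rule tendsto_upperbound)
      have "\<bar>(f (x + h *\<^sub>R axis i 1) - f x) / h\<bar> \<le> L" if "h \<noteq> 0" for h
        using assms(1)[of "x + h *\<^sub>R axis i 1" x] that by (simp add: abs_divide divide_le_eq dist_norm)
      then show "\<forall>\<^sub>F h in at 0. \<bar>(f (x + h *\<^sub>R axis i 1) - f x) / h\<bar> \<le> L" by (auto simp: eventually_at_filter)
    qed simp
    then show ?thesis using True by (simp add: grad_def)
  qed
  have "norm (grad f x) \<le> (\<Sum>i\<in>UNIV. \<bar>grad f x $ i\<bar>)" by (rule norm_le_l1_cart)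
  also have "\<dots> \<le> 2 * L" using c[of 1] c[of 2] by (simp add: sum_2)
  finally show ?thesis .
qed (use assms in \<open>auto simp: grad_def\<close>)

text \<open>Length in C^2 of the pair of Fourier coefficients of a field; measured this way a
  divergence costs at most one factor |k| (\<open>norm_div_coef_le\<close>).\<close>

definition vcoef :: "(real^2 \<Rightarrow> real^2) \<Rightarrow> int^2 \<Rightarrow> real" where
  "vcoef V k = sqrt ((norm (fcoef (\<lambda>y. V y $ 1) k))^2 + (norm (fcoef (\<lambda>y. V y $ 2) k))^2)"

lemma vcoef_nonneg [simp]: "0 \<le> vcoef V k" by (simp add: vcoef_def)

lemma norm_div_coef_le: "norm (div_coef V k) \<le> norm (freq k) * vcoef V k"
proof -
  let ?a = "norm (fcoef (\<lambda>y. V y $ 1) k)" and ?b = "norm (fcoef (\<lambda>y. V y $ 2) k)"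
  have "norm (div_coef V k) \<le> \<bar>freq k $ 1\<bar> * ?a + \<bar>freq k $ 2\<bar> * ?b"
    unfolding div_coef_def norm_mult sum_2
    using norm_triangle_ineq[of "complex_of_real (freq k $ 1) * fcoef (\<lambda>y. V y $ 1) k"
        "complex_of_real (freq k $ 2) * fcoef (\<lambda>y. V y $ 2) k"] by (simp add: norm_mult)
  also have "\<dots> = vector [\<bar>freq k $ 1\<bar>, \<bar>freq k $ 2\<bar>] \<bullet> (vector [?a, ?b] :: real^2)"
    by (simp add: inner_vec_def sum_2)
  also have "\<dots> \<le> norm (vector [\<bar>freq k $ 1\<bar>, \<bar>freq k $ 2\<bar>] :: real^2) * norm (vector [?a, ?b] :: real^2)"
    by (rule norm_cauchy_schwarz)
  also have "norm (vector [\<bar>freq k $ 1\<bar>, \<bar>freq k $ 2\<bar>] :: real^2) = norm (freq k)"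
    by (simp add: norm_eq_sqrt_inner inner_vec_def sum_2)
  also have "norm (vector [?a, ?b] :: real^2) = vcoef V k"
    by (simp add: norm_eq_sqrt_inner inner_vec_def sum_2 vcoef_def power2_eq_square)
  finally show ?thesis .
qed

lemma sum_vcoef_bounded:
  assumes "\<And>x. x \<in> cbox 0 1 \<Longrightarrow> norm (V x) \<le> M" "finite F"
  shows "(\<Sum>k\<in>F. (vcoef V k)^2) \<le> 2 * M^2"
proof -
  have b: "\<bar>V x $ j\<bar> \<le> M" if "x \<in> cbox 0 1" for j x
    using component_le_norm_cart[of "V x" j] assms(1)[OF that] by linarith
  show ?thesis
    using bessel_bounded[of "\<lambda>y. V y $ 1", OF b assms(2)] bessel_bounded[of "\<lambda>y. V y $ 2", OF b assms(2)]
    by (simp add: vcoef_def sum.distrib)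
qed

lemma sum_vcoef_le_integral:
  assumes c: "continuous_on UNIV V" and F: "finite F"
  shows "(\<Sum>k\<in>F. (vcoef V k)^2) \<le> integral (cbox 0 1) (\<lambda>x. (norm (V x))^2)"
proof -
  have cj: "continuous_on S (\<lambda>x. V x $ j)" for j S
    by (intro continuous_intros continuous_on_subset[OF c]) auto
  have "compact (V ` cbox 0 1)" by (intro compact_continuous_image continuous_on_subset[OF c]) auto
  from compact_imp_bounded[OF this] obtain M where M: "\<And>x. x \<in> cbox 0 1 \<Longrightarrow> norm (V x) \<le> M"
    unfolding bounded_iff by auto
  have b: "\<bar>V x $ j\<bar> \<le> M" if "x \<in> cbox 0 1" for j x
    using component_le_norm_cart[of "V x" j] M[OF that] by linarith
  have "(\<Sum>k\<in>F. (vcoef V k)^2) \<le> integral (cbox 0 1) (\<lambda>x. (V x $ 1)^2) + integral (cbox 0 1) (\<lambda>x. (V x $ 2)^2)"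
    using bessel[of "\<lambda>y. V y $ 1", OF integrable_continuous[OF cj] b F] bessel[of "\<lambda>y. V y $ 2", OF integrable_continuous[OF cj] b F]
    by (simp add: vcoef_def sum.distrib)
  also have "\<dots> = integral (cbox 0 1) (\<lambda>x. (V x $ 1)^2 + (V x $ 2)^2)"
    by (intro integral_add[symmetric] integrable_continuous continuous_intros cj)
  also have "\<dots> = integral (cbox 0 1) (\<lambda>x. (norm (V x))^2)"
    unfolding power2_norm_eq_inner inner_vec_def by (simp add: sum_2 power2_eq_square)
  finally show ?thesis .
qed

section \<open>Observability from a box\<close>

text \<open>For the equispaced samples F(j), the combination F(j+1) - cis (2 pi q h) F(j) no longer
  contains the frequency q, and its coefficient at n is multiplied by the difference of the two
  phases. Each elimination at most doubles the bound and uses up one sample; after all of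
  \<open>S\<close> is eliminated only the mode m remains.\<close>

lemma coefficient_extraction:
  fixes c :: "int \<Rightarrow> complex"
  assumes "finite S" "m \<notin> S"
    and "\<And>j. j \<le> card S \<Longrightarrow> norm (\<Sum>n\<in>insert m S. c n * cis (2 * pi * of_int n * (\<theta> + real j * h))) \<le> K"
  shows "norm (c m) * (\<Prod>n\<in>S. norm (cis (2 * pi * of_int m * h) - cis (2 * pi * of_int n * h))) \<le> 2 ^ card S * K"
  using assms
proof (induction S arbitrary: c K rule: finite_induct)
  case empty
  then show ?case using empty(2)[of 0] by (simp add: norm_mult)
next
  case (insert q S)
  define c' where "c' n = c n * (cis (2 * pi * of_int n * h) - cis (2 * pi * of_int q * h))" for n
  define F where "F j = (\<Sum>n\<in>insert m (insert q S). c n * cis (2 * pi * of_int n * (\<theta> + real j * h)))" for j :: nat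
  have FK: "norm (F j) \<le> K" if "j \<le> Suc (card S)" for j
    unfolding F_def using insert.prems(2)[of j] that insert.hyps by simp
  have "norm (c' m) * (\<Prod>n\<in>S. norm (cis (2 * pi * of_int m * h) - cis (2 * pi * of_int n * h))) \<le> 2 ^ card S * (2 * K)"
  proof (rule insert.IH)
    show "m \<notin> S" using insert.prems by auto
    fix j assume j: "j \<le> card S"
    have "F (Suc j) - cis (2 * pi * of_int q * h) * F j
        = (\<Sum>n\<in>insert m (insert q S). c' n * cis (2 * pi * of_int n * (\<theta> + real j * h)))"
      unfolding F_def sum_distrib_left sum_subtractf[symmetric]
    proof (rule sum.cong[OF refl])
      fix n
      have "cis (2 * pi * of_int n * (\<theta> + real (Suc j) * h)) = cis (2 * pi * of_int n * h) * cis (2 * pi * of_int n * (\<theta> + real j * h))"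
        by (simp add: cis_mult algebra_simps)
      then show "c n * cis (2 * pi * of_int n * (\<theta> + real (Suc j) * h)) - cis (2 * pi * of_int q * h) * (c n * cis (2 * pi * of_int n * (\<theta> + real j * h)))
        = c' n * cis (2 * pi * of_int n * (\<theta> + real j * h))"
        by (simp add: c'_def algebra_simps)
    qed
    also have "\<dots> = (\<Sum>n\<in>insert m S. c' n * cis (2 * pi * of_int n * (\<theta> + real j * h)))"
    proof (rule sum.mono_neutral_right)
      show "\<forall>i\<in>insert m (insert q S) - insert m S. c' i * cis (2 * pi * of_int i * (\<theta> + real j * h)) = 0"
        by (auto simp: c'_def)
    qed (use insert.hyps in auto)
    finally have "norm (\<Sum>n\<in>insert m S. c' n * cis (2 * pi * of_int n * (\<theta> + real j * h))) = norm (F (Suc j) - cis (2 * pi * of_int q * h) * F j)"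
      by simp
    also have "\<dots> \<le> norm (F (Suc j)) + norm (F j)"
      using norm_triangle_ineq4[of "F (Suc j)" "cis (2 * pi * of_int q * h) * F j"] by (simp add: norm_mult)
    also have "\<dots> \<le> 2 * K" using FK[of "Suc j"] FK[of j] j by simp
    finally show "norm (\<Sum>n\<in>insert m S. c' n * cis (2 * pi * of_int n * (\<theta> + real j * h))) \<le> 2 * K" .
  qed
  then show ?case using insert.hyps by (simp add: c'_def norm_mult mult_ac)
qed

text \<open>With z = x - y, |z| <= |cis z - 1| + z^2, and the last term is at most |z|/2 when |z| <=
  1/2.\<close>

lemma norm_cis_diff_ge:
  assumes "\<bar>x - y\<bar> \<le> 1/2" shows "\<bar>x - y\<bar> / 2 \<le> norm (cis x - cis y)"
proof -
  let ?z = "x - y"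
  have "cis x - cis y = cis y * (cis ?z - 1)" by (simp add: cis_mult algebra_simps)
  then have n: "norm (cis x - cis y) = norm (cis ?z - 1)" by (simp add: norm_mult)
  have "\<bar>?z\<bar> = norm (\<i> * of_real ?z :: complex)" by (simp only: norm_mult norm_ii norm_of_real mult_1)
  also have "\<dots> \<le> norm (cis ?z - 1) + norm (cis ?z - 1 - \<i> * of_real ?z)"
    using norm_triangle_ineq4[of "cis ?z - 1" "cis ?z - 1 - \<i> * of_real ?z"] by simp
  also have "norm (cis ?z - 1 - \<i> * of_real ?z) \<le> \<bar>?z\<bar> / 2"
    using norm_cis_taylor[of ?z] mult_left_mono[OF assms, of "\<bar>?z\<bar>"] by (simp add: power2_eq_square)
  finally show ?thesis unfolding n by simp
qed

text \<open>\<open>coefficient_extraction\<close> with 2N eliminations: each phase difference is at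
  least 2h, and the powers of 2 from the doublings cancel.\<close>

lemma trig_poly_coeff_bound:
  fixes c :: "int \<Rightarrow> complex"
  assumes N: "1 \<le> N" and \<rho>: "0 < \<rho>" "\<rho> \<le> 1/16" and m: "m \<in> {-int N..int N}"
    and K: "\<And>x. \<alpha> \<le> x \<Longrightarrow> x \<le> \<alpha> + \<rho> \<Longrightarrow> norm (\<Sum>n\<in>{-int N..int N}. c n * cis (2 * pi * of_int n * x)) \<le> K"
  shows "norm (c m) \<le> (2 * real N / \<rho>) ^ (2 * N) * K"
proof -
  \<comment> \<open>With this spacing the 2N + 1 samples just fill the interval of length rho. All
    phase differences are then at most 2 pi rho <= 1/2, the range of
    \<open>norm_cis_diff_ge\<close>; this is where the bound 1/16 on rho comes from.\<close>
  define h where "h = \<rho> / (2 * real N)"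
  let ?S = "{-int N..int N} - {m}"
  have h: "0 < h" using N \<rho> by (simp add: h_def)
  have ins: "insert m ?S = {-int N..int N}" using m by auto
  have card: "card ?S = 2 * N" using m by simp
  have "norm (c m) * (\<Prod>n\<in>?S. norm (cis (2 * pi * of_int m * h) - cis (2 * pi * of_int n * h))) \<le> 2 ^ card ?S * K"
  proof (rule coefficient_extraction)
    fix j assume "j \<le> card ?S"
    then have "real j \<le> 2 * real N" unfolding card by linarith
    then have "real j * h \<le> 2 * real N * h" using h by (intro mult_right_mono) auto
    also have "\<dots> = \<rho>" using N by (simp add: h_def)
    finally show "norm (\<Sum>n\<in>insert m ?S. c n * cis (2 * pi * of_int n * (\<alpha> + real j * h))) \<le> K"
      unfolding ins using h by (intro K) auto
  qed auto
  moreover have "(2 * h) ^ card ?S \<le> (\<Prod>n\<in>?S. norm (cis (2 * pi * of_int m * h) - cis (2 * pi * of_int n * h)))"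
    unfolding prod_constant[symmetric]
  proof (rule prod_mono, intro conjI)
    fix n assume n: "n \<in> ?S"
    let ?d = "\<bar>2 * pi * of_int m * h - 2 * pi * of_int n * h\<bar>"
    have "2 * pi * of_int m * h - 2 * pi * of_int n * h = (2 * pi * h) * of_int (m - n)" by (simp add: algebra_simps)
    then have d: "?d = 2 * pi * h * \<bar>real_of_int (m - n)\<bar>" using h by (simp only: abs_mult) simp
    have "\<bar>m - n\<bar> \<le> 2 * int N" using m n by auto
    then have "\<bar>real_of_int (m - n)\<bar> \<le> 2 * real N" by linarith
    then have "?d \<le> 2 * pi * h * (2 * real N)" unfolding d using h by (intro mult_left_mono) auto
    also have "\<dots> = 2 * pi * \<rho>" using N by (simp add: h_def)
    also have "\<dots> \<le> 2 * 4 * (1/16)" using \<rho> pi_less_4 by (intro mult_mono) auto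
    finally have d2: "?d \<le> 1/2" by simp
    have "1 \<le> \<bar>m - n\<bar>" using n by auto
    then have "1 \<le> \<bar>real_of_int (m - n)\<bar>" by linarith
    then have "2 * pi * h * 1 \<le> 2 * pi * h * \<bar>real_of_int (m - n)\<bar>" using h by (intro mult_left_mono) auto
    moreover have "2 * h \<le> pi * h" using h pi_gt3 by (intro mult_right_mono) auto
    ultimately have "2 * h \<le> ?d / 2" unfolding d by linarith
    also have "\<dots> \<le> norm (cis (2 * pi * of_int m * h) - cis (2 * pi * of_int n * h))"
      by (rule norm_cis_diff_ge[OF d2])
    finally show "2 * h \<le> norm (cis (2 * pi * of_int m * h) - cis (2 * pi * of_int n * h))" .
  qed (use h in auto)
  ultimately have "norm (c m) * (2 * h) ^ card ?S \<le> 2 ^ card ?S * K"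
    by (meson mult_left_mono norm_ge_zero order_trans)
  then have "norm (c m) * h ^ (2 * N) \<le> K" unfolding card by (simp add: power_mult_distrib)
  then have "norm (c m) \<le> K / h ^ (2 * N)" using h by (simp add: pos_le_divide_eq)
  also have "\<dots> = (2 * real N / \<rho>) ^ (2 * N) * K" by (simp add: h_def power_divide)
  finally show ?thesis .
qed

text \<open>The one-dimensional bound is applied in x for each fixed y, and then in y to the
  resulting coefficients; hence the doubled exponent 4N.\<close>

lemma trig_poly2_coeff_bound:
  fixes c :: "int^2 \<Rightarrow> complex"
  assumes N: "1 \<le> N" and \<rho>: "0 < \<rho>" "\<rho> \<le> 1/16" and k: "k \<in> int2_box N"
    and K: "\<And>x y. \<lbrakk>\<alpha> \<le> x; x \<le> \<alpha> + \<rho>; \<beta> \<le> y; y \<le> \<beta> + \<rho>\<rbrakk> \<Longrightarrow> norm (\<Sum>k\<in>int2_box N. c k * cis (freq k \<bullet> vector [x, y])) \<le> K"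
  shows "norm (c k) \<le> (2 * real N / \<rho>) ^ (4 * N) * K"
proof -
  let ?Q = "(2 * real N / \<rho>) ^ (2 * N)"
  have k12: "k $ 1 \<in> {-int N..int N}" "k $ 2 \<in> {-int N..int N}" using k by (auto simp: int2_box_def abs_le_iff minus_le_iff)
  have "norm (\<Sum>n\<in>{-int N..int N}. c (vector [k $ 1, n]) * cis (2 * pi * of_int n * y)) \<le> ?Q * K"
    if y: "\<beta> \<le> y" "y \<le> \<beta> + \<rho>" for y
  proof -
    let ?d = "\<lambda>m. \<Sum>n\<in>{-int N..int N}. c (vector [m, n]) * cis (2 * pi * of_int n * y)"
    have "norm (?d (k $ 1)) \<le> ?Q * K"
    proof (rule trig_poly_coeff_bound[OF N \<rho> k12(1), where c="?d" and \<alpha>=\<alpha>])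
      fix x assume x: "\<alpha> \<le> x" "x \<le> \<alpha> + \<rho>"
      have "(\<Sum>m\<in>{-int N..int N}. ?d m * cis (2 * pi * of_int m * x)) = (\<Sum>k\<in>int2_box N. c k * cis (freq k \<bullet> vector [x, y]))"
        unfolding sum_int2_box cis_freq_split sum_distrib_right by (intro sum.cong refl) (simp add: mult_ac)
      then show "norm (\<Sum>m\<in>{-int N..int N}. ?d m * cis (2 * pi * of_int m * x)) \<le> K"
        using K[OF x y] by simp
    qed
    then show ?thesis .
  qed
  then have "norm (c (vector [k $ 1, k $ 2])) \<le> ?Q * (?Q * K)"
    by (rule trig_poly_coeff_bound[OF N \<rho> k12(2), where c="\<lambda>n. c (vector [k $ 1, n])"])
  moreover have "vector [k $ 1, k $ 2] = k" by (simp add: vec_eq_iff forall_2)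
  moreover have "?Q * ?Q = (2 * real N / \<rho>) ^ (4 * N)" by (simp flip: power_add)
  ultimately show ?thesis by (simp only: mult.assoc[symmetric])
qed

lemma card_int2_box: "card (int2_box N) = (2 * N + 1)^2"
proof -
  have "real (card (int2_box N)) = (\<Sum>k\<in>int2_box N. 1)" by simp
  also have "\<dots> = real ((2 * N + 1)^2)" unfolding sum_int2_box by (simp add: power2_eq_square algebra_simps)
  finally show ?thesis by (simp only: of_nat_eq_iff)
qed

lemma lam_outside_box:
  assumes "k \<notin> int2_box N" shows "real N ^ 4 \<le> lam k"
proof -
  obtain i where "\<not> \<bar>k $ i\<bar> \<le> int N" using assms by (auto simp: int2_box_def)
  then have "real N \<le> \<bar>real_of_int (k $ i)\<bar>" by linarith
  also have "\<dots> \<le> norm (freq k)" by (rule norm_freq_ge_nth)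
  finally show ?thesis unfolding lam_def by (rule power_mono) simp
qed

text \<open>Modes outside the box of size N are small at time t because they have been damped since
  t'. On the square the remaining trigonometric polynomial is therefore bounded by \<open>M\<close>
  plus that tail, which bounds each of its (2N+1)^2 coefficients.\<close>

lemma observability_step:
  fixes c :: "int^2 \<Rightarrow> complex"
  assumes s: "(\<lambda>k. norm (c k) * exp (- t' * lam k)) summable_on UNIV" and tt: "t' < t"
    and N: "1 \<le> N" and \<rho>: "0 < \<rho>" "\<rho> \<le> 1/16" and M: "0 \<le> M"
    and b: "\<And>x y. \<lbrakk>\<alpha> \<le> x; x \<le> \<alpha> + \<rho>; \<beta> \<le> y; y \<le> \<beta> + \<rho>\<rbrakk> \<Longrightarrow> norm (csyn (\<lambda>k. exp (- t * lam k) * c k) (vector [x, y])) \<le> M"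
  shows "(\<Sum>\<^sub>\<infinity>k. norm (c k) * exp (- t * lam k))
      \<le> exp ((5 + 8 / \<rho>) * real N^2) * (M + exp (- (t - t') * real N^4) * (\<Sum>\<^sub>\<infinity>k. norm (c k) * exp (- t' * lam k)))"
proof -
  let ?a = "\<lambda>k. norm (c k) * exp (- t * lam k)" and ?a' = "\<lambda>k. norm (c k) * exp (- t' * lam k)"
  define \<tau> where "\<tau> = exp (- (t - t') * real N^4) * infsum ?a' UNIV"
  define Q where "Q = (2 * real N / \<rho>) ^ (4 * N)"
  have sa: "?a summable_on UNIV"
    by (rule summable_on_real_comparison[OF s]) (use tt in \<open>auto intro!: mult_left_mono mult_right_mono\<close>)
  have sub: "?a summable_on int2_box N" "?a summable_on (- int2_box N)" "?a' summable_on (- int2_box N)"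
    using sa s summable_on_subset_banach by blast+
  have tail: "infsum ?a (- int2_box N) \<le> \<tau>"
  proof -
    have "infsum ?a (- int2_box N) \<le> (\<Sum>\<^sub>\<infinity>k\<in>- int2_box N. exp (- (t - t') * real N^4) * ?a' k)"
    proof (rule infsum_mono[OF sub(2) summable_on_cmult_right[OF sub(3)]])
      fix k assume "k \<in> - int2_box N"
      then have "(t - t') * real N^4 \<le> (t - t') * lam k" using lam_outside_box tt by (intro mult_left_mono) auto
      then have "exp (- t * lam k) \<le> exp (- (t - t') * real N^4) * exp (- t' * lam k)"
        by (simp add: algebra_simps flip: exp_add)
      from mult_left_mono[OF this, of "norm (c k)"]
      show "?a k \<le> exp (- (t - t') * real N^4) * ?a' k" by (simp add: mult_ac)
    qed
    also have "\<dots> = exp (- (t - t') * real N^4) * infsum ?a' (- int2_box N)" by (rule infsum_cmult_right')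
    also have "\<dots> \<le> \<tau>" unfolding \<tau>_def
      by (intro mult_left_mono infsum_mono_neutral sub s) auto
    finally show ?thesis .
  qed
  have \<tau>0: "0 \<le> \<tau>" unfolding \<tau>_def by (intro mult_nonneg_nonneg infsum_nonneg) auto
  have co: "?a k \<le> Q * (M + \<tau>)" if k: "k \<in> int2_box N" for k
  proof -
    have "norm (exp (- t * lam k) * c k) \<le> Q * (M + \<tau>)" unfolding Q_def
    proof (rule trig_poly2_coeff_bound[OF N \<rho> k, where c="\<lambda>k. exp (- t * lam k) * c k" and \<alpha>=\<alpha> and \<beta>=\<beta>])
      fix x y assume xy: "\<alpha> \<le> x" "x \<le> \<alpha> + \<rho>" "\<beta> \<le> y" "y \<le> \<beta> + \<rho>"
      let ?f = "\<lambda>k. exp (- t * lam k) * c k * cis (freq k \<bullet> vector [x, y])"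
      have n: "norm (?f k) = ?a k" for k by (simp add: norm_mult)
      have fs: "?f summable_on UNIV" by (rule summable_on_norm_comparison(1)[OF sa]) (simp add: norm_mult)
      have fs': "?f summable_on (int2_box N)" "?f summable_on (- int2_box N)"
        using fs summable_on_subset_banach by blast+
      have "infsum ?f UNIV = infsum ?f (int2_box N) + infsum ?f (- int2_box N)"
        using infsum_Un_disjoint[OF fs'] by simp
      then have "norm (sum ?f (int2_box N)) = norm (infsum ?f UNIV - infsum ?f (- int2_box N))" by simp
      also have "\<dots> \<le> norm (infsum ?f UNIV) + norm (infsum ?f (- int2_box N))" by (rule norm_triangle_ineq4)
      also have "norm (infsum ?f (- int2_box N)) \<le> infsum ?a (- int2_box N)"
        using norm_infsum_bound[of ?f "- int2_box N"] sub(2) unfolding n by simp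
      also have "norm (infsum ?f UNIV) \<le> M" using b[OF xy] by (simp add: csyn_def)
      finally show "norm (sum ?f (int2_box N)) \<le> M + \<tau>" using tail by simp
    qed
    then show ?thesis by (simp add: norm_mult mult.commute)
  qed
  have Q0: "0 \<le> Q" using \<rho> by (simp add: Q_def)
  have "infsum ?a UNIV = infsum ?a (int2_box N) + infsum ?a (- int2_box N)"
    using infsum_Un_disjoint[OF sub(1,2)] by simp
  also have "infsum ?a (int2_box N) \<le> (\<Sum>k\<in>int2_box N. Q * (M + \<tau>))"
    by (simp only: infsum_finite finite_int2_box) (rule sum_mono, rule co)
  also have "\<dots> = (2 * real N + 1)^2 * (Q * (M + \<tau>))" by (simp add: card_int2_box)
  also have "infsum ?a (- int2_box N) \<le> M + \<tau>" using tail M by simp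
  finally have "infsum ?a UNIV \<le> ((2 * real N + 1)^2 * Q + 1) * (M + \<tau>)" by (simp add: algebra_simps)
  \<comment> \<open>(2N+1)^2 <= exp (4N), and Q <= exp (8 N^2 / rho) from x <= exp x. The summand 1
    is paid by one factor exp 1, and 1 + 4N <= 5 N^2.\<close>
  also have "\<dots> \<le> exp ((5 + 8 / \<rho>) * real N^2) * (M + \<tau>)"
  proof (rule mult_right_mono)
    have N1: "1 \<le> real N" using N by simp
    have NN: "real N \<le> real N^2" using N1 by (simp add: power2_eq_square)
    have "(2 * real N + 1)^2 \<le> exp (2 * real N)^2"
      using exp_ge_add_one_self[of "2 * real N"] by (intro power_mono) (simp_all add: add.commute)
    also have "\<dots> = exp (4 * real N)" by (simp flip: exp_double)
    finally have 1: "(2 * real N + 1)^2 \<le> exp (4 * real N)" .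
    have "2 * real N / \<rho> \<le> exp (2 * real N / \<rho>)" using exp_ge_add_one_self[of "2 * real N / \<rho>"] by linarith
    then have "Q \<le> exp (2 * real N / \<rho>) ^ (4 * N)" unfolding Q_def using \<rho> by (intro power_mono) auto
    also have "\<dots> = exp (real (4 * N) * (2 * real N / \<rho>))" by (rule exp_of_nat_mult[symmetric])
    also have "\<dots> = exp (8 / \<rho> * real N^2)" by (simp add: power2_eq_square)
    finally have 2: "Q \<le> exp (8 / \<rho> * real N^2)" .
    have "(2 * real N + 1)^2 * Q \<le> exp (4 * real N) * exp (8 / \<rho> * real N^2)"
      by (intro mult_mono 1 2 Q0) auto
    also have "\<dots> = exp (4 * real N + 8 / \<rho> * real N^2)" by (simp add: exp_add)
    finally have 3: "(2 * real N + 1)^2 * Q \<le> exp (4 * real N + 8 / \<rho> * real N^2)" .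
    let ?z = "exp (4 * real N + 8 / \<rho> * real N^2)"
    have z: "1 \<le> ?z" using \<rho> by auto
    have "2 * ?z \<le> exp 1 * ?z" using exp_ge_add_one_self[of 1] by (intro mult_right_mono) auto
    with z 3 have "(2 * real N + 1)^2 * Q + 1 \<le> exp (1 + (4 * real N + 8 / \<rho> * real N^2))"
      unfolding exp_add[of 1] by linarith
    also have "\<dots> \<le> exp ((5 + 8 / \<rho>) * real N^2)"
      unfolding exp_le_cancel_iff distrib_right using NN N1 by linarith
    finally show "(2 * real N + 1)^2 * Q + 1 \<le> exp ((5 + 8 / \<rho>) * real N^2)" .
  qed (use M \<tau>0 in simp)
  finally show ?thesis unfolding \<tau>_def .
qed

text \<open>Lebeau--Robbiano iteration: the frequency cut-off doubles while the time steps halve. The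
  coefficients of a trigonometric polynomial of degree \<open>N\<close> are controlled by its values on a small square
  up to a factor \<open>exp (\<kappa> N\<^sup>2)\<close>, and the gain \<open>exp (- \<delta> N\<^sup>4)\<close> of the semigroup on the remaining modes wins.\<close>

lemma observability:
  fixes \<alpha> \<beta> :: real
  assumes ab: "a < b" and \<rho>: "0 < \<rho>" "\<rho> \<le> 1/16" and M: "0 \<le> M"
  obtains C where "\<And>(c :: int^2 \<Rightarrow> complex) k. \<lbrakk>(\<lambda>k. norm (c k) * exp (- a * lam k)) summable_on UNIV;
      \<And>t x y. \<lbrakk>a \<le> t; t \<le> b; \<alpha> \<le> x; x \<le> \<alpha> + \<rho>; \<beta> \<le> y; y \<le> \<beta> + \<rho>\<rbrakk> \<Longrightarrow> norm (csyn (\<lambda>k. exp (- t * lam k) * c k) (vector [x, y])) \<le> M\<rbrakk>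
      \<Longrightarrow> norm (c k) * exp (- b * lam k) \<le> C"
proof -
  define \<kappa> where "\<kappa> = 5 + 8 / \<rho>"
  have \<kappa>: "0 < \<kappa>" using \<rho> by (simp add: \<kappa>_def add_pos_pos)
  obtain N0 :: nat where N0: "2 * (4 * \<kappa> + 1) / (b - a) < real N0" using reals_Archimedean2 by blast
  have "0 < 2 * (4 * \<kappa> + 1) / (b - a)" using \<kappa> ab by simp
  then have N0pos: "1 \<le> N0" using N0 by (cases N0) auto
  have "real N0 \<le> real N0^2" using N0pos by (simp add: power2_eq_square)
  then have "2 * (4 * \<kappa> + 1) / (b - a) \<le> real N0^2" using N0 by linarith
  then have N0b: "4 * \<kappa> + 1 \<le> (b - a) * real N0^2 / 2" using ab by (simp add: field_simps)
  show thesis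
  proof (rule that[where C="2 * M * exp (\<kappa> * real N0^2)"])
    fix c :: "int^2 \<Rightarrow> complex" and k
    assume s: "(\<lambda>k. norm (c k) * exp (- a * lam k)) summable_on UNIV"
      and bd: "\<And>t x y. \<lbrakk>a \<le> t; t \<le> b; \<alpha> \<le> x; x \<le> \<alpha> + \<rho>; \<beta> \<le> y; y \<le> \<beta> + \<rho>\<rbrakk> \<Longrightarrow> norm (csyn (\<lambda>k. exp (- t * lam k) * c k) (vector [x, y])) \<le> M"
    define A where "A t = (\<Sum>\<^sub>\<infinity>k. norm (c k) * exp (- t * lam k))" for t
    define T where "T j = a + (b - a) / 2^j" for j :: nat
    define N where "N j = N0 * 2^j" for j :: nat
    \<comment> \<open>Dividing by the cost of the cut-off N_j turns the one-step estimate into X_j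
      <= M + X_{j+1}/2.\<close>
    define X where "X j = A (T j) * exp (- \<kappa> * real (N j)^2)" for j
    have T1: "a < T j" for j using ab by (simp add: T_def)
    have T2: "T j \<le> b" for j
    proof -
      have "(b - a) / 2^j \<le> (b - a) / 1" using ab by (intro divide_left_mono) auto
      then show ?thesis by (simp add: T_def)
    qed
    have T3: "T j - T (Suc j) = (b - a) / 2^(Suc j)" for j by (simp add: T_def field_simps)
    have T4: "T (Suc j) < T j" for j using T3[of j] ab by (smt (verit) divide_pos_pos zero_less_power)
    have ss: "(\<lambda>k. norm (c k) * exp (- t * lam k)) summable_on UNIV" if "a \<le> t" for t
      by (rule summable_on_real_comparison[OF s]) (use that in \<open>auto intro!: mult_left_mono mult_right_mono\<close>)
    have A0: "0 \<le> A t" for t unfolding A_def by (intro infsum_nonneg) auto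
    have Aa: "A t \<le> A a" if "a \<le> t" for t unfolding A_def
      by (rule infsum_mono[OF ss[OF that] s]) (use that in \<open>auto intro!: mult_left_mono mult_right_mono\<close>)
    have X0: "0 \<le> X j" "X j \<le> A a" for j
    proof -
      show "0 \<le> X j" by (simp add: X_def A0)
      have "A (T j) * exp (- \<kappa> * real (N j)^2) \<le> A (T j) * 1" using \<kappa> A0 by (intro mult_left_mono) auto
      then show "X j \<le> A a" using Aa[of "T j"] T1[of j] unfolding X_def by linarith
    qed
    have step: "X j \<le> M + X (Suc j) / 2" for j
    proof -
      let ?E = "exp (\<kappa> * real (N j)^2)" and ?g = "exp (- (T j - T (Suc j)) * real (N j)^4)"
      have NS: "real (N (Suc j))^2 = 4 * real (N j)^2" by (simp add: N_def power_mult_distrib)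
      have N1: "1 \<le> N j" using N0pos by (simp add: N_def)
      have "A (T j) \<le> ?E * (M + ?g * A (T (Suc j)))"
        unfolding A_def \<kappa>_def
        by (rule observability_step[OF ss[OF less_imp_le[OF T1[of "Suc j"]]] T4[of j] N1 \<rho> M bd[OF less_imp_le[OF T1[of j]] T2[of j]]])
      then have "X j \<le> ?E * (M + ?g * A (T (Suc j))) * exp (- \<kappa> * real (N j)^2)"
        unfolding X_def by (rule mult_right_mono) simp
      also have "\<dots> = (M + ?g * A (T (Suc j))) * (?E * exp (- \<kappa> * real (N j)^2))" by (simp only: mult_ac)
      also have "?E * exp (- \<kappa> * real (N j)^2) = 1" by (simp flip: exp_add)
      also have "A (T (Suc j)) = X (Suc j) * exp (4 * \<kappa> * real (N j)^2)"
        unfolding X_def NS by (simp add: mult.assoc flip: exp_add)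
      finally have 1: "X j \<le> M + (?g * exp (4 * \<kappa> * real (N j)^2)) * X (Suc j)" by (simp add: mult_ac)
      \<comment> \<open>The factor 4 comes from N_{j+1}^2 = 4 N_j^2. The time step halves while N^4
        grows by 16 and N^2 by 4, so the inequality secured at j = 0 persists.\<close>
      have "?g * exp (4 * \<kappa> * real (N j)^2) \<le> 1/2"
      proof -
        have "real (N j)^2 * (4 * \<kappa> + 1) \<le> real (N j)^2 * ((b - a) * real N0^2 / 2)"
          by (intro mult_left_mono N0b) auto
        also have "\<dots> \<le> real (N j)^2 * ((b - a) * real N0^2 / 2 * 2^j)"
          using ab mult_left_mono[of 1 "2^j" "(b - a) * real N0^2 / 2"] by (intro mult_left_mono) auto
        also have "\<dots> = (T j - T (Suc j)) * real (N j)^4"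
          unfolding T3 N_def by (simp add: field_simps power2_eq_square power4_eq_xxxx)
        finally have "4 * \<kappa> * real (N j)^2 + real (N j)^2 \<le> (T j - T (Suc j)) * real (N j)^4" by (simp add: algebra_simps)
        moreover have "1 \<le> real (N j)^2" using N1 by simp
        ultimately have "- (T j - T (Suc j)) * real (N j)^4 + 4 * \<kappa> * real (N j)^2 \<le> -1" by linarith
        then have "?g * exp (4 * \<kappa> * real (N j)^2) \<le> exp (-1)" unfolding exp_add[symmetric] by (simp only: exp_le_cancel_iff)
        also have "exp (-1) \<le> 1/(2::real)" using exp_ge_add_one_self[of "1::real"] by (simp add: exp_minus field_simps)
        finally show ?thesis .
      qed
      then have "(?g * exp (4 * \<kappa> * real (N j)^2)) * X (Suc j) \<le> 1/2 * X (Suc j)"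
        by (rule mult_right_mono) (rule X0)
      with 1 show ?thesis by linarith
    qed
    have Xb: "X 0 \<le> 2 * M + X j / 2^j" for j
    proof -
      have "X 0 \<le> 2 * M - 2 * M / 2^j + X j / 2^j"
      proof (induction j)
        case (Suc j)
        have "X j / 2^j \<le> (M + X (Suc j) / 2) / 2^j" by (intro divide_right_mono step) auto
        also have "\<dots> = 2 * M / 2^j - 2 * M / 2^(Suc j) + X (Suc j) / 2^(Suc j)" by (simp add: field_simps)
        finally show ?case using Suc by linarith
      qed simp
      moreover have "0 \<le> 2 * M / 2^j" using M by simp
      ultimately show ?thesis by linarith
    qed
    \<comment> \<open>The remainder involves \<open>A a\<close>, for which no uniform bound is
      available; its factor is halved at every step and vanishes in the limit, so the constant is
      the same for all coefficient families.\<close>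
    have Xj: "X 0 \<le> 2 * M + A a * (1/2)^j" for j
    proof -
      have "X j / 2^j \<le> A a / 2^j" using X0(2)[of j] by (intro divide_right_mono) auto
      then show ?thesis using Xb[of j] by (simp add: power_divide)
    qed
    have "(\<lambda>j. 2 * M + A a * (1/2)^j) \<longlonglongrightarrow> 2 * M + A a * 0"
      by (intro tendsto_intros LIMSEQ_power_zero) simp
    then have "(\<lambda>j. 2 * M + A a * (1/2)^j) \<longlonglongrightarrow> 2 * M" by simp
    then have "X 0 \<le> 2 * M" by (rule LIMSEQ_le_const) (use Xj in auto)
    then have "A b * exp (- \<kappa> * real N0^2) \<le> 2 * M" by (simp add: X_def T_def N_def)
    then have "A b * exp (- \<kappa> * real N0^2) * exp (\<kappa> * real N0^2) \<le> 2 * M * exp (\<kappa> * real N0^2)"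
      by (intro mult_right_mono) auto
    then have "A b \<le> 2 * M * exp (\<kappa> * real N0^2)" by (simp add: mult.assoc flip: exp_add)
    moreover have "norm (c k) * exp (- b * lam k) \<le> A b"
      unfolding A_def using finite_sum_le_infsum[OF ss[of b], of "{k}"] ab by simp
    ultimately show "norm (c k) * exp (- b * lam k) \<le> 2 * M * exp (\<kappa> * real N0^2)" by linarith
  qed
qed

section \<open>The nonlinearity and Duhamel integrals\<close>

definition NL :: "real \<Rightarrow> real^2 \<Rightarrow> real^2" where
  "NL p y = (norm y powr (p - 2)) *\<^sub>R y"

lemma nonlin_eq: "nonlin p v = (\<lambda>x. NL p (grad v x))"
  by (rule ext) (simp add: nonlin_def NL_def)

lemma norm_NL: "2 < p \<Longrightarrow> norm (NL p y) = norm y powr (p - 1)"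
proof (cases "y = 0")
  case False
  have "norm y powr (p - 2) * norm y powr 1 = norm y powr (p - 2 + 1)" by (rule powr_add[symmetric])
  then show ?thesis using False by (simp add: NL_def)
qed (simp add: NL_def)

lemma norm_NL_le:
  assumes "2 < p" "norm y \<le> R" shows "norm (NL p y) \<le> R powr (p - 1)"
  unfolding norm_NL[OF assms(1)] using assms by (intro powr_mono2) auto

text \<open>With q = p - 2 < 1 the power |y|^q is not Lipschitz at 0, but its increment times the
  smaller length is: (|y|/|z|)^q <= |y|/|z| gives (|y|^q - |z|^q) |z| <= |z|^q (|y| - |z|).\<close>

lemma NL_lipschitz_aux:
  assumes p: "2 < p" "p < 3" and zy: "norm z \<le> norm y" and y: "norm y \<le> R"
  shows "norm (NL p y - NL p z) \<le> 2 * R powr (p - 2) * norm (y - z)"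
proof -
  let ?q = "p - 2"
  have R: "0 \<le> R" using y norm_ge_zero order_trans by blast
  have "NL p y - NL p z = (norm y powr ?q) *\<^sub>R (y - z) + (norm y powr ?q - norm z powr ?q) *\<^sub>R z"
    by (simp add: NL_def algebra_simps)
  then have "norm (NL p y - NL p z) \<le> norm y powr ?q * norm (y - z) + \<bar>norm y powr ?q - norm z powr ?q\<bar> * norm z"
    using norm_triangle_ineq[of "(norm y powr ?q) *\<^sub>R (y - z)" "(norm y powr ?q - norm z powr ?q) *\<^sub>R z"] by simp
  also have "\<bar>norm y powr ?q - norm z powr ?q\<bar> * norm z \<le> norm z powr ?q * norm (y - z)"
  proof (cases "z = 0")
    case False
    let ?c = "norm y / norm z"
    have c: "1 \<le> ?c" using False zy by simp
    have m: "norm z powr ?q \<le> norm y powr ?q" using zy p by (intro powr_mono2) auto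
    have "norm y powr ?q = norm z powr ?q * ?c powr ?q" using False by (simp flip: powr_mult)
    also have "?c powr ?q \<le> ?c powr 1" using c p by (intro powr_mono) auto
    finally have "norm y powr ?q \<le> norm z powr ?q * ?c" using c by (simp add: mult_left_mono)
    then have "norm y powr ?q * norm z \<le> norm z powr ?q * norm y" using False by (simp add: field_simps)
    then have "(norm y powr ?q - norm z powr ?q) * norm z \<le> norm z powr ?q * (norm y - norm z)" by (simp add: algebra_simps)
    also have "\<dots> \<le> norm z powr ?q * norm (y - z)" by (intro mult_left_mono norm_triangle_ineq2) auto
    finally show ?thesis using m by simp
  qed simp
  also have "norm y powr ?q * norm (y - z) + norm z powr ?q * norm (y - z) \<le> R powr ?q * norm (y - z) + R powr ?q * norm (y - z)"
    using p y zy by (intro add_mono mult_right_mono powr_mono2) auto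
  finally show ?thesis by (simp add: mult.commute mult.left_commute)
qed

lemma NL_lipschitz:
  assumes p: "2 < p" "p < 3" and "norm z \<le> R" "norm y \<le> R"
  shows "norm (NL p y - NL p z) \<le> 2 * R powr (p - 2) * norm (y - z)"
proof (cases "norm z \<le> norm y")
  case True
  then show ?thesis using NL_lipschitz_aux[OF p _ assms(4)] by blast
next
  case False
  then show ?thesis using NL_lipschitz_aux[OF p _ assms(3), of y] by (simp add: norm_minus_commute)
qed

lemma continuous_on_NL:
  assumes "2 < p" "continuous_on S g" shows "continuous_on S (\<lambda>x. NL p (g x))"
  unfolding NL_def using assms by (intro continuous_intros continuous_on_powr') auto

lemma fcoef_diff:
  assumes "continuous_on UNIV f" "continuous_on UNIV g"
  shows "fcoef f k - fcoef g k = fcoef (\<lambda>x. f x - g x) k"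
  unfolding fcoef_def
  by (subst integral_diff[symmetric])
     (auto intro!: integrable_continuous continuous_intros continuous_on_subset[OF assms(1)] continuous_on_subset[OF assms(2)] simp: algebra_simps)

lemma div_coef_diff:
  assumes "continuous_on UNIV V" "continuous_on UNIV W"
  shows "div_coef V k - div_coef W k = div_coef (\<lambda>x. V x - W x) k"
proof -
  have "fcoef (\<lambda>y. V y $ j) k - fcoef (\<lambda>y. W y $ j) k = fcoef (\<lambda>y. (V y - W y) $ j) k" for j
    using fcoef_diff[of "\<lambda>y. V y $ j" "\<lambda>y. W y $ j"] assms by (auto intro: continuous_intros)
  then show ?thesis by (simp add: div_coef_def right_diff_distrib[symmetric] sum_subtractf[symmetric])
qed

lemma vcoef_le:
  assumes "\<And>x. x \<in> cbox 0 1 \<Longrightarrow> norm (V x) \<le> M" shows "vcoef V k \<le> 2 * M"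
proof -
  have M: "0 \<le> M" using order_trans[OF norm_ge_zero assms[of 0]] by (simp add: mem_box_cart)
  have "(vcoef V k)^2 \<le> 2 * M^2" using sum_vcoef_bounded[of V M "{k}"] assms by simp
  also have "\<dots> \<le> (2 * M)^2" by (simp add: power2_eq_square)
  finally show ?thesis using M by (rule_tac power2_le_imp_le) auto
qed

lemma norm_div_coef_bounded:
  assumes "\<And>x. x \<in> cbox 0 1 \<Longrightarrow> norm (V x) \<le> M" shows "norm (div_coef V k) \<le> norm (freq k) * (2 * M)"
  by (rule order_trans[OF norm_div_coef_le]) (intro mult_left_mono vcoef_le assms, auto)

section \<open>Duhamel integrals in Fourier space\<close>

definition duhamel :: "(real \<Rightarrow> int^2 \<Rightarrow> complex) \<Rightarrow> real \<Rightarrow> real \<Rightarrow> int^2 \<Rightarrow> complex" where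
  "duhamel n r t k = integral {r..t} (\<lambda>s. complex_of_real (exp (- (t - s) * lam k)) * n s k)"

text \<open>Models the coefficients \<open>n\<close> of the divergence of a field with coefficient
  sizes \<open>q\<close>, whose L2 norm at time s is at most \<open>\<beta> s\<close>. The interval
  is open because \<open>\<beta>\<close> may have an integrable singularity at the restart time
  r.\<close>

definition source :: "(real \<Rightarrow> int^2 \<Rightarrow> complex) \<Rightarrow> (real \<Rightarrow> int^2 \<Rightarrow> real) \<Rightarrow> (real \<Rightarrow> real) \<Rightarrow> real \<Rightarrow> real \<Rightarrow> bool" where
  "source n q \<beta> r t \<longleftrightarrow> (\<forall>k. (\<lambda>s. n s k) \<in> borel_measurable (lebesgue_on {r<..<t}))
    \<and> (\<forall>s k. r < s \<longrightarrow> s < t \<longrightarrow> 0 \<le> q s k \<and> norm (n s k) \<le> norm (freq k) * q s k)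
    \<and> (\<forall>s. r < s \<longrightarrow> s < t \<longrightarrow> 0 \<le> \<beta> s)
    \<and> (\<forall>s F. r < s \<longrightarrow> s < t \<longrightarrow> finite F \<longrightarrow> (\<Sum>k\<in>F. (q s k)^2) \<le> (\<beta> s)^2)"

text \<open>The integrand is singular at s = t, but its antiderivative is continuous up to there, so
  the fundamental theorem with derivatives in the interior applies.\<close>

lemma has_integral_powr_left:
  fixes r t c :: real
  assumes "r \<le> t" "0 < c" "c < 1"
  shows "((\<lambda>s. (t - s) powr (- c)) has_integral (t - r) powr (1 - c) / (1 - c)) {r..t}"
proof -
  have "((\<lambda>s. (t - s) powr (- c)) has_integral (- ((t - t) powr (1 - c) / (1 - c))) - (- ((t - r) powr (1 - c) / (1 - c)))) {r..t}"
  proof (rule fundamental_theorem_of_calculus_interior[OF assms(1)])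
    show "continuous_on {r..t} (\<lambda>s. - ((t - s) powr (1 - c) / (1 - c)))"
      using assms by (intro continuous_intros continuous_on_powr') auto
    fix s assume s: "s \<in> {r<..<t}"
    have "((\<lambda>s. - ((t - s) powr (1 - c) / (1 - c))) has_real_derivative (t - s) powr (- c)) (at s)"
    proof -
      have "((\<lambda>s. (t - s) powr (1 - c)) has_real_derivative (1 - c) * (t - s) powr (1 - c - of_nat 1) * (-1)) (at s)"
        by (rule DERIV_fun_powr) (use s in \<open>auto intro!: derivative_eq_intros\<close>)
      from DERIV_minus[OF DERIV_cdivide[OF this, of "1 - c"]] show ?thesis using assms by simp
    qed
    then show "((\<lambda>s. - ((t - s) powr (1 - c) / (1 - c))) has_vector_derivative (t - s) powr (- c)) (at s)"
      by (simp add: has_real_derivative_iff_has_vector_derivative)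
  qed
  then show ?thesis by simp
qed

lemma has_integral_powr_right:
  fixes r t c :: real
  assumes "r \<le> t" "0 < c" "c < 1"
  shows "((\<lambda>s. (s - r) powr (- c)) has_integral (t - r) powr (1 - c) / (1 - c)) {r..t}"
proof -
  have "((\<lambda>s. (s - r) powr (- c)) has_integral ((t - r) powr (1 - c) / (1 - c)) - ((r - r) powr (1 - c) / (1 - c))) {r..t}"
  proof (rule fundamental_theorem_of_calculus_interior[OF assms(1)])
    show "continuous_on {r..t} (\<lambda>s. (s - r) powr (1 - c) / (1 - c))"
      using assms by (intro continuous_intros continuous_on_powr') auto
    fix s assume s: "s \<in> {r<..<t}"
    have "((\<lambda>s. (s - r) powr (1 - c) / (1 - c)) has_real_derivative (s - r) powr (- c)) (at s)"
    proof -
      have "((\<lambda>s. (s - r) powr (1 - c)) has_real_derivative (1 - c) * (s - r) powr (1 - c - of_nat 1) * 1) (at s)"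
        by (rule DERIV_fun_powr) (use s in \<open>auto intro!: derivative_eq_intros\<close>)
      from DERIV_cdivide[OF this, of "1 - c"] show ?thesis using assms by simp
    qed
    then show "((\<lambda>s. (s - r) powr (1 - c) / (1 - c)) has_vector_derivative (s - r) powr (- c)) (at s)"
      by (simp add: has_real_derivative_iff_has_vector_derivative)
  qed
  then show ?thesis by simp
qed

text \<open>The exponent (b + 2)/4 collects the weight b, one derivative from the divergence and one
  unit from the l^1 summation in dimension two; the singularity is integrable in time exactly when b
  < 2.\<close>

lemma source_pointwise:
  fixes n :: "real \<Rightarrow> int^2 \<Rightarrow> complex"
  assumes src: "source n q \<beta> r t" and b: "0 \<le> b" "b \<le> 3"
    and s: "r < s" "s < t" and F: "finite F"
  shows "(\<Sum>k\<in>F. norm (freq k) powr b * norm (exp (- (t - s) * lam k) * n s k)) \<le> 18 * (min (t - s) 1) powr (- (b + 2) / 4) * \<beta> s"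
proof -
  have ns: "norm (n s k) \<le> norm (freq k) * q s k" and q0: "0 \<le> q s k" for k using src s unfolding source_def by blast+
  have "(\<Sum>k\<in>F. norm (freq k) powr b * norm (exp (- (t - s) * lam k) * n s k))
      \<le> (\<Sum>k\<in>F. norm (freq k) powr (b + 1) * exp (- (t - s) * lam k) * q s k)"
  proof (rule sum_mono)
    fix k
    have "norm (freq k) powr b * norm (exp (- (t - s) * lam k) * n s k)
        = norm (freq k) powr b * exp (- (t - s) * lam k) * norm (n s k)" by (simp add: norm_mult)
    also have "\<dots> \<le> norm (freq k) powr b * exp (- (t - s) * lam k) * (norm (freq k) * q s k)"
      by (intro mult_left_mono ns) auto
    also have "\<dots> = norm (freq k) powr (b + 1) * exp (- (t - s) * lam k) * q s k"
      by (simp add: powr_add)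
    finally show "norm (freq k) powr b * norm (exp (- (t - s) * lam k) * n s k) \<le> norm (freq k) powr (b + 1) * exp (- (t - s) * lam k) * q s k" .
  qed
  also have "\<dots> \<le> 18 * (min (t - s) 1) powr (- (b + 1 + 1) / 4) * \<beta> s"
    by (rule smoothing_l1) (use src s F b q0 in \<open>auto simp: source_def\<close>)
  also have "- (b + 1 + 1) / 4 = - (b + 2) / 4" by simp
  finally show ?thesis .
qed

text \<open>The pointwise estimate integrated in time. The majorant \<open>g\<close> is left open,
  since \<open>\<beta>\<close> is constant in some uses and singular at r in others. It also
  justifies exchanging the time integral with the Fourier series.\<close>

lemma duhamel_estimate:
  fixes n :: "real \<Rightarrow> int^2 \<Rightarrow> complex"
  assumes src: "source n q \<beta> r t" and b: "0 \<le> b" "b \<le> 3"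
    and g: "g integrable_on {r..t}"
    and gb: "\<And>s. r < s \<Longrightarrow> s < t \<Longrightarrow> 18 * (min (t - s) 1) powr (- (b + 2) / 4) * \<beta> s \<le> g s"
  shows "\<And>k. (\<lambda>s. exp (- (t - s) * lam k) * n s k) integrable_on {r..t}"
    and "\<And>F. finite F \<Longrightarrow> (\<Sum>k\<in>F. norm (freq k) powr b * norm (duhamel n r t k)) \<le> integral {r..t} g"
    and "(\<lambda>s. syn (\<lambda>k. exp (- (t - s) * lam k) * n s k) x) integrable_on {r..t}"
    and "integral {r..t} (\<lambda>s. syn (\<lambda>k. exp (- (t - s) * lam k) * n s k) x) = syn (duhamel n r t) x"
    and "(\<lambda>k. norm (duhamel n r t k)) summable_on UNIV"
proof -
  let ?I = "{r<..<t}" and ?e = "\<lambda>k s. exp (- (t - s) * lam k) * n s k"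
  have gI: "g integrable_on ?I" using g by (simp add: integrable_on_open_interval_real)
  have fin: "(\<Sum>k\<in>F. norm (freq k) powr b * norm (?e k s)) \<le> g s" if "finite F" "s \<in> ?I" for F s
    using source_pointwise[OF src b _ _ that(1), of s] gb[of s] that(2) by auto
  have g0: "0 \<le> g s" if "s \<in> ?I" for s using fin[of "{}" s] that by simp
  \<comment> \<open>For k = 0 both sides vanish: a divergence has mean zero, here because
    \<open>n s 0\<close> is bounded by \<open>norm (freq 0) * q s 0\<close>.\<close>
  have one: "norm (?e k s) \<le> norm (freq k) powr b * norm (?e k s)" if s: "s \<in> ?I" for k s
  proof (cases "k = 0")
    case True
    have "r < s" "s < t" using s by auto
    then have "norm (n s 0) \<le> norm (freq 0) * q s 0" using src unfolding source_def by blast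
    then show ?thesis using True by simp
  next
    case False
    have "1 \<le> norm (freq k) powr b" using norm_freq_ge_1[OF False] b by (simp add: ge_one_powr_ge_zero)
    then show ?thesis using mult_right_mono[of 1 _ "norm (?e k s)"] by fastforce
  qed
  have fin1: "(\<Sum>k\<in>F. norm (?e k s)) \<le> g s" if "finite F" "s \<in> ?I" for F s
    using sum_mono[of F "\<lambda>k. norm (?e k s)", OF one[OF that(2)]] fin[OF that] by linarith
  have m: "?e k \<in> borel_measurable (lebesgue_on ?I)" for k
  proof -
    have "(\<lambda>s. complex_of_real (exp (- (t - s) * lam k))) \<in> borel_measurable (lebesgue_on ?I)"
      by (intro continuous_imp_measurable_on_sets_lebesgue continuous_intros) auto
    moreover have "(\<lambda>s. n s k) \<in> borel_measurable (lebesgue_on ?I)" using src by (simp add: source_def)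
    ultimately show ?thesis by (rule borel_measurable_times)
  qed
  have i: "?e k integrable_on ?I" for k
    by (rule measurable_bounded_by_integrable_imp_integrable[OF m gI]) (use fin1[of "{k}"] in auto)
  then show ik: "\<And>k. ?e k integrable_on {r..t}" by (simp add: integrable_on_open_interval_real)
  have d: "duhamel n r t k = integral ?I (?e k)" for k
    unfolding duhamel_def by (simp add: integral_open_interval_real)
  have ni: "(\<lambda>s. norm (?e k s)) integrable_on ?I" for k
    using absolutely_integrable_integrable_bound[OF _ i gI, of k] fin1[of "{k}"] by (simp add: absolutely_integrable_on_def)
  show "(\<Sum>k\<in>F. norm (freq k) powr b * norm (duhamel n r t k)) \<le> integral {r..t} g" if F: "finite F" for F
  proof -
    have "(\<Sum>k\<in>F. norm (freq k) powr b * norm (duhamel n r t k)) \<le> (\<Sum>k\<in>F. norm (freq k) powr b * integral ?I (\<lambda>s. norm (?e k s)))"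
      unfolding d by (intro sum_mono mult_left_mono integral_norm_bound_integral i ni) auto
    also have "\<dots> = integral ?I (\<lambda>s. \<Sum>k\<in>F. norm (freq k) powr b * norm (?e k s))"
      by (subst integral_sum[OF F]) (intro integrable_on_mult_right ni, simp only: integral_mult_right)
    also have "\<dots> \<le> integral ?I g"
      by (rule integral_le) (intro integrable_sum F integrable_on_mult_right ni, rule gI, rule fin[OF F])
    finally show ?thesis by (simp add: integral_open_interval_real)
  qed
  let ?f = "\<lambda>k s. ?e k s * cis (freq k \<bullet> x)"
  have fi: "?f k integrable_on ?I" for k by (intro integrable_on_mult_left i)
  have fb: "(\<Sum>k\<in>F. norm (?f k s)) \<le> g s" if "finite F" "s \<in> ?I" for F s
    using fin1[OF that] by (simp add: norm_mult)
  note sw = integral_infsum_dominated[OF fi gI fb]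
  have c1: "(\<lambda>s. csyn (\<lambda>k. exp (- (t - s) * lam k) * n s k) x) integrable_on ?I"
    using sw(1) by (simp only: csyn_def)
  have "(\<lambda>s. syn (\<lambda>k. exp (- (t - s) * lam k) * n s k) x) integrable_on ?I"
    using integrable_linear[OF c1 bounded_linear_Re] by (simp only: o_def syn_def)
  then show "(\<lambda>s. syn (\<lambda>k. exp (- (t - s) * lam k) * n s k) x) integrable_on {r..t}"
    by (simp add: integrable_on_open_interval_real)
  have "integral ?I (\<lambda>s. syn (\<lambda>k. exp (- (t - s) * lam k) * n s k) x) = Re (integral ?I (\<lambda>s. csyn (\<lambda>k. exp (- (t - s) * lam k) * n s k) x))"
    using integral_linear[OF c1 bounded_linear_Re] by (simp only: o_def syn_def)
  also have "integral ?I (\<lambda>s. csyn (\<lambda>k. exp (- (t - s) * lam k) * n s k) x) = (\<Sum>\<^sub>\<infinity>k. integral ?I (?f k))"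
    using sw(3) by (simp only: csyn_def)
  also have "\<dots> = csyn (duhamel n r t) x"
    unfolding csyn_def d by (rule infsum_cong) (rule integral_mult_left)
  finally show "integral {r..t} (\<lambda>s. syn (\<lambda>k. exp (- (t - s) * lam k) * n s k) x) = syn (duhamel n r t) x"
    by (simp add: syn_def integral_open_interval_real)
  have "norm (integral ?I (?f k)) = norm (duhamel n r t k)" for k
    unfolding d integral_mult_left by (simp add: norm_mult)
  then show "(\<lambda>k. norm (duhamel n r t k)) summable_on UNIV" using sw(2) by simp
qed

text \<open>72/(2 - b) = 18 * 4/(2 - b), from the integral of (t - s)^{-(b+2)/4}. The positive power
  of the length that remains is what makes the fixed point map contract on short intervals.\<close>

lemma duhamel_const:
  fixes n :: "real \<Rightarrow> int^2 \<Rightarrow> complex"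
  assumes src: "source n q (\<lambda>_. B) r t" and t: "r \<le> t" "t - r \<le> 1" and b: "0 \<le> b" "b < 2" and B: "0 \<le> B" and F: "finite F"
  shows "(\<Sum>k\<in>F. norm (freq k) powr b * norm (duhamel n r t k)) \<le> 72 / (2 - b) * B * (t - r) powr ((2 - b) / 4)"
proof -
  have h: "((\<lambda>s. (18 * B) * (t - s) powr (- ((b + 2) / 4))) has_integral (18 * B) * ((t - r) powr (1 - (b + 2) / 4) / (1 - (b + 2) / 4))) {r..t}"
    by (intro has_integral_mult_right has_integral_powr_left t) (use b in auto)
  have "(\<Sum>k\<in>F. norm (freq k) powr b * norm (duhamel n r t k)) \<le> integral {r..t} (\<lambda>s. (18 * B) * (t - s) powr (- ((b + 2) / 4)))"
    by (rule duhamel_estimate(2)[OF src b(1) _ has_integral_integrable[OF h] _ F]) (use b t in \<open>auto simp: minus_divide_left min_def\<close>)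
  also have "\<dots> = (18 * B) * ((t - r) powr (1 - (b + 2) / 4) / (1 - (b + 2) / 4))" by (rule integral_unique[OF h])
  also have "1 - (b + 2) / 4 = (2 - b) / 4" by (simp add: field_simps)
  finally show ?thesis using b by (simp add: field_simps)
qed

lemma duhamel_const_integrable:
  fixes n :: "real \<Rightarrow> int^2 \<Rightarrow> complex"
  assumes src: "source n q (\<lambda>_. B) r t" and t: "r \<le> t" and B: "0 \<le> B"
  shows "\<And>k. (\<lambda>s. exp (- (t - s) * lam k) * n s k) integrable_on {r..t}"
    and "(\<lambda>s. syn (\<lambda>k. exp (- (t - s) * lam k) * n s k) x) integrable_on {r..t}"
    and "integral {r..t} (\<lambda>s. syn (\<lambda>k. exp (- (t - s) * lam k) * n s k) x) = syn (duhamel n r t) x"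
    and "(\<lambda>k. norm (duhamel n r t k)) summable_on UNIV"
    and "(\<lambda>k. norm (freq k) * norm (duhamel n r t k)) summable_on UNIV"
proof -
  \<comment> \<open>The summand 1 covers t - s > 1, so the length of the interval is
    unrestricted.\<close>
  let ?g = "\<lambda>s. (18 * B) * (1 + (t - s) powr (- (3/4)))"
  have h: "?g integrable_on {r..t}"
    by (intro integrable_on_mult_right integrable_add integrable_const_ivl
        has_integral_integrable[OF has_integral_powr_left]) (use t in auto)
  have le: "18 * (min (t - s) 1) powr (- (1 + 2) / 4) * B \<le> ?g s" if "r < s" "s < t" for s
  proof -
    have "(min (t - s) 1) powr (- (3/4)) \<le> 1 + (t - s) powr (- (3/4))" by (auto simp: min_def)
    from mult_left_mono[OF this, of "18 * B"] show ?thesis using B by (simp add: mult_ac)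
  qed
  note d = duhamel_estimate[OF src _ _ h le]
  show "\<And>k. (\<lambda>s. exp (- (t - s) * lam k) * n s k) integrable_on {r..t}" by (rule d(1)) auto
  show "(\<lambda>s. syn (\<lambda>k. exp (- (t - s) * lam k) * n s k) x) integrable_on {r..t}" by (rule d(3)) auto
  show "integral {r..t} (\<lambda>s. syn (\<lambda>k. exp (- (t - s) * lam k) * n s k) x) = syn (duhamel n r t) x" by (rule d(4)) auto
  show "(\<lambda>k. norm (duhamel n r t k)) summable_on UNIV" by (rule d(5)) auto
  show "(\<lambda>k. norm (freq k) * norm (duhamel n r t k)) summable_on UNIV"
    by (rule summable_on_boundI(1)[where B="integral {r..t} ?g"]) (use d(2) in auto)
qed

lemma source_subinterval:
  fixes n :: "real \<Rightarrow> int^2 \<Rightarrow> complex"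
  assumes "source n q \<beta> r t" "r \<le> r'" "t' \<le> t" shows "source n q \<beta> r' t'"
proof -
  have sub: "{r'<..<t'} \<subseteq> {r<..<t}" using assms by auto
  have m: "(\<lambda>s. n s k) \<in> borel_measurable (lebesgue_on {r'<..<t'})" for k
    using assms(1) unfolding source_def by (intro measurable_restrict_mono[OF _ sub]) blast
  have s: "r < s \<and> s < t" if "r' < s" "s < t'" for s using that assms(2,3) by linarith
  show ?thesis
    unfolding source_def
    using m s assms(1)[unfolded source_def] by (intro conjI allI impI) blast+
qed

lemma duhamel_split:
  fixes n :: "real \<Rightarrow> int^2 \<Rightarrow> complex"
  assumes i: "(\<lambda>s. exp (- (t - s) * lam k) * n s k) integrable_on {r..t}" and rt: "r \<le> t'" "t' \<le> t"
  shows "duhamel n r t k = exp (- (t - t') * lam k) * duhamel n r t' k + duhamel n t' t k"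
proof -
  have "duhamel n r t k = integral {r..t'} (\<lambda>s. exp (- (t - s) * lam k) * n s k) + duhamel n t' t k"
    unfolding duhamel_def by (rule Henstock_Kurzweil_Integration.integral_combine[OF rt i, symmetric])
  also have "integral {r..t'} (\<lambda>s. exp (- (t - s) * lam k) * n s k)
     = integral {r..t'} (\<lambda>s. exp (- (t - t') * lam k) * (exp (- (t' - s) * lam k) * n s k))"
  proof (rule integral_cong)
    fix s
    have "exp (- (t - s) * lam k) = exp (- (t - t') * lam k) * exp (- (t' - s) * lam k)"
      by (simp add: algebra_simps flip: exp_add)
    then show "exp (- (t - s) * lam k) * n s k = exp (- (t - t') * lam k) * (exp (- (t' - s) * lam k) * n s k)" by simp
  qed
  also have "\<dots> = exp (- (t - t') * lam k) * duhamel n r t' k" unfolding duhamel_def by (rule integral_mult_right)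
  finally show ?thesis .
qed

lemma duhamel_hermitian:
  assumes "\<And>s. hermitian_coeffs (n s)" shows "hermitian_coeffs (duhamel n r t)"
  unfolding hermitian_coeffs_def
proof
  fix k
  have "cnj (duhamel n r t k) = integral {r..t} (\<lambda>s. cnj (exp (- (t - s) * lam k) * n s k))"
    unfolding duhamel_def by (simp only: integral_cnj_HK)
  then show "duhamel n r t (- k) = cnj (duhamel n r t k)"
    using assms by (simp add: duhamel_def hermitian_coeffs_def)
qed

text \<open>Interpolation between the bounds 1 and y. For y = h |k|^4 the exponent 1/8 costs half a
  derivative, and 1 + 1/2 is still below the threshold 2 of \<open>duhamel_const\<close>.\<close>

lemma one_minus_exp_le:
  assumes "0 \<le> (y::real)" shows "\<bar>exp (- y) - 1\<bar> \<le> y powr (1/8)"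
proof -
  have 1: "\<bar>exp (- y) - 1\<bar> \<le> 1" using assms by (simp add: abs_if)
  have 2: "\<bar>exp (- y) - 1\<bar> \<le> y" using exp_ge_add_one_self[of "- y"] assms by (simp add: abs_if)
  show ?thesis
  proof (cases "y \<le> 1")
    case True
    have "y \<le> y powr (1/8)"
    proof (cases "y = 0")
      case False
      then have "y powr 1 \<le> y powr (1/8)" using True assms by (intro powr_mono') auto
      then show ?thesis using assms by simp
    qed simp
    then show ?thesis using 2 by linarith
  next
    case False
    then have "1 \<le> y powr (1/8)" by (intro ge_one_powr_ge_zero) auto
    then show ?thesis using 1 by linarith
  qed
qed

lemma duhamel_same [simp]: "duhamel n t t k = 0" by (simp add: duhamel_def)

text \<open>The difference is the Duhamel integral over [t', t] plus exp (-h lam) - 1 acting on the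
  older part, h = t - t'. The constants are 72/(2 - b) at b = 1 and at b = 3/2.\<close>

lemma duhamel_holder:
  fixes n :: "real \<Rightarrow> int^2 \<Rightarrow> complex"
  assumes src: "source n q (\<lambda>_. B) r T" and B: "0 \<le> B" and t: "r \<le> t'" "t' \<le> t" "t \<le> T" "T - r \<le> 1" and F: "finite F"
  shows "(\<Sum>k\<in>F. norm (freq k) * norm (duhamel n r t k - duhamel n r t' k)) \<le> 72 * B * (t - t') powr (1/4) + 144 * B * (t - t') powr (1/8)"
proof -
  let ?h = "t - t'"
  have h: "0 \<le> ?h" "?h \<le> 1" using t by auto
  have s1: "source n q (\<lambda>_. B) r t" "source n q (\<lambda>_. B) t' t" "source n q (\<lambda>_. B) r t'"
    using t by (auto intro: source_subinterval[OF src])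
  have i: "(\<lambda>s. exp (- (t - s) * lam k) * n s k) integrable_on {r..t}" for k
    using duhamel_const_integrable(1)[OF s1(1) _ B, of k] t by simp
  have le: "norm (freq k) * norm (duhamel n r t k - duhamel n r t' k)
      \<le> norm (freq k) powr 1 * norm (duhamel n t' t k) + ?h powr (1/8) * (norm (freq k) powr (3/2) * norm (duhamel n r t' k))" for k
  proof -
    have e: "duhamel n r t k - duhamel n r t' k = duhamel n t' t k + (exp (- ?h * lam k) - 1) * duhamel n r t' k"
      using duhamel_split[of t k n r t', OF i t(1,2)] by (simp add: algebra_simps)
    have "norm (duhamel n r t k - duhamel n r t' k) \<le> norm (duhamel n t' t k) + norm ((exp (- ?h * lam k) - 1) * duhamel n r t' k)"
      unfolding e by (rule norm_triangle_ineq)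
    also have "norm ((exp (- ?h * lam k) - 1) * duhamel n r t' k) = \<bar>exp (- (?h * lam k)) - 1\<bar> * norm (duhamel n r t' k)"
      by (simp only: norm_mult norm_of_real minus_mult_left)
    also have "\<dots> \<le> (?h * lam k) powr (1/8) * norm (duhamel n r t' k)"
      using h by (intro mult_right_mono one_minus_exp_le) auto
    also have "(?h * lam k) powr (1/8) = ?h powr (1/8) * norm (freq k) powr (1/2)"
    proof -
      have "lam k powr (1/8) = norm (freq k) powr (1/2)"
      proof (cases "freq k = 0")
        case False
        then have e: "lam k = norm (freq k) powr 4" unfolding lam_def by simp
        show ?thesis unfolding e powr_powr by simp
      qed (simp add: lam_def)
      then show ?thesis using h by (simp add: powr_mult)
    qed
    finally have "norm (freq k) * norm (duhamel n r t k - duhamel n r t' k)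
       \<le> norm (freq k) * (norm (duhamel n t' t k) + ?h powr (1/8) * norm (freq k) powr (1/2) * norm (duhamel n r t' k))"
      by (intro mult_left_mono) auto
    also have "\<dots> = norm (freq k) powr 1 * norm (duhamel n t' t k) + ?h powr (1/8) * ((norm (freq k) powr (1/2) * norm (freq k) powr 1) * norm (duhamel n r t' k))"
      by (simp add: algebra_simps)
    also have "norm (freq k) powr (1/2) * norm (freq k) powr 1 = norm (freq k) powr (3/2)" unfolding powr_add[symmetric] by simp
    finally show ?thesis .
  qed
  have 1: "(\<Sum>k\<in>F. norm (freq k) * norm (duhamel n r t k - duhamel n r t' k))
     \<le> (\<Sum>k\<in>F. norm (freq k) powr 1 * norm (duhamel n t' t k)) + ?h powr (1/8) * (\<Sum>k\<in>F. norm (freq k) powr (3/2) * norm (duhamel n r t' k))"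
    unfolding sum_distrib_left sum.distrib[symmetric] by (intro sum_mono le)
  have 2: "(\<Sum>k\<in>F. norm (freq k) powr 1 * norm (duhamel n t' t k)) \<le> 72 * B * ?h powr (1/4)"
    using duhamel_const[OF s1(2) t(2) h(2) _ _ B F, of 1] by simp
  have 3: "(\<Sum>k\<in>F. norm (freq k) powr (3/2) * norm (duhamel n r t' k)) \<le> 144 * B"
  proof -
    have "(\<Sum>k\<in>F. norm (freq k) powr (3/2) * norm (duhamel n r t' k)) \<le> 144 * B * (t' - r) powr (1/8)"
      using duhamel_const[OF s1(3) t(1) _ _ _ B F, of "3/2"] t by simp
    also have "\<dots> \<le> 144 * B * 1" using t B by (intro mult_left_mono powr_le1) auto
    finally show ?thesis by simp
  qed
  have "?h powr (1/8) * (\<Sum>k\<in>F. norm (freq k) powr (3/2) * norm (duhamel n r t' k)) \<le> ?h powr (1/8) * (144 * B)"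
    by (intro mult_left_mono 3) simp
  also have "\<dots> = 144 * B * ?h powr (1/8)" by simp
  finally show ?thesis using 1 2 by linarith
qed

lemma duhamel_uniform_continuity:
  fixes n :: "real \<Rightarrow> int^2 \<Rightarrow> complex"
  assumes src: "source n q (\<lambda>_. B) r T" and B: "0 \<le> B" and T: "T - r \<le> 1" and t: "t \<in> {r..T}"
  shows "((\<lambda>s. \<Sum>\<^sub>\<infinity>k. norm (freq k) * norm (duhamel n r s k - duhamel n r t k)) \<longlongrightarrow> 0) (at t within {r..T})"
    and "\<And>s. s \<in> {r..T} \<Longrightarrow> (\<lambda>k. norm (freq k) * norm (duhamel n r s k - duhamel n r t k)) summable_on UNIV"
proof -
  let ?\<phi> = "\<lambda>s. 72 * B * \<bar>s - t\<bar> powr (1/4) + 144 * B * \<bar>s - t\<bar> powr (1/8)"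
  have b: "(\<Sum>k\<in>F. norm (freq k) * norm (duhamel n r s k - duhamel n r t k)) \<le> ?\<phi> s" if "s \<in> {r..T}" "finite F" for s F
  proof (cases "s \<le> t")
    case True
    then show ?thesis using duhamel_holder[OF src B _ True _ T that(2)] that t by (simp add: norm_minus_commute)
  next
    case False
    then show ?thesis using duhamel_holder[OF src B _ _ _ T that(2), of t s] that t by simp
  qed
  show "(\<lambda>k. norm (freq k) * norm (duhamel n r s k - duhamel n r t k)) summable_on UNIV" if "s \<in> {r..T}" for s
    by (rule summable_on_boundI(1)[OF b[OF that]]) auto
  have le: "(\<Sum>\<^sub>\<infinity>k. norm (freq k) * norm (duhamel n r s k - duhamel n r t k)) \<le> ?\<phi> s" if "s \<in> {r..T}" for s
    by (rule summable_on_boundI(2)[OF b[OF that]]) auto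
  have "((\<lambda>s. 72 * B * \<bar>s - t\<bar> powr (1/4) + 144 * B * \<bar>s - t\<bar> powr (1/8)) \<longlongrightarrow> 72 * B * \<bar>t - t\<bar> powr (1/4) + 144 * B * \<bar>t - t\<bar> powr (1/8)) (at t within {r..T})"
    by (intro tendsto_intros tendsto_powr') auto
  then have lim: "(?\<phi> \<longlongrightarrow> 0) (at t within {r..T})" by simp
  show "((\<lambda>s. \<Sum>\<^sub>\<infinity>k. norm (freq k) * norm (duhamel n r s k - duhamel n r t k)) \<longlongrightarrow> 0) (at t within {r..T})"
    by (rule tendsto_sandwich[OF _ _ tendsto_const lim])
       (auto intro!: always_eventually infsum_nonneg le simp: eventually_at_filter)
qed

lemma exp_coeffs_continuous:
  fixes f :: "int^2 \<Rightarrow> complex"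
  assumes f: "(\<lambda>k. norm (freq k) * norm (f k)) summable_on UNIV" and t: "0 \<le> t"
  shows "((\<lambda>s. \<Sum>\<^sub>\<infinity>k. norm (freq k) * norm (exp (- s * lam k) * f k - exp (- t * lam k) * f k)) \<longlongrightarrow> 0) (at t within {0..})"
    and "\<And>s. 0 \<le> s \<Longrightarrow> (\<lambda>k. norm (freq k) * norm (exp (- s * lam k) * f k - exp (- t * lam k) * f k)) summable_on UNIV"
proof -
  have b: "norm (freq k) * norm (exp (- s * lam k) * f k - exp (- t * lam k) * f k) \<le> 2 * (norm (freq k) * norm (f k))" if "0 \<le> s" for s k
  proof -
    have e: "norm (exp (- s * lam k) * f k) \<le> 1 * norm (f k)" if "0 \<le> s" for s
      unfolding norm_mult using that by (intro mult_right_mono) auto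
    have "norm (exp (- s * lam k) * f k - exp (- t * lam k) * f k) \<le> 2 * norm (f k)"
      using norm_triangle_ineq4[of "exp (- s * lam k) * f k" "exp (- t * lam k) * f k"] e[OF that] e[OF t] by linarith
    then have "norm (freq k) * norm (exp (- s * lam k) * f k - exp (- t * lam k) * f k) \<le> norm (freq k) * (2 * norm (f k))"
      by (intro mult_left_mono) auto
    then show ?thesis by (simp only: mult_ac)
  qed
  show "(\<lambda>k. norm (freq k) * norm (exp (- s * lam k) * f k - exp (- t * lam k) * f k)) summable_on UNIV" if "0 \<le> s" for s
    by (rule summable_on_real_comparison[OF summable_on_cmult_right[OF f, of 2] _ b[OF that]]) simp
  show "((\<lambda>s. \<Sum>\<^sub>\<infinity>k. norm (freq k) * norm (exp (- s * lam k) * f k - exp (- t * lam k) * f k)) \<longlongrightarrow> 0) (at t within {0..})"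
  proof (rule infsum_tendsto_zero_dominated[OF _ _ summable_on_cmult_right[OF f, of 2]])
    fix k
    have "((\<lambda>s. norm (freq k) * norm (exp (- s * lam k) * f k - exp (- t * lam k) * f k)) \<longlongrightarrow> norm (freq k) * norm (exp (- t * lam k) * f k - exp (- t * lam k) * f k)) (at t within {0..})"
      by (intro tendsto_intros)
    then show "((\<lambda>s. norm (freq k) * norm (exp (- s * lam k) * f k - exp (- t * lam k) * f k)) \<longlongrightarrow> 0) (at t within {0..})" by simp
  next
    show "\<forall>\<^sub>F s in at t within {0..}. \<forall>k. 0 \<le> norm (freq k) * norm (exp (- s * lam k) * f k - exp (- t * lam k) * f k) \<and>
        norm (freq k) * norm (exp (- s * lam k) * f k - exp (- t * lam k) * f k) \<le> 2 * (norm (freq k) * norm (f k))"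
      unfolding eventually_at_filter using b by (intro always_eventually) simp
  qed
qed

text \<open>Time continuity in the |k|-weighted l^1 norm, including the starting time r. The fixed
  point space, the gluing of solutions and the final continuity argument all rely on it.\<close>

lemma mild_coeffs_continuous:
  fixes n :: "real \<Rightarrow> int^2 \<Rightarrow> complex" and f :: "int^2 \<Rightarrow> complex"
  assumes f: "(\<lambda>k. norm (freq k) * norm (f k)) summable_on UNIV"
    and src: "source n q (\<lambda>_. B) r T" and B: "0 \<le> B" and T: "T - r \<le> 1" and t: "t \<in> {r..T}"
    and a: "\<And>s k. s \<in> {r..T} \<Longrightarrow> a s k = exp (- (s - r) * lam k) * f k - duhamel n r s k"
  shows "((\<lambda>s. \<Sum>\<^sub>\<infinity>k. norm (freq k) * norm (a s k - a t k)) \<longlongrightarrow> 0) (at t within {r..T})"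
proof -
  have t0: "0 \<le> t - r" using t by auto
  note E = exp_coeffs_continuous[OF f t0] and D = duhamel_uniform_continuity[OF src B T t]
  let ?E = "\<lambda>s k. norm (freq k) * norm (exp (- s * lam k) * f k - exp (- (t - r) * lam k) * f k)"
  let ?D = "\<lambda>s k. norm (freq k) * norm (duhamel n r s k - duhamel n r t k)"
  have le: "(\<Sum>\<^sub>\<infinity>k. norm (freq k) * norm (a s k - a t k)) \<le> infsum (?E (s - r)) UNIV + infsum (?D s) UNIV" if s: "s \<in> {r..T}" for s
  proof -
    have sE: "?E (s - r) summable_on UNIV" and sD: "?D s summable_on UNIV" using E(2)[of "s - r"] D(2)[of s] s by auto
    have p: "norm (freq k) * norm (a s k - a t k) \<le> ?E (s - r) k + ?D s k" for k
    proof -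
      have e: "a s k - a t k = (exp (- (s - r) * lam k) * f k - exp (- (t - r) * lam k) * f k) - (duhamel n r s k - duhamel n r t k)"
        using a[OF s] a[OF t] by simp
      have "norm (a s k - a t k) \<le> norm (exp (- (s - r) * lam k) * f k - exp (- (t - r) * lam k) * f k) + norm (duhamel n r s k - duhamel n r t k)"
        unfolding e by (rule norm_triangle_ineq4)
      from mult_left_mono[OF this, of "norm (freq k)"] show ?thesis by (simp only: distrib_left norm_ge_zero)
    qed
    have "(\<lambda>k. norm (freq k) * norm (a s k - a t k)) summable_on UNIV"
      by (rule summable_on_real_comparison[OF summable_on_add[OF sE sD] _ p]) simp
    then have "(\<Sum>\<^sub>\<infinity>k. norm (freq k) * norm (a s k - a t k)) \<le> (\<Sum>\<^sub>\<infinity>k. ?E (s - r) k + ?D s k)"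
      by (rule infsum_mono[OF _ summable_on_add[OF sE sD] p])
    then show ?thesis by (simp only: infsum_add[OF sE sD])
  qed
  have "filterlim (\<lambda>s. s - r) (at (t - r) within {0..}) (at t within {r..T})"
    unfolding filterlim_at by (auto simp: eventually_at_filter intro!: tendsto_intros)
  from filterlim_compose[OF E(1) this]
  have "((\<lambda>s. infsum (?E (s - r)) UNIV) \<longlongrightarrow> 0) (at t within {r..T})" .
  from tendsto_add[OF this D(1)]
  have lim: "((\<lambda>s. infsum (?E (s - r)) UNIV + infsum (?D s) UNIV) \<longlongrightarrow> 0) (at t within {r..T})" by simp
  show ?thesis
  proof (rule tendsto_sandwich[OF _ _ tendsto_const lim])
    show "\<forall>\<^sub>F s in at t within {r..T}. 0 \<le> (\<Sum>\<^sub>\<infinity>k. norm (freq k) * norm (a s k - a t k))"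
      by (intro always_eventually allI infsum_nonneg) simp
    show "\<forall>\<^sub>F s in at t within {r..T}. (\<Sum>\<^sub>\<infinity>k. norm (freq k) * norm (a s k - a t k)) \<le> infsum (?E (s - r)) UNIV + infsum (?D s) UNIV"
      unfolding eventually_at_filter by (intro always_eventually allI impI le)
  qed
qed

section \<open>Local existence\<close>

type_synonym field2 = "(real^2) \<Rightarrow>\<^sub>C (real^2)"

text \<open>The unknown \<open>G\<close> of the fixed point problem is the gradient field, not the
  function: bounded continuous maps into bounded continuous fields form a complete space, and the
  nonlinearity depends on the gradient alone.\<close>

definition NLc :: "real \<Rightarrow> (real \<Rightarrow>\<^sub>C field2) \<Rightarrow> real \<Rightarrow> int^2 \<Rightarrow> complex" where
  "NLc p G s k = div_coef (\<lambda>x. NL p (apply_bcontfun (apply_bcontfun G s) x)) k"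

lemma norm_apply_field:
  assumes "norm G \<le> R" shows "norm (apply_bcontfun (apply_bcontfun G s) x) \<le> R"
proof -
  have "norm (apply_bcontfun (apply_bcontfun G s) x) \<le> norm (apply_bcontfun G s)" by (rule norm_bounded)
  also have "\<dots> \<le> norm G" by (rule norm_bounded)
  finally show ?thesis using assms by simp
qed

lemma dist_apply_field:
  "norm (apply_bcontfun (apply_bcontfun G s) x - apply_bcontfun (apply_bcontfun H s) x) \<le> dist G H"
  using dist_bounded[of "apply_bcontfun G s" x "apply_bcontfun H s"] dist_bounded[of G s H] by (simp add: dist_norm)

lemma continuous_NL_field:
  assumes "2 < p" shows "continuous_on S (\<lambda>x. NL p (apply_bcontfun (g :: field2) x))"
  by (rule continuous_on_NL[OF assms]) (use continuous_on_apply_bcontfun in \<open>auto intro: continuous_on_subset\<close>)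

lemma NLc_diff:
  assumes p: "2 < p" "p < 3" and G: "norm G \<le> R" "norm H \<le> R"
  shows "NLc p G s k - NLc p H s k = div_coef (\<lambda>x. NL p (apply_bcontfun (apply_bcontfun G s) x) - NL p (apply_bcontfun (apply_bcontfun H s) x)) k"
    and "norm (NL p (apply_bcontfun (apply_bcontfun G s) x) - NL p (apply_bcontfun (apply_bcontfun H s) x)) \<le> 2 * R powr (p - 2) * dist G H"
proof -
  show "NLc p G s k - NLc p H s k = div_coef (\<lambda>x. NL p (apply_bcontfun (apply_bcontfun G s) x) - NL p (apply_bcontfun (apply_bcontfun H s) x)) k"
    unfolding NLc_def by (rule div_coef_diff) (rule continuous_NL_field[OF p(1)])+
  have "norm (NL p (apply_bcontfun (apply_bcontfun G s) x) - NL p (apply_bcontfun (apply_bcontfun H s) x))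
     \<le> 2 * R powr (p - 2) * norm (apply_bcontfun (apply_bcontfun G s) x - apply_bcontfun (apply_bcontfun H s) x)"
    by (rule NL_lipschitz[OF p norm_apply_field[OF G(2)] norm_apply_field[OF G(1)]])
  also have "\<dots> \<le> 2 * R powr (p - 2) * dist G H" by (intro mult_left_mono dist_apply_field) auto
  finally show "norm (NL p (apply_bcontfun (apply_bcontfun G s) x) - NL p (apply_bcontfun (apply_bcontfun H s) x)) \<le> 2 * R powr (p - 2) * dist G H" .
qed

lemma continuous_NLc:
  assumes p: "2 < p" "p < 3" shows "continuous_on S (\<lambda>s. NLc p G s k)"
proof -
  let ?R = "norm G"
  let ?g = "\<lambda>s. apply_bcontfun G s"
  have le: "norm (NLc p G s k - NLc p G t k) \<le> norm (freq k) * (2 * (2 * ?R powr (p - 2) * dist (?g s) (?g t)))" for s t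
  proof -
    have e: "NLc p G s k - NLc p G t k = div_coef (\<lambda>x. NL p (apply_bcontfun (?g s) x) - NL p (apply_bcontfun (?g t) x)) k"
      unfolding NLc_def by (rule div_coef_diff) (rule continuous_NL_field[OF p(1)])+
    have "norm (NL p (apply_bcontfun (?g s) x) - NL p (apply_bcontfun (?g t) x)) \<le> 2 * ?R powr (p - 2) * dist (?g s) (?g t)" for x
    proof -
      have "norm (NL p (apply_bcontfun (?g s) x) - NL p (apply_bcontfun (?g t) x)) \<le> 2 * ?R powr (p - 2) * norm (apply_bcontfun (?g s) x - apply_bcontfun (?g t) x)"
        by (rule NL_lipschitz[OF p]) (rule norm_apply_field, simp)+
      also have "\<dots> \<le> 2 * ?R powr (p - 2) * dist (?g s) (?g t)"
        using dist_bounded[of "?g s" x "?g t"] by (intro mult_left_mono) (auto simp: dist_norm)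
      finally show ?thesis .
    qed
    then show ?thesis unfolding e by (intro norm_div_coef_bounded)
  qed
  have cG: "continuous_on S ?g" using continuous_on_subset[OF continuous_on_apply_bcontfun] by blast
  show ?thesis
    unfolding continuous_on_def
  proof
    fix t assume t: "t \<in> S"
    have "(?g \<longlongrightarrow> ?g t) (at t within S)" using cG t by (simp add: continuous_on_def)
    then have "((\<lambda>s. norm (freq k) * (2 * (2 * ?R powr (p - 2) * dist (?g s) (?g t)))) \<longlongrightarrow> norm (freq k) * (2 * (2 * ?R powr (p - 2) * dist (?g t) (?g t)))) (at t within S)"
      by (intro tendsto_intros)
    then have lim: "((\<lambda>s. norm (freq k) * (2 * (2 * ?R powr (p - 2) * dist (?g s) (?g t)))) \<longlongrightarrow> 0) (at t within S)" by simp
    have "((\<lambda>s. NLc p G s k - NLc p G t k) \<longlongrightarrow> 0) (at t within S)"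
      by (rule Lim_null_comparison[OF _ lim]) (intro always_eventually allI le)
    then show "((\<lambda>s. NLc p G s k) \<longlongrightarrow> NLc p G t k) (at t within S)" by (rule LIM_zero_cancel)
  qed
qed

lemma NLc_source:
  assumes p: "2 < p" "p < 3" and G: "norm G \<le> R"
  shows "source (NLc p G) (\<lambda>s k. vcoef (\<lambda>x. NL p (apply_bcontfun (apply_bcontfun G s) x)) k) (\<lambda>_. 2 * R powr (p - 1)) r t"
  unfolding source_def
proof (intro conjI allI impI)
  fix k s and F :: "(int^2) set"
  show "(\<lambda>s. NLc p G s k) \<in> borel_measurable (lebesgue_on {r<..<t})"
    by (intro continuous_imp_measurable_on_sets_lebesgue continuous_NLc p) auto
  show "norm (NLc p G s k) \<le> norm (freq k) * vcoef (\<lambda>x. NL p (apply_bcontfun (apply_bcontfun G s) x)) k"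
    unfolding NLc_def by (rule norm_div_coef_le)
  show "(\<Sum>k\<in>F. (vcoef (\<lambda>x. NL p (apply_bcontfun (apply_bcontfun G s) x)) k)^2) \<le> (2 * R powr (p - 1))^2" if "finite F"
  proof -
    have "(\<Sum>k\<in>F. (vcoef (\<lambda>x. NL p (apply_bcontfun (apply_bcontfun G s) x)) k)^2) \<le> 2 * (R powr (p - 1))^2"
      by (rule sum_vcoef_bounded[OF norm_NL_le[OF p(1) norm_apply_field[OF G]] that])
    then show ?thesis by (simp add: power_mult_distrib) (smt (verit) zero_le_power2)
  qed
qed auto

lemma NLc_diff_source:
  assumes p: "2 < p" "p < 3" and G: "norm G \<le> R" "norm H \<le> R"
  shows "source (\<lambda>s k. NLc p G s k - NLc p H s k)
    (\<lambda>s k. vcoef (\<lambda>x. NL p (apply_bcontfun (apply_bcontfun G s) x) - NL p (apply_bcontfun (apply_bcontfun H s) x)) k)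
    (\<lambda>_. 2 * (2 * R powr (p - 2) * dist G H)) r t"
  unfolding source_def
proof (intro conjI allI impI)
  fix k s and F :: "(int^2) set"
  let ?V = "\<lambda>x. NL p (apply_bcontfun (apply_bcontfun G s) x) - NL p (apply_bcontfun (apply_bcontfun H s) x)"
  show "(\<lambda>s. NLc p G s k - NLc p H s k) \<in> borel_measurable (lebesgue_on {r<..<t})"
    by (intro continuous_imp_measurable_on_sets_lebesgue continuous_on_diff continuous_NLc p) auto
  show "norm (NLc p G s k - NLc p H s k) \<le> norm (freq k) * vcoef ?V k"
    unfolding NLc_diff(1)[OF p G] by (rule norm_div_coef_le)
  show "(\<Sum>k\<in>F. (vcoef ?V k)^2) \<le> (2 * (2 * R powr (p - 2) * dist G H))^2" if "finite F"
  proof -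
    have "(\<Sum>k\<in>F. (vcoef ?V k)^2) \<le> 2 * (2 * R powr (p - 2) * dist G H)^2"
      by (rule sum_vcoef_bounded[OF NLc_diff(2)[OF p G] that])
    also have "\<dots> \<le> (2 * (2 * R powr (p - 2) * dist G H))^2"
      unfolding power_mult_distrib[of 2] by (intro mult_right_mono) auto
    finally show ?thesis .
  qed
qed auto

text \<open>Contraction on the ball of radius 2M. With B = 2 (2M)^{p-1} the Duhamel term is at most
  72 B tau^{1/4} = 288 (2M)^{p-2} tau^{1/4} M, and the map has Lipschitz constant 288 (2M)^{p-2}
  tau^{1/4}; the condition on tau makes these at most M/2 and 1/2. The time step depends on the
  datum through \<open>M\<close> only.\<close>

lemma local_existence:
  fixes f :: "int^2 \<Rightarrow> complex"
  assumes p: "2 < p" "p < 3" and M: "0 < M" and \<tau>: "0 < \<tau>" "\<tau> \<le> 1" "288 * (2 * M) powr (p - 2) * \<tau> powr (1/4) \<le> 1/2"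
    and f: "(\<lambda>k. norm (freq k) * norm (f k)) summable_on UNIV" "(\<Sum>\<^sub>\<infinity>k. norm (freq k) * norm (f k)) \<le> M" "hermitian_coeffs f"
  obtains a n q B where "\<And>t. hermitian_coeffs (a t)"
    and "\<And>t. t \<in> {0..\<tau>} \<Longrightarrow> (\<lambda>k. norm (freq k) * norm (a t k)) summable_on UNIV"
    and "\<And>t k. t \<in> {0..\<tau>} \<Longrightarrow> a t k = exp (- t * lam k) * f k - duhamel n 0 t k"
    and "\<And>t k. t \<in> {0..\<tau>} \<Longrightarrow> n t k = div_coef (nonlin p (syn (a t))) k"
    and "source n q (\<lambda>_. B) 0 \<tau>" "0 \<le> B"
proof -
  define B where "B = 2 * (2 * M) powr (p - 1)"
  define aG where "aG G t k = exp (- t * lam k) * f k - duhamel (NLc p G) 0 t k" for G t k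
  \<comment> \<open>The bounded continuous functions of time live on the whole line, so time is
    clamped to [0, tau].\<close>
  define cl where "cl t = max 0 (min \<tau> t)" for t :: real
  have cl: "cl t \<in> {0..\<tau>}" for t using \<tau> by (auto simp: cl_def)
  have cl_id: "cl t = t" if "t \<in> {0..\<tau>}" for t using that by (auto simp: cl_def)
  have B0: "0 \<le> B" by (simp add: B_def)
  have src: "source (NLc p G) (\<lambda>s k. vcoef (\<lambda>x. NL p (apply_bcontfun (apply_bcontfun G s) x)) k) (\<lambda>_. B) 0 t" if "norm G \<le> 2 * M" for G t
    unfolding B_def by (rule NLc_source[OF p that])
  have small: "72 * B * \<tau> powr (1/4) \<le> M"
  proof -
    have "(2 * M) powr (p - 1) = (2 * M) powr (p - 2) * (2 * M) powr 1" unfolding powr_add[symmetric] by simp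
    then have "72 * B * \<tau> powr (1/4) = (288 * (2 * M) powr (p - 2) * \<tau> powr (1/4)) * M" using M by (simp add: B_def)
    also have "\<dots> \<le> 1/2 * M" using M by (intro mult_right_mono \<tau>) auto
    finally show ?thesis using M by linarith
  qed
  have dF: "(\<Sum>k\<in>F. norm (freq k) * norm (duhamel (NLc p G) 0 t k)) \<le> M" if G: "norm G \<le> 2 * M" and t: "t \<in> {0..\<tau>}" and F: "finite F" for G t F
  proof -
    have "(\<Sum>k\<in>F. norm (freq k) powr 1 * norm (duhamel (NLc p G) 0 t k)) \<le> 72 / (2 - 1) * B * (t - 0) powr ((2 - 1) / 4)"
      by (rule duhamel_const[OF src[OF G]]) (use t \<tau> B0 F in auto)
    also have "\<dots> \<le> 72 * B * \<tau> powr (1/4)" using t B0 by (auto intro!: mult_left_mono powr_mono2)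
    finally show ?thesis using small by simp
  qed
  have asum: "(\<lambda>k. norm (freq k) * norm (aG G t k)) summable_on UNIV" "(\<Sum>\<^sub>\<infinity>k. norm (freq k) * norm (aG G t k)) \<le> 2 * M"
    if G: "norm G \<le> 2 * M" and t: "t \<in> {0..\<tau>}" for G t
  proof -
    have "(\<Sum>k\<in>F. norm (freq k) * norm (aG G t k)) \<le> 2 * M" if F: "finite F" for F
    proof -
      have "norm (freq k) * norm (aG G t k) \<le> norm (freq k) * norm (f k) + norm (freq k) * norm (duhamel (NLc p G) 0 t k)" for k
      proof -
        have "norm (aG G t k) \<le> norm (exp (- t * lam k) * f k) + norm (duhamel (NLc p G) 0 t k)"
          unfolding aG_def by (rule norm_triangle_ineq4)
        also have "norm (exp (- t * lam k) * f k) \<le> 1 * norm (f k)"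
          unfolding norm_mult using t by (intro mult_right_mono) auto
        finally have "norm (freq k) * norm (aG G t k) \<le> norm (freq k) * (norm (f k) + norm (duhamel (NLc p G) 0 t k))"
          by (intro mult_left_mono) auto
        then show ?thesis by (simp only: distrib_left)
      qed
      then have "(\<Sum>k\<in>F. norm (freq k) * norm (aG G t k)) \<le> (\<Sum>k\<in>F. norm (freq k) * norm (f k)) + (\<Sum>k\<in>F. norm (freq k) * norm (duhamel (NLc p G) 0 t k))"
        unfolding sum.distrib[symmetric] by (rule sum_mono)
      also have "(\<Sum>k\<in>F. norm (freq k) * norm (f k)) \<le> (\<Sum>\<^sub>\<infinity>k. norm (freq k) * norm (f k))"
        by (rule finite_sum_le_infsum[OF f(1) F]) auto
      finally show ?thesis using f(2) dF[OF G t F] by linarith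
    qed
    from summable_on_boundI[OF this]
    show "(\<lambda>k. norm (freq k) * norm (aG G t k)) summable_on UNIV" "(\<Sum>\<^sub>\<infinity>k. norm (freq k) * norm (aG G t k)) \<le> 2 * M" by auto
  qed
  define \<Phi> where "\<Phi> G t = Bcontfun (gsyn (aG G (cl t)))" for G t
  have b1: "gsyn (aG G (cl t)) \<in> bcontfun" if "norm G \<le> 2 * M" for G t
    using gsyn_summable(2)[OF asum(1)[OF that cl]] continuous_on_gsyn[OF asum(1)[OF that cl]]
    by (auto simp: bcontfun_def bounded_iff)
  have ap: "apply_bcontfun (\<Phi> G t) = gsyn (aG G (cl t))" if "norm G \<le> 2 * M" for G t
    unfolding \<Phi>_def by (rule Bcontfun_inverse[OF b1[OF that]])
  have nb: "norm (\<Phi> G t) \<le> 2 * M" if G: "norm G \<le> 2 * M" for G t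
  proof (rule norm_bound)
    fix x show "norm (apply_bcontfun (\<Phi> G t) x) \<le> 2 * M"
      unfolding ap[OF G] using gsyn_summable(2)[OF asum(1)[OF G cl], of t x] asum(2)[OF G cl[of t]] by linarith
  qed
  have dist_le: "dist (\<Phi> G s) (\<Phi> H t) \<le> (\<Sum>\<^sub>\<infinity>k. norm (freq k) * norm (aG G (cl s) k - aG H (cl t) k))"
    if G: "norm G \<le> 2 * M" "norm H \<le> 2 * M" for G H s t
  proof (rule dist_bound)
    fix x
    have "(\<lambda>k. norm (freq k) * norm (aG G (cl s) k - aG H (cl t) k)) summable_on UNIV"
      by (rule summable_diff_weighted[OF asum(1)[OF G(1) cl] asum(1)[OF G(2) cl]]) simp
    from gsyn_summable(2)[OF this]
    show "dist (apply_bcontfun (\<Phi> G s) x) (apply_bcontfun (\<Phi> H t) x) \<le> (\<Sum>\<^sub>\<infinity>k. norm (freq k) * norm (aG G (cl s) k - aG H (cl t) k))"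
      unfolding ap[OF G(1)] ap[OF G(2)] dist_norm gsyn_diff[OF asum(1)[OF G(1) cl] asum(1)[OF G(2) cl]] .
  qed
  have b2: "\<Phi> G \<in> bcontfun" if G: "norm G \<le> 2 * M" for G
  proof -
    have "continuous_on UNIV (\<Phi> G)"
      unfolding continuous_on_def
    proof
      fix t :: real
      let ?h = "\<lambda>s. \<Sum>\<^sub>\<infinity>k. norm (freq k) * norm (aG G s k - aG G (cl t) k)"
      have "(?h \<longlongrightarrow> 0) (at (cl t) within {0..\<tau>})"
        by (rule mild_coeffs_continuous[OF f(1) src[OF G] B0 _ cl]) (use \<tau> in \<open>auto simp: aG_def\<close>)
      \<comment> \<open>Clamping may take the value \<open>cl t\<close> at other points too, so the
        limit has to include the point itself; there the sum is 0.\<close>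
      then have "(?h \<longlongrightarrow> ?h (cl t)) (at (cl t) within {0..\<tau>})" by simp
      then have h: "(?h \<longlongrightarrow> ?h (cl t)) (inf (nhds (cl t)) (principal {0..\<tau>}))"
        by (rule tendsto_at_within_iff_tendsto_nhds[where g="?h", THEN iffD1])
      have "(cl \<longlongrightarrow> cl t) (at t)" unfolding cl_def by (intro tendsto_intros)
      then have "filterlim cl (inf (nhds (cl t)) (principal {0..\<tau>})) (at t)"
        unfolding filterlim_inf filterlim_principal using cl by (intro conjI always_eventually allI) blast+
      from filterlim_compose[OF h this]
      have "((\<lambda>s. \<Sum>\<^sub>\<infinity>k. norm (freq k) * norm (aG G (cl s) k - aG G (cl t) k)) \<longlongrightarrow> 0) (at t)" by simp
      then have "((\<lambda>s. dist (\<Phi> G s) (\<Phi> G t)) \<longlongrightarrow> 0) (at t)"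
        by (rule tendsto_sandwich[OF _ _ tendsto_const, rotated -1]) (intro always_eventually allI dist_le[OF G G] zero_le_dist)+
      then show "(\<Phi> G \<longlongrightarrow> \<Phi> G t) (at t within UNIV)" using tendsto_dist_iff by blast
    qed
    then show ?thesis using nb[OF G] by (auto simp: bcontfun_def bounded_iff)
  qed
  define \<Psi> where "\<Psi> G = Bcontfun (\<Phi> G)" for G
  have ap2: "apply_bcontfun (\<Psi> G) = \<Phi> G" if "norm G \<le> 2 * M" for G
    unfolding \<Psi>_def by (rule Bcontfun_inverse[OF b2[OF that]])
  have "\<exists>!G\<in>cball 0 (2 * M). \<Psi> G = G"
  proof (rule Banach_fix[where c="1/2"])
    show "complete (cball 0 (2 * M) :: (real \<Rightarrow>\<^sub>C field2) set)" by (simp add: complete_eq_closed)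
    show "cball 0 (2 * M) \<noteq> ({} :: (real \<Rightarrow>\<^sub>C field2) set)" using M by simp
    show "\<Psi> ` cball 0 (2 * M) \<subseteq> cball 0 (2 * M)"
    proof
      fix H assume "H \<in> \<Psi> ` cball 0 (2 * M)"
      then obtain G where G: "norm G \<le> 2 * M" "H = \<Psi> G" by auto
      have "norm (\<Psi> G) \<le> 2 * M" by (rule norm_bound) (simp add: ap2[OF G(1)] nb[OF G(1)])
      then show "H \<in> cball 0 (2 * M)" using G by simp
    qed
    fix G H :: "real \<Rightarrow>\<^sub>C field2" assume "G \<in> cball 0 (2 * M)" "H \<in> cball 0 (2 * M)"
    then have G: "norm G \<le> 2 * M" "norm H \<le> 2 * M" by auto
    show "dist (\<Psi> G) (\<Psi> H) \<le> 1/2 * dist G H"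
    proof (rule dist_bound)
      fix t
      let ?t = "cl t" and ?B = "2 * (2 * (2 * M) powr (p - 2) * dist G H)"
      have t: "?t \<in> {0..\<tau>}" by (rule cl)
      have d: "aG G ?t k - aG H ?t k = - duhamel (\<lambda>s k. NLc p G s k - NLc p H s k) 0 ?t k" for k
      proof -
        have t1: "0 \<le> ?t" using t by auto
        show ?thesis
          unfolding aG_def duhamel_def
          by (simp only: right_diff_distrib integral_diff[OF duhamel_const_integrable(1)[OF src[OF G(1)] t1 B0] duhamel_const_integrable(1)[OF src[OF G(2)] t1 B0]]) simp
      qed
      have "(\<Sum>\<^sub>\<infinity>k. norm (freq k) * norm (aG G ?t k - aG H ?t k)) \<le> 72 * ?B * \<tau> powr (1/4)"
      proof (rule summable_on_boundI(2))
        fix F :: "(int^2) set" assume F: "finite F"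
        have "(\<Sum>k\<in>F. norm (freq k) * norm (aG G ?t k - aG H ?t k)) = (\<Sum>k\<in>F. norm (freq k) powr 1 * norm (duhamel (\<lambda>s k. NLc p G s k - NLc p H s k) 0 ?t k))"
          unfolding d norm_minus_cancel by simp
        also have "\<dots> \<le> 72 / (2 - 1) * ?B * (?t - 0) powr ((2 - 1) / 4)"
          by (rule duhamel_const[OF NLc_diff_source[OF p G]]) (use t \<tau> F in auto)
        also have "\<dots> = 72 * ?B * ?t powr (1/4)" by simp
        also have "\<dots> \<le> 72 * ?B * \<tau> powr (1/4)" using t by (intro mult_left_mono powr_mono2) auto
        finally show "(\<Sum>k\<in>F. norm (freq k) * norm (aG G ?t k - aG H ?t k)) \<le> 72 * ?B * \<tau> powr (1/4)" .
      qed simp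
      also have "\<dots> = (288 * (2 * M) powr (p - 2) * \<tau> powr (1/4)) * dist G H" by simp
      also have "\<dots> \<le> 1/2 * dist G H" by (intro mult_right_mono \<tau>) auto
      finally show "dist (apply_bcontfun (\<Psi> G) t) (apply_bcontfun (\<Psi> H) t) \<le> 1/2 * dist G H"
        unfolding ap2[OF G(1)] ap2[OF G(2)] using dist_le[OF G, of t t] by linarith
    qed
  qed auto
  then obtain G where G: "norm G \<le> 2 * M" "\<Psi> G = G" by auto
  \<comment> \<open>At the fixed point \<open>G\<close> is the gradient of the synthesised function,
    so its source is the true nonlinearity.\<close>
  have GG: "apply_bcontfun (apply_bcontfun G t) = gsyn (aG G t)" if "t \<in> {0..\<tau>}" for t
    using ap[OF G(1), of t] ap2[OF G(1)] G(2) cl_id[OF that] by simp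
  show thesis
  proof (rule that[of "aG G" "NLc p G"])
    show "hermitian_coeffs (aG G t)" for t
    proof -
      have "hermitian_coeffs (duhamel (NLc p G) 0 t)"
        by (rule duhamel_hermitian) (simp add: NLc_def[abs_def] hermitian_div_coef)
      then show ?thesis using f(3) by (simp add: aG_def hermitian_coeffs_def)
    qed
    show "NLc p G t k = div_coef (nonlin p (syn (aG G t))) k" if t: "t \<in> {0..\<tau>}" for t k
      unfolding NLc_def GG[OF t] nonlin_eq grad_syn[OF weighted_summableI[OF asum(1)[OF G(1) t]]] ..
    show "aG G t k = exp (- t * lam k) * f k - duhamel (NLc p G) 0 t k" for t k by (rule aG_def)
  qed (use asum[OF G(1)] src[OF G(1)] B0 in auto)
qed

section \<open>Restarting a mild solution\<close>

text \<open>A function measurable in s and continuous in x is jointly measurable, as the limit of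
  its values at grid points floor(n x)/n, of which only countably many occur; Fubini then makes the
  integral measurable in s.\<close>

lemma measurable_unit_square_integral:
  fixes F :: "real \<Rightarrow> real^2 \<Rightarrow> complex"
  assumes m: "\<And>x. (\<lambda>s. F s x) \<in> borel_measurable lebesgue" and c: "\<And>s. continuous_on UNIV (F s)"
  shows "(\<lambda>s. integral (cbox 0 1) (F s)) \<in> borel_measurable lebesgue"
proof -
  define g where "g m x = (vector [real_of_int \<lfloor>real (Suc m) * x $ 1\<rfloor> / real (Suc m), real_of_int \<lfloor>real (Suc m) * x $ 2\<rfloor> / real (Suc m)] :: real^2)" for m and x :: "real^2"
  have gx: "(\<lambda>m. g m x) \<longlonglongrightarrow> x" for x
  proof -
    have fl: "(\<lambda>m. real_of_int \<lfloor>real (Suc m) * y\<rfloor> / real (Suc m)) \<longlonglongrightarrow> y" for y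
    proof -
      have "(\<lambda>m. real_of_int \<lfloor>real (Suc m) * y\<rfloor> / real (Suc m) - y) \<longlonglongrightarrow> 0"
      proof (rule Lim_null_comparison[OF always_eventually LIMSEQ_inverse_real_of_nat], rule allI)
        fix m
        have e: "real_of_int \<lfloor>real (Suc m) * y\<rfloor> / real (Suc m) - y = (real_of_int \<lfloor>real (Suc m) * y\<rfloor> - real (Suc m) * y) / real (Suc m)"
          by (simp add: field_simps)
        have "\<bar>real_of_int \<lfloor>real (Suc m) * y\<rfloor> - real (Suc m) * y\<bar> \<le> 1" by linarith
        then show "norm (real_of_int \<lfloor>real (Suc m) * y\<rfloor> / real (Suc m) - y) \<le> inverse (real (Suc m))"
          unfolding e real_norm_def abs_divide inverse_eq_divide by (simp add: divide_right_mono del: of_nat_Suc)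
      qed
      then show ?thesis by (rule LIM_zero_cancel)
    qed
    have "(\<lambda>m. \<chi> i. g m x $ i) \<longlonglongrightarrow> (\<chi> i. x $ i)"
    proof (rule vec_tendstoI)
      fix i :: 2
      have "i = 1 \<or> i = 2" by (rule exhaust_2)
      then show "(\<lambda>m. (\<chi> i. g m x $ i) $ i) \<longlonglongrightarrow> (\<chi> i. x $ i) $ i" using fl by (auto simp: g_def)
    qed
    then show ?thesis by simp
  qed
  have step: "(\<lambda>(s, x). F s (g m x)) \<in> borel_measurable (lebesgue \<Otimes>\<^sub>M lborel)" for m
  proof -
    have m1: "(\<lambda>z. F (fst z) (vector [real_of_int i / real (Suc m), real_of_int j / real (Suc m)])) \<in> borel_measurable (lebesgue \<Otimes>\<^sub>M (lborel :: (real^2) measure))" for i j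
      by (rule measurable_compose[OF measurable_fst m])
    have fm: "(\<lambda>z. \<lfloor>real (Suc m) * snd z $ i\<rfloor>) \<in> measurable (lebesgue \<Otimes>\<^sub>M (lborel :: (real^2) measure)) (count_space UNIV)" for i
    proof -
      have "(\<lambda>x :: real^2. real (Suc m) * x $ i) \<in> borel_measurable lborel"
        unfolding measurable_lborel2 by (intro borel_measurable_continuous_onI continuous_intros)
      then have "(\<lambda>z. real (Suc m) * snd z $ i) \<in> borel_measurable (lebesgue \<Otimes>\<^sub>M (lborel :: (real^2) measure))"
        by (rule measurable_compose[OF measurable_snd])
      then show ?thesis by (rule measurable_compose[OF _ measurable_real_floor])
    qed
    have m2: "(\<lambda>z. F (fst z) (vector [real_of_int i / real (Suc m), real_of_int \<lfloor>real (Suc m) * snd z $ 2\<rfloor> / real (Suc m)])) \<in> borel_measurable (lebesgue \<Otimes>\<^sub>M (lborel :: (real^2) measure))" for i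
      by (rule measurable_compose_countable[where f="\<lambda>j z. F (fst z) (vector [real_of_int i / real (Suc m), real_of_int j / real (Suc m)])", OF m1 fm])
    have "(\<lambda>z. F (fst z) (vector [real_of_int \<lfloor>real (Suc m) * snd z $ 1\<rfloor> / real (Suc m), real_of_int \<lfloor>real (Suc m) * snd z $ 2\<rfloor> / real (Suc m)])) \<in> borel_measurable (lebesgue \<Otimes>\<^sub>M (lborel :: (real^2) measure))"
      by (rule measurable_compose_countable[where f="\<lambda>i z. F (fst z) (vector [real_of_int i / real (Suc m), real_of_int \<lfloor>real (Suc m) * snd z $ 2\<rfloor> / real (Suc m)])", OF m2 fm])
    then show ?thesis by (simp add: g_def split_def)
  qed
  have joint: "(\<lambda>(s, x). F s x) \<in> borel_measurable (lebesgue \<Otimes>\<^sub>M lborel)"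
  proof (rule borel_measurable_LIMSEQ_metric[OF step])
    fix z :: "real \<times> (real^2)"
    have "(\<lambda>m. F (fst z) (g m (snd z))) \<longlonglongrightarrow> F (fst z) (snd z)"
      by (rule continuous_on_tendsto_compose[OF c gx]) auto
    then show "(\<lambda>m. case z of (s, x) \<Rightarrow> F s (g m x)) \<longlonglongrightarrow> (case z of (s, x) \<Rightarrow> F s x)" by (simp add: split_def)
  qed
  have "(\<lambda>(s, x). indicat_real (cbox 0 1) x *\<^sub>R F s x) \<in> borel_measurable (lebesgue \<Otimes>\<^sub>M lborel)"
    using joint unfolding split_def by measurable
  then have "(\<lambda>s. \<integral>x. indicat_real (cbox 0 1) x *\<^sub>R F s x \<partial>lborel) \<in> borel_measurable lebesgue"
    by (rule lborel.borel_measurable_lebesgue_integral)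
  moreover have "(\<integral>x. indicat_real (cbox 0 1) x *\<^sub>R F s x \<partial>lborel) = integral (cbox 0 1) (F s)" for s
  proof -
    have "set_integrable lborel (cbox 0 1) (F s)"
      unfolding set_integrable_def by (rule borel_integrable_compact) (auto intro: continuous_on_subset[OF c])
    from set_borel_integral_eq_integral(2)[OF this] show ?thesis by (simp add: set_lebesgue_integral_def)
  qed
  ultimately show ?thesis by simp
qed

lemma locally_bounded_compact_interval:
  fixes N :: "real \<Rightarrow> real"
  assumes "\<epsilon> \<le> T" and loc: "\<And>t. t \<in> {\<epsilon>..T} \<Longrightarrow> \<exists>B d. 0 < d \<and> (\<forall>s\<in>{\<epsilon>..T}. \<bar>s - t\<bar> < d \<longrightarrow> N s \<le> B)"
  shows "\<exists>B. \<forall>s\<in>{\<epsilon>..T}. N s \<le> B"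
proof -
  have "\<exists>B. \<forall>s\<in>{\<epsilon>..T}. s \<in> {\<epsilon>..T} \<longrightarrow> N s \<le> B"
  proof (rule Bolzano[where P="\<lambda>a b. \<exists>B. \<forall>s\<in>{a..b}. s \<in> {\<epsilon>..T} \<longrightarrow> N s \<le> B", OF assms(1)])
    fix a b c :: real
    assume "\<exists>B. \<forall>s\<in>{a..b}. s \<in> {\<epsilon>..T} \<longrightarrow> N s \<le> B" "\<exists>B. \<forall>s\<in>{b..c}. s \<in> {\<epsilon>..T} \<longrightarrow> N s \<le> B"
    then obtain B1 B2 where "\<forall>s\<in>{a..b}. s \<in> {\<epsilon>..T} \<longrightarrow> N s \<le> B1" "\<forall>s\<in>{b..c}. s \<in> {\<epsilon>..T} \<longrightarrow> N s \<le> B2" by blast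
    then have "\<forall>s\<in>{a..c}. s \<in> {\<epsilon>..T} \<longrightarrow> N s \<le> max B1 B2"
      by (intro ballI impI) (rename_tac s, case_tac "s \<le> b", auto simp: le_max_iff_disj)
    then show "\<exists>B. \<forall>s\<in>{a..c}. s \<in> {\<epsilon>..T} \<longrightarrow> N s \<le> B" by blast
  next
    fix t assume "\<epsilon> \<le> t" "t \<le> T"
    then obtain B d where "0 < d" "\<forall>s\<in>{\<epsilon>..T}. \<bar>s - t\<bar> < d \<longrightarrow> N s \<le> B" using loc[of t] by auto
    then show "\<exists>d>0. \<forall>a b. a \<le> t \<and> t \<le> b \<and> b - a < d \<longrightarrow> (\<exists>B. \<forall>s\<in>{a..b}. s \<in> {\<epsilon>..T} \<longrightarrow> N s \<le> B)"
      by (intro exI[of _ d] conjI allI impI exI[of _ B]) auto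
  qed
  then show ?thesis by blast
qed

text \<open>\<open>Tm\<close> is any time below which the solution exists; that no mild solution
  lasts beyond it becomes an assumption in \<open>L2_lower_bound\<close>.\<close>

locale mild_flow =
  fixes p :: real and u0 :: "real^2 \<Rightarrow> real" and u :: "real \<Rightarrow> real^2 \<Rightarrow> real" and Tm :: real
  assumes p2: "2 < p" and p3: "p < 3" and u0: "W1inf u0"
    and mild: "\<And>T. 0 < T \<Longrightarrow> T < Tm \<Longrightarrow> mild_solution p u0 u T"
begin

definition nl_coef :: "real \<Rightarrow> int^2 \<Rightarrow> complex" where "nl_coef s k = div_coef (nonlin p (u s)) k"

lemma div_semigroup_flow: "div_semigroup (t - s) (nonlin p (u s)) x = syn (\<lambda>k. exp (- (t - s) * lam k) * nl_coef s k) x"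
  by (simp add: div_semigroup_eq_syn nl_coef_def[abs_def])

lemma u_W1inf: "0 < t \<Longrightarrow> t < Tm \<Longrightarrow> W1inf (u t)"
  using mild[of t] unfolding mild_solution_def by auto

lemma u_continuous:
  assumes "0 < t" "t < Tm" shows "((\<lambda>s. W1inf_norm (\<lambda>x. u s x - u t x)) \<longlongrightarrow> 0) (at t)"
proof -
  let ?T = "(t + Tm) / 2"
  have T: "0 < ?T" "?T < Tm" "t < ?T" using assms by auto
  have "((\<lambda>s. W1inf_norm (\<lambda>x. u s x - u t x)) \<longlongrightarrow> 0) (at t within {0<..?T})"
    using mild[OF T(1,2)] assms T(3) unfolding mild_solution_def by auto
  moreover have "at t within {0<..?T} = at t"
    by (rule at_within_nhd[of t "{0<..<?T}" _ UNIV]) (use assms T(3) in auto)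
  ultimately show ?thesis by simp
qed

lemma u_formula:
  assumes "0 < t" "t < Tm"
  shows "(\<lambda>s. syn (\<lambda>k. exp (- (t - s) * lam k) * nl_coef s k) x) integrable_on {0..t}"
    and "u t x = semigroup t u0 x - integral {0..t} (\<lambda>s. syn (\<lambda>k. exp (- (t - s) * lam k) * nl_coef s k) x)"
  using mild[OF assms] assms unfolding mild_solution_def div_semigroup_flow by auto

text \<open>Continuity into W^{1,infinity} yields bounds on compact subintervals of (0, Tm) only.
  Nothing is known as s tends to 0, which is the difficulty of this section.\<close>

lemma u_bounded:
  assumes "0 < \<epsilon>" "\<epsilon> \<le> T" "T < Tm"
  obtains L where "0 \<le> L" "\<And>s x. s \<in> {\<epsilon>..T} \<Longrightarrow> norm (grad (u s) x) \<le> L"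
proof -
  have "\<exists>B. \<forall>s\<in>{\<epsilon>..T}. W1inf_norm (u s) \<le> B"
  proof (rule locally_bounded_compact_interval[OF assms(2)])
    fix t assume t: "t \<in> {\<epsilon>..T}"
    then have t': "0 < t" "t < Tm" using assms by auto
    from tendstoD[OF u_continuous[OF t'], of 1]
    have "\<forall>\<^sub>F s in at t. dist (W1inf_norm (\<lambda>x. u s x - u t x)) 0 < 1" by simp
    then obtain d where d: "0 < d" "\<And>s. s \<noteq> t \<Longrightarrow> dist s t < d \<Longrightarrow> dist (W1inf_norm (\<lambda>x. u s x - u t x)) 0 < 1"
      unfolding eventually_at by auto
    show "\<exists>B d. 0 < d \<and> (\<forall>s\<in>{\<epsilon>..T}. \<bar>s - t\<bar> < d \<longrightarrow> W1inf_norm (u s) \<le> B)"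
    proof (rule exI[of _ "2 + 2 * W1inf_norm (u t)"], rule exI[of _ d], intro conjI ballI impI d(1))
      fix s assume s: "s \<in> {\<epsilon>..T}" "\<bar>s - t\<bar> < d"
      show "W1inf_norm (u s) \<le> 2 + 2 * W1inf_norm (u t)"
      proof (cases "s = t")
        case True
        then show ?thesis using W1inf_norm_bounds(3)[OF u_W1inf[OF t']] by simp
      next
        case False
        have "W1inf_norm (u s) \<le> 2 * W1inf_norm (\<lambda>x. u s x - u t x) + 2 * W1inf_norm (u t)"
          by (rule W1inf_norm_triangle) (use s assms u_W1inf t' in auto)
        moreover have "W1inf_norm (\<lambda>x. u s x - u t x) < 1" using d(2)[OF False] s(2) by (simp add: dist_real_def)
        ultimately show ?thesis by linarith
      qed
    qed
  qed
  then obtain B where B: "\<And>s. s \<in> {\<epsilon>..T} \<Longrightarrow> W1inf_norm (u s) \<le> B" by blast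
  have "norm (grad (u s) x) \<le> 2 * max B 0" if s: "s \<in> {\<epsilon>..T}" for s x
  proof -
    have W: "W1inf (u s)" using u_W1inf s assms by auto
    have "norm (grad (u s) x) \<le> 2 * W1inf_norm (u s)"
      by (rule norm_grad_le[OF W1inf_norm_bounds(2,3)[OF W]])
    then show ?thesis using B[OF s] by simp
  qed
  then show thesis by (intro that[of "2 * max B 0"]) auto
qed

text \<open>Measurability of the coefficients in time is not part of the definition of a mild
  solution. It is recovered from the pointwise Duhamel integrals: for each x the heat flow of the
  source is measurable in s, it is continuous in x, and its Fourier coefficients are integrals over
  the square.\<close>

lemma nl_coef_measurable:
  assumes "0 < t" "t < Tm" shows "(\<lambda>s. nl_coef s k) \<in> borel_measurable (lebesgue_on {0<..<t})"
proof -
  let ?e = "\<lambda>s k. exp (- (t - s) * lam k) * nl_coef s k"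
  define F where "F s x = (if s \<in> {0<..<t} then complex_of_real (syn (?e s) x) * cis (- (freq k \<bullet> x)) else 0)" for s x
  have sm: "(\<lambda>k. norm (?e s k)) summable_on UNIV" if s: "s \<in> {0<..<t}" for s
  proof -
    have "0 < s" "s \<le> s" "s < Tm" using s assms by auto
    from u_bounded[OF this] obtain L where L': "\<And>s' x. s' \<in> {s..s} \<Longrightarrow> norm (grad (u s') x) \<le> L" by blast
    have L: "norm (grad (u s) x) \<le> L" for x using L' by simp
    have b: "norm (nl_coef s k) \<le> norm (freq k) * (2 * L powr (p - 1))" for k
      unfolding nl_coef_def by (rule norm_div_coef_bounded) (simp add: nonlin_eq norm_NL_le[OF p2 L])
    have sp: "(\<lambda>k. (2 * L powr (p - 1)) * (norm (freq k) powr 1 * exp (- (t - s) * lam k))) summable_on UNIV"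
      by (intro summable_on_cmult_right summable_freq_exp_lam) (use s in auto)
    show ?thesis
    proof (rule summable_on_real_comparison[OF sp])
      fix k
      have "norm (?e s k) = exp (- (t - s) * lam k) * norm (nl_coef s k)" by (simp add: norm_mult)
      also have "\<dots> \<le> exp (- (t - s) * lam k) * (norm (freq k) * (2 * L powr (p - 1)))" by (intro mult_left_mono b) auto
      finally show "norm (?e s k) \<le> (2 * L powr (p - 1)) * (norm (freq k) powr 1 * exp (- (t - s) * lam k))" by (simp add: mult_ac)
    qed auto
  qed
  have herm: "hermitian_coeffs (?e s)" for s
    using hermitian_exp[OF hermitian_div_coef, of "- (t - s)" "nonlin p (u s)"] by (simp only: nl_coef_def)
  have "(\<lambda>s. integral (cbox 0 1) (F s)) \<in> borel_measurable lebesgue"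
  proof (rule measurable_unit_square_integral)
    fix s show "continuous_on UNIV (F s)"
    proof (cases "s \<in> {0<..<t}")
      case True
      have e: "F s = (\<lambda>x. csyn (?e s) x * cis (- (freq k \<bullet> x)))"
        unfolding F_def csyn_eq_of_real_syn[OF herm] using True by simp
      show ?thesis unfolding e by (intro continuous_intros continuous_on_csyn sm[OF True])
    next
      case False
      then have "F s = (\<lambda>x. 0)" by (auto simp: F_def)
      then show ?thesis by simp
    qed
  next
    fix x
    have "(\<lambda>s. syn (?e s) x) \<in> borel_measurable (lebesgue_on {0..t})"
      by (rule integrable_imp_measurable[OF u_formula(1)[OF assms]])
    then have "(\<lambda>s. syn (?e s) x) \<in> borel_measurable (lebesgue_on {0<..<t})"
      by (rule measurable_restrict_mono) auto
    then have "(\<lambda>s. complex_of_real (syn (?e s) x) * cis (- (freq k \<bullet> x))) \<in> borel_measurable (lebesgue_on {0<..<t})"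
      by simp
    then show "(\<lambda>s. F s x) \<in> borel_measurable lebesgue"
      unfolding F_def by (rule borel_measurable_if_I) auto
  qed
  then have m1: "(\<lambda>s. integral (cbox 0 1) (F s)) \<in> borel_measurable (lebesgue_on {0<..<t})"
    by (rule measurable_restrict_space1)
  \<comment> \<open>The growing exponential that undoes the damping of the k-th mode.\<close>
  have m2: "(\<lambda>s. complex_of_real (exp ((t - s) * lam k))) \<in> borel_measurable (lebesgue_on {0<..<t})"
    by (intro continuous_imp_measurable_on_sets_lebesgue continuous_intros) auto
  have "(\<lambda>s. complex_of_real (exp ((t - s) * lam k)) * integral (cbox 0 1) (F s)) \<in> borel_measurable (lebesgue_on {0<..<t})"
    by (rule borel_measurable_times[OF m2 m1])
  moreover have "complex_of_real (exp ((t - s) * lam k)) * integral (cbox 0 1) (F s) = nl_coef s k" if s: "s \<in> {0<..<t}" for s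
  proof -
    have "integral (cbox 0 1) (F s) = integral (cbox 0 1) (\<lambda>x. csyn (?e s) x * cis (- (freq k \<bullet> x)))"
      unfolding F_def csyn_eq_of_real_syn[OF herm] using s by simp
    also have "\<dots> = ?e s k" by (rule csyn_has_coeff[OF sm[OF s]])
    finally have "integral (cbox 0 1) (F s) = ?e s k" .
    then show ?thesis by (simp add: mult.assoc[symmetric] flip: of_real_mult exp_add) (simp add: algebra_simps)
  qed
  ultimately show ?thesis by (subst measurable_cong[where g="\<lambda>s. complex_of_real (exp ((t - s) * lam k)) * integral (cbox 0 1) (F s)"]) auto
qed

lemma nl_coef_source:
  assumes "0 < \<epsilon>" "\<epsilon> \<le> t" "t < Tm"
  obtains B where "0 \<le> B" "source nl_coef (\<lambda>s. vcoef (nonlin p (u s))) (\<lambda>_. B) \<epsilon> t"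
proof -
  obtain L where L: "0 \<le> L" "\<And>s x. s \<in> {\<epsilon>..t} \<Longrightarrow> norm (grad (u s) x) \<le> L" using u_bounded[OF assms] by blast
  have t0: "0 < t" using assms by linarith
  have "source nl_coef (\<lambda>s. vcoef (nonlin p (u s))) (\<lambda>_. 2 * L powr (p - 1)) \<epsilon> t"
    unfolding source_def
  proof (intro conjI allI impI)
    fix k s and F :: "(int^2) set"
    show "(\<lambda>s. nl_coef s k) \<in> borel_measurable (lebesgue_on {\<epsilon><..<t})"
      by (rule measurable_restrict_mono[OF nl_coef_measurable[OF t0 assms(3)]]) (use assms in auto)
    show "norm (nl_coef s k) \<le> norm (freq k) * vcoef (nonlin p (u s)) k" unfolding nl_coef_def by (rule norm_div_coef_le)
    assume s: "\<epsilon> < s" "s < t"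
    show "(\<Sum>k\<in>F. (vcoef (nonlin p (u s)) k)^2) \<le> (2 * L powr (p - 1))^2" if "finite F"
    proof -
      have "(\<Sum>k\<in>F. (vcoef (nonlin p (u s)) k)^2) \<le> 2 * (L powr (p - 1))^2"
        unfolding nonlin_eq by (rule sum_vcoef_bounded[OF norm_NL_le[OF p2 L(2)] that]) (use s in auto)
      also have "\<dots> \<le> (2 * L powr (p - 1))^2" unfolding power_mult_distrib by (intro mult_right_mono) auto
      finally show ?thesis .
    qed
  qed auto
  then show thesis by (intro that[of "2 * L powr (p - 1)"]) auto
qed

end

text \<open>The sets where all \<open>W i\<close> are bounded by m are closed and cover the closed
  set of pairs (t, x), so one of them contains a neighbourhood. The index set, later the truncation
  times, is arbitrary and carries no topology.\<close>

lemma Baire_locally_bounded: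
  fixes W :: "'i \<Rightarrow> real \<Rightarrow> real^2 \<Rightarrow> real"
  assumes ab: "a < b"
    and c: "\<And>i. i \<in> I \<Longrightarrow> continuous_on ({a..b} \<times> UNIV) (\<lambda>z. W i (fst z) (snd z))"
    and pw: "\<And>t x. t \<in> {a..b} \<Longrightarrow> \<exists>B. \<forall>i\<in>I. \<bar>W i t x\<bar> \<le> B"
  obtains M a' b' \<alpha> \<beta> \<rho> where "0 \<le> M" "a \<le> a'" "a' < b'" "b' \<le> b" "0 < \<rho>" "\<rho> \<le> 1/16"
    "\<And>i t x y. \<lbrakk>i \<in> I; a' \<le> t; t \<le> b'; \<alpha> \<le> x; x \<le> \<alpha> + \<rho>; \<beta> \<le> y; y \<le> \<beta> + \<rho>\<rbrakk> \<Longrightarrow> \<bar>W i t (vector [x, y])\<bar> \<le> M"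
proof -
  let ?S = "{a..b} \<times> (UNIV :: (real^2) set)"
  define A where "A m = ?S \<inter> (\<Inter>i\<in>I. ?S \<inter> (\<lambda>z. W i (fst z) (snd z)) -` {- real m..real m})" for m :: nat
  have S: "closed ?S" by (intro closed_Times) auto
  have Acl: "closed (A m)" for m
    unfolding A_def by (intro closed_Int S closed_INT ballI continuous_closed_preimage c) auto
  have cover: "\<exists>m. z \<in> A m" if z: "z \<in> ?S" for z
  proof -
    obtain B where B: "\<forall>i\<in>I. \<bar>W i (fst z) (snd z)\<bar> \<le> B" using pw[of "fst z" "snd z"] z by auto
    obtain m :: nat where "B \<le> real m" using real_arch_simple by blast
    then have "\<bar>W i (fst z) (snd z)\<bar> \<le> real m" if "i \<in> I" for i using B that by (meson order_trans)
    then have "z \<in> A m" using z unfolding A_def by (auto simp: abs_le_iff minus_le_iff)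
    then show ?thesis by blast
  qed
  have "\<exists>m. \<not> ?S \<subseteq> closure (?S - A m)"
  proof (rule ccontr)
    assume "\<not> ?thesis"
    then have d: "?S \<subseteq> closure (?S - A m)" for m by blast
    have "?S \<subseteq> closure (\<Inter> (range (\<lambda>m. ?S - A m)))"
    proof (rule Baire[OF S])
      fix T assume "T \<in> range (\<lambda>m. ?S - A m)"
      then obtain m where T: "T = ?S - A m" by blast
      have "openin (top_of_set ?S) (?S \<inter> - A m)" by (rule openin_open_Int) (use Acl in auto)
      then show "openin (top_of_set ?S) T \<and> ?S \<subseteq> closure T" using d[of m] unfolding T Diff_eq by blast
    qed auto
    moreover have "\<Inter> (range (\<lambda>m. ?S - A m)) = {}" using cover by blast
    ultimately have "?S \<subseteq> {}" by (simp only: closure_empty)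
    then show False using ab by auto
  qed
  then obtain m z where z: "z \<in> ?S" "z \<notin> closure (?S - A m)" by blast
  then obtain e where e: "0 < e" "\<forall>w\<in>?S - A m. \<not> dist w z < e"
    unfolding closure_approachable by blast
  obtain t0 x0 where z0: "z = (t0, x0)" by force
  have t0: "a \<le> t0" "t0 \<le> b" using z z0 by auto
  \<comment> \<open>Points of the box are within 3 rho < e of (t0, x0); 1/16 is the size demanded by
    the observability estimate, and b - a leaves room for a time interval inside [a, b].\<close>
  define \<rho> where "\<rho> = min (1/16) (min (e/4) (b - a))"
  have \<rho>: "0 < \<rho>" "\<rho> \<le> 1/16" "\<rho> \<le> e/4" "\<rho> \<le> b - a" using e(1) ab unfolding \<rho>_def by (simp, simp only: min.cobounded1, linarith+)
  define a' where "a' = max a (t0 - \<rho>)"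
  have a': "a \<le> a'" "a' + \<rho> \<le> b \<or> a' < t0" "a' \<le> t0" "t0 - \<rho> \<le> a'" using t0 \<rho> by (auto simp: a'_def)
  define b' where "b' = min b (a' + \<rho>)"
  have b': "a' < b'" "b' \<le> b" "b' \<le> t0 + \<rho>" using a' \<rho> t0 ab by (auto simp: b'_def a'_def)
  show thesis
  proof (rule that[of "real m" a' b' \<rho> "x0 $ 1" "x0 $ 2"])
    fix i t x y
    assume i: "i \<in> I" and t: "a' \<le> t" "t \<le> b'" and x: "x0 $ 1 \<le> x" "x \<le> x0 $ 1 + \<rho>" and y: "x0 $ 2 \<le> y" "y \<le> x0 $ 2 + \<rho>"
    have "dist (t0, x0) (t, vector [x, y]) \<le> dist t0 t + dist x0 (vector [x, y])"
      unfolding dist_Pair_Pair by (rule sqrt_sum_squares_le_sum) auto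
    also have "dist t0 t \<le> \<rho>" using t a' b' by (auto simp: dist_real_def)
    also have "dist x0 (vector [x, y]) \<le> (\<Sum>i\<in>UNIV. \<bar>(x0 - vector [x, y]) $ i\<bar>)"
      unfolding dist_norm by (rule norm_le_l1_cart)
    also have "\<dots> \<le> 2 * \<rho>" using x y by (simp add: sum_2)
    finally have "dist (t0, x0) (t, vector [x, y]) < e" using \<rho> e by linarith
    moreover have "(t, vector [x, y]) \<in> ?S" using t a' b' by auto
    ultimately have "(t, vector [x, y]) \<in> A m" using e(2) z0 dist_commute by (metis DiffI)
    then have "(t, vector [x, y]) \<in> (\<lambda>z. W i (fst z) (snd z)) -` {- real m..real m}" using i unfolding A_def by blast
    then show "\<bar>W i t (vector [x, y])\<bar> \<le> real m" by (auto simp: abs_le_iff)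
  qed (use a' b' \<rho> in auto)
qed

text \<open>An indefinite gauge integral is continuous up to the endpoint even without absolute
  integrability; at time 0 this is all the information available.\<close>

lemma integral_tendsto_at_right:
  fixes f :: "real \<Rightarrow> 'a::banach"
  assumes "f integrable_on {a..b}" "a < b"
  shows "((\<lambda>\<epsilon>. integral {\<epsilon>..b} f) \<longlongrightarrow> integral {a..b} f) (at_right a)"
proof -
  have "((\<lambda>\<epsilon>. integral {\<epsilon>..b} f) \<longlongrightarrow> integral {a..b} f) (at a within {a..b})"
    using indefinite_integral_continuous_1'[OF assms(1)] assms(2) unfolding continuous_on_def by auto
  then show ?thesis using assms(2) by (simp add: at_within_Icc_at_right)
qed

context mild_flow
begin

lemma nl_coef_hermitian: "hermitian_coeffs (nl_coef s)"
  using hermitian_div_coef by (simp add: nl_coef_def[abs_def])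

lemma duhamel_flow_hermitian: "hermitian_coeffs (duhamel nl_coef r t)"
  by (rule duhamel_hermitian[OF nl_coef_hermitian])

lemma duhamel_flow_facts:
  assumes "0 < r" "r \<le> t" "t < Tm"
  shows "\<And>k. (\<lambda>s. exp (- (t - s) * lam k) * nl_coef s k) integrable_on {r..t}"
    and "(\<lambda>s. syn (\<lambda>k. exp (- (t - s) * lam k) * nl_coef s k) x) integrable_on {r..t}"
    and "integral {r..t} (\<lambda>s. syn (\<lambda>k. exp (- (t - s) * lam k) * nl_coef s k) x) = syn (duhamel nl_coef r t) x"
    and "(\<lambda>k. norm (duhamel nl_coef r t k)) summable_on UNIV"
    and "(\<lambda>k. norm (freq k) * norm (duhamel nl_coef r t k)) summable_on UNIV"
proof -
  obtain B where "0 \<le> B" "source nl_coef (\<lambda>s. vcoef (nonlin p (u s))) (\<lambda>_. B) r t" using nl_coef_source[OF assms] by blast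
  note d = duhamel_const_integrable[OF this(2) assms(2) this(1)]
  show "\<And>k. (\<lambda>s. exp (- (t - s) * lam k) * nl_coef s k) integrable_on {r..t}" by (rule d)
  show "(\<lambda>s. syn (\<lambda>k. exp (- (t - s) * lam k) * nl_coef s k) x) integrable_on {r..t}" by (rule d)
  show "integral {r..t} (\<lambda>s. syn (\<lambda>k. exp (- (t - s) * lam k) * nl_coef s k) x) = syn (duhamel nl_coef r t) x" by (rule d)
  show "(\<lambda>k. norm (duhamel nl_coef r t k)) summable_on UNIV" by (rule d)
  show "(\<lambda>k. norm (freq k) * norm (duhamel nl_coef r t k)) summable_on UNIV" by (rule d)
qed

lemma duhamel_flow_split:
  assumes "0 < r" "r \<le> t'" "t' \<le> t" "t < Tm"
  shows "duhamel nl_coef r t k = exp (- (t - t') * lam k) * duhamel nl_coef r t' k + duhamel nl_coef t' t k"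
  by (rule duhamel_split[OF duhamel_flow_facts(1)]) (use assms in auto)

lemma exp_duhamel_summable:
  assumes "0 < \<epsilon>" "\<epsilon> \<le> t1" "t1 < Tm" "0 \<le> \<sigma>"
  shows "(\<lambda>k. norm (exp (- \<sigma> * lam k) * duhamel nl_coef \<epsilon> t1 k)) summable_on UNIV"
proof (rule summable_on_real_comparison[OF duhamel_flow_facts(4)[OF assms(1-3)]])
  fix k
  have "exp (- \<sigma> * lam k) \<le> 1" using assms by simp
  from mult_right_mono[OF this, of "norm (duhamel nl_coef \<epsilon> t1 k)"]
  show "norm (exp (- \<sigma> * lam k) * duhamel nl_coef \<epsilon> t1 k) \<le> norm (duhamel nl_coef \<epsilon> t1 k)" by (simp add: norm_mult)
qed simp

text \<open>For a target time t beyond t1, the integral over [eps, t1] is the free evolution for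
  time t - t1 of the coefficients \<open>duhamel nl_coef \<epsilon> t1\<close>. Pointwise integrals
  at all later times thus become values of one free solution.\<close>

lemma integral_eps:
  assumes "0 < \<epsilon>" "\<epsilon> \<le> t1" "t1 \<le> t" "t < Tm"
  shows "integral {\<epsilon>..t1} (\<lambda>s. syn (\<lambda>k. exp (- (t - s) * lam k) * nl_coef s k) x) = syn (\<lambda>k. exp (- (t - t1) * lam k) * duhamel nl_coef \<epsilon> t1 k) x"
proof -
  let ?D = "\<lambda>s. syn (\<lambda>k. exp (- (t - s) * lam k) * nl_coef s k) x"
  have 1: "0 < \<epsilon>" "\<epsilon> \<le> t" "t < Tm" "0 < t1" "t1 \<le> t" using assms by auto
  have "integral {\<epsilon>..t1} ?D + integral {t1..t} ?D = integral {\<epsilon>..t} ?D"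
    by (rule Henstock_Kurzweil_Integration.integral_combine[OF assms(2,3) duhamel_flow_facts(2)[OF 1(1-3)]])
  then have "integral {\<epsilon>..t1} ?D = syn (duhamel nl_coef \<epsilon> t) x - syn (duhamel nl_coef t1 t) x"
    using duhamel_flow_facts(3)[OF 1(1-3), of x] duhamel_flow_facts(3)[OF 1(4,5,3), of x] by simp
  also have "\<dots> = syn (\<lambda>k. duhamel nl_coef \<epsilon> t k - duhamel nl_coef t1 t k) x"
    by (rule syn_diff[OF duhamel_flow_facts(4)[OF 1(1-3)] duhamel_flow_facts(4)[OF 1(4,5,3)]])
  also have "(\<lambda>k. duhamel nl_coef \<epsilon> t k - duhamel nl_coef t1 t k) = (\<lambda>k. exp (- (t - t1) * lam k) * duhamel nl_coef \<epsilon> t1 k)"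
    using duhamel_flow_split[OF assms] by auto
  finally show ?thesis .
qed

text \<open>Uniformity in eps: at a fixed time and point the truncated integrals are bounded,
  because the indefinite integral is continuous on [0, t1]. Baire makes this uniform on a box, and
  observability carries it to every mode, up to the factor exp (- b0 lam k).\<close>

lemma duhamel_bound:
  assumes t1: "0 < t1" and b0: "0 < b0" "t1 + b0 < Tm"
  obtains C where "\<And>\<epsilon> k. 0 < \<epsilon> \<Longrightarrow> \<epsilon> \<le> t1 \<Longrightarrow> norm (duhamel nl_coef \<epsilon> t1 k) * exp (- b0 * lam k) \<le> C"
proof -
  have t1T: "t1 < Tm" using b0 by linarith
  \<comment> \<open>The contribution of [eps, t1] seen at time t1 + sigma.\<close>
  define W where "W \<epsilon> \<sigma> x = syn (\<lambda>k. exp (- \<sigma> * lam k) * duhamel nl_coef \<epsilon> t1 k) x" for \<epsilon> \<sigma> x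
  have sm: "(\<lambda>k. norm (duhamel nl_coef \<epsilon> t1 k)) summable_on UNIV" if "\<epsilon> \<in> {0<..t1}" for \<epsilon>
    by (rule duhamel_flow_facts(4)) (use that t1T in auto)
  obtain M a' b' \<alpha> \<beta> \<rho> where M: "0 \<le> M" "b0/2 \<le> a'" "a' < b'" "b' \<le> b0" "0 < \<rho>" "\<rho> \<le> 1/16"
    and MW: "\<And>\<epsilon> \<sigma> x y. \<lbrakk>\<epsilon> \<in> {0<..t1}; a' \<le> \<sigma>; \<sigma> \<le> b'; \<alpha> \<le> x; x \<le> \<alpha> + \<rho>; \<beta> \<le> y; y \<le> \<beta> + \<rho>\<rbrakk> \<Longrightarrow> \<bar>W \<epsilon> \<sigma> (vector [x, y])\<bar> \<le> M"
  proof (rule Baire_locally_bounded[of "b0/2" b0 "{0<..t1}" W])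
    show "b0 / 2 < b0" using b0 by simp
    fix \<epsilon> assume \<epsilon>: "\<epsilon> \<in> {0<..t1}"
    have "uniform_limit ({b0/2..b0} \<times> UNIV) (\<lambda>X z. \<Sum>k\<in>X. exp (- fst z * lam k) * duhamel nl_coef \<epsilon> t1 k * cis (freq k \<bullet> snd z))
        (\<lambda>z. \<Sum>\<^sub>\<infinity>k. exp (- fst z * lam k) * duhamel nl_coef \<epsilon> t1 k * cis (freq k \<bullet> snd z)) (finite_subsets_at_top UNIV)"
    proof (rule Weierstrass_m_test_general[OF _ sm[OF \<epsilon>]])
      fix k and z :: "real \<times> (real^2)" assume "z \<in> {b0/2..b0} \<times> UNIV"
      then have "exp (- fst z * lam k) \<le> 1" using b0 by auto
      from mult_right_mono[OF this, of "norm (duhamel nl_coef \<epsilon> t1 k)"]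
      show "norm (exp (- fst z * lam k) * duhamel nl_coef \<epsilon> t1 k * cis (freq k \<bullet> snd z)) \<le> norm (duhamel nl_coef \<epsilon> t1 k)" by (simp add: norm_mult)
    qed
    then have "continuous_on ({b0/2..b0} \<times> UNIV) (\<lambda>z. \<Sum>\<^sub>\<infinity>k. exp (- fst z * lam k) * duhamel nl_coef \<epsilon> t1 k * cis (freq k \<bullet> snd z))"
      by (rule uniform_limit_theorem[rotated]) (auto intro!: always_eventually continuous_intros)
    then show "continuous_on ({b0/2..b0} \<times> UNIV) (\<lambda>z. W \<epsilon> (fst z) (snd z))"
      unfolding W_def syn_def csyn_def by (rule continuous_on_Re)
  next
    fix \<sigma> x assume \<sigma>: "\<sigma> \<in> {b0/2..b0}"
    let ?D = "\<lambda>s. syn (\<lambda>k. exp (- (t1 + \<sigma> - s) * lam k) * nl_coef s k) x"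
    have T: "0 < t1 + \<sigma>" "t1 + \<sigma> < Tm" using \<sigma> t1 b0 by auto
    have "?D integrable_on {0..t1}"
      by (rule integrable_on_subinterval[OF u_formula(1)[OF T]]) (use \<sigma> b0 in auto)
    then have "continuous_on {0..t1} (\<lambda>\<epsilon>. integral {\<epsilon>..t1} ?D)" by (rule indefinite_integral_continuous_1')
    then have "bounded ((\<lambda>\<epsilon>. integral {\<epsilon>..t1} ?D) ` {0..t1})"
      by (intro compact_imp_bounded compact_continuous_image) auto
    then obtain B where B: "\<And>\<epsilon>. \<epsilon> \<in> {0..t1} \<Longrightarrow> \<bar>integral {\<epsilon>..t1} ?D\<bar> \<le> B"
      unfolding bounded_iff real_norm_def by blast
    have "\<bar>W \<epsilon> \<sigma> x\<bar> \<le> B" if "\<epsilon> \<in> {0<..t1}" for \<epsilon>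
      using B[of \<epsilon>] integral_eps[of \<epsilon> t1 "t1 + \<sigma>" x] that \<sigma> b0 T by (simp add: W_def)
    then show "\<exists>B. \<forall>\<epsilon>\<in>{0<..t1}. \<bar>W \<epsilon> \<sigma> x\<bar> \<le> B" by blast
  qed blast
  obtain C where C: "\<And>(c :: int^2 \<Rightarrow> complex) k. \<lbrakk>(\<lambda>k. norm (c k) * exp (- a' * lam k)) summable_on UNIV;
      \<And>t x y. \<lbrakk>a' \<le> t; t \<le> b'; \<alpha> \<le> x; x \<le> \<alpha> + \<rho>; \<beta> \<le> y; y \<le> \<beta> + \<rho>\<rbrakk> \<Longrightarrow> norm (csyn (\<lambda>k. exp (- t * lam k) * c k) (vector [x, y])) \<le> M\<rbrakk>
      \<Longrightarrow> norm (c k) * exp (- b' * lam k) \<le> C"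
    using observability[OF M(3,5,6,1), of \<alpha> \<beta>] by blast
  show thesis
  proof (rule that)
    fix \<epsilon> k assume \<epsilon>: "0 < \<epsilon>" "\<epsilon> \<le> t1"
    have "norm (duhamel nl_coef \<epsilon> t1 k) * exp (- b0 * lam k) \<le> norm (duhamel nl_coef \<epsilon> t1 k) * exp (- b' * lam k)"
      using M by (intro mult_left_mono) (auto intro: mult_right_mono)
    also have "\<dots> \<le> C"
    proof (rule C)
      have "(\<lambda>k. norm (exp (- a' * lam k) * duhamel nl_coef \<epsilon> t1 k)) summable_on UNIV"
        by (rule exp_duhamel_summable[OF \<epsilon> t1T]) (use M b0 in auto)
      then show "(\<lambda>k. norm (duhamel nl_coef \<epsilon> t1 k) * exp (- a' * lam k)) summable_on UNIV"
        by (simp add: norm_mult mult.commute)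
      fix t x y assume "a' \<le> t" "t \<le> b'" "\<alpha> \<le> x" "x \<le> \<alpha> + \<rho>" "\<beta> \<le> y" "y \<le> \<beta> + \<rho>"
      then have "\<bar>W \<epsilon> t (vector [x, y])\<bar> \<le> M" using MW[of \<epsilon> t x y] \<epsilon> by auto
      moreover have "csyn (\<lambda>k. exp (- t * lam k) * duhamel nl_coef \<epsilon> t1 k) (vector [x, y]) = of_real (W \<epsilon> t (vector [x, y]))"
        unfolding W_def by (rule csyn_eq_of_real_syn[OF hermitian_exp[OF duhamel_flow_hermitian]])
      ultimately show "norm (csyn (\<lambda>k. exp (- t * lam k) * duhamel nl_coef \<epsilon> t1 k) (vector [x, y])) \<le> M" by simp
    qed
    finally show "norm (duhamel nl_coef \<epsilon> t1 k) * exp (- b0 * lam k) \<le> C" .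
  qed
qed

lemma exp_times_bound:
  fixes z :: complex
  assumes "norm z * exp (- b * lam k) \<le> C"
  shows "norm (exp (- \<sigma> * lam k) * z) \<le> C * exp (- (\<sigma> - b) * lam k)"
proof -
  have "norm (exp (- \<sigma> * lam k) * z) = (norm z * exp (- b * lam k)) * exp (- (\<sigma> - b) * lam k)"
    by (simp add: norm_mult algebra_simps flip: exp_add)
  also have "\<dots> \<le> C * exp (- (\<sigma> - b) * lam k)" by (intro mult_right_mono assms) auto
  finally show ?thesis .
qed

text \<open>As eps tends to 0 the truncated integrals at time t converge at each point and are
  bounded uniformly in x by \<open>duhamel_bound\<close>, so their Fourier coefficients converge;
  undoing the damping from t1 to t gives the claim.\<close>

lemma duhamel_limit:
  assumes t1: "0 < t1" "t1 < Tm"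
  obtains c where "\<And>k. ((\<lambda>\<epsilon>. duhamel nl_coef \<epsilon> t1 k) \<longlongrightarrow> c k) (at_right 0)"
proof -
  define t where "t = (t1 + Tm) / 2"
  \<comment> \<open>Half of the time from t1 to t pays for the growth that
    \<open>duhamel_bound\<close> permits, the other half leaves a summable factor.\<close>
  define b0 where "b0 = (t - t1) / 2"
  have t: "t1 < t" "t < Tm" "0 < t" using t1 by (auto simp: t_def)
  have b0: "0 < b0" "t1 + b0 < Tm" "0 < t - t1 - b0" using t by (auto simp: b0_def field_simps)
  obtain C where C: "\<And>\<epsilon> k. 0 < \<epsilon> \<Longrightarrow> \<epsilon> \<le> t1 \<Longrightarrow> norm (duhamel nl_coef \<epsilon> t1 k) * exp (- b0 * lam k) \<le> C"
    using duhamel_bound[OF t1(1) b0(1,2)] by blast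
  let ?D = "\<lambda>x s. syn (\<lambda>k. exp (- (t - s) * lam k) * nl_coef s k) x"
  let ?W = "\<lambda>\<epsilon> x. integral {\<epsilon>..t1} (?D x)"
  let ?K = "\<Sum>\<^sub>\<infinity>k. C * exp (- (t - t1 - b0) * lam k)"
  have Ks: "(\<lambda>k. C * exp (- (t - t1 - b0) * lam k)) summable_on UNIV"
    by (rule summable_on_cmult_right[OF summable_exp_lam[OF b0(3)]])
  have int0: "?D x integrable_on {0..t1}" for x
    by (rule integrable_on_subinterval[OF u_formula(1)[OF t(3,2)]]) (use t in auto)
  have lim: "((\<lambda>\<epsilon>. ?W \<epsilon> x) \<longlongrightarrow> ?W 0 x) (at_right 0)" for x
    by (rule integral_tendsto_at_right[OF int0 t1(1)])
  have e: "complex_of_real (?W \<epsilon> x) = csyn (\<lambda>k. exp (- (t - t1) * lam k) * duhamel nl_coef \<epsilon> t1 k) x" if "0 < \<epsilon>" "\<epsilon> \<le> t1" for \<epsilon> x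
    unfolding integral_eps[OF that less_imp_le[OF t(1)] t(2)]
    by (rule csyn_eq_of_real_syn[OF hermitian_exp[OF duhamel_flow_hermitian], symmetric])
  have sm: "(\<lambda>k. norm (exp (- (t - t1) * lam k) * duhamel nl_coef \<epsilon> t1 k)) summable_on UNIV" if "0 < \<epsilon>" "\<epsilon> \<le> t1" for \<epsilon>
    by (rule exp_duhamel_summable[OF that t1(2)]) (use t in auto)
  have bd: "norm (complex_of_real (?W \<epsilon> x)) \<le> ?K" if "0 < \<epsilon>" "\<epsilon> \<le> t1" for \<epsilon> x
    unfolding e[OF that]
  proof (rule order_trans[OF norm_csyn_le[OF sm[OF that]]], rule infsum_mono[OF sm[OF that] Ks])
    fix k show "norm (exp (- (t - t1) * lam k) * duhamel nl_coef \<epsilon> t1 k) \<le> C * exp (- (t - t1 - b0) * lam k)"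
      by (rule exp_times_bound[OF C[OF that]])
  qed
  have L: "((\<lambda>\<epsilon>. exp (- (t - t1) * lam k) * duhamel nl_coef \<epsilon> t1 k) \<longlongrightarrow> integral (cbox 0 1) (\<lambda>x. complex_of_real (?W 0 x) * cis (- (freq k \<bullet> x)))) (at_right 0)" for k
  proof (rule tendsto_at_right_sequentially[OF t1(1)])
    fix S :: "nat \<Rightarrow> real" assume S: "\<And>m. 0 < S m" "\<And>m. S m < t1" "S \<longlonglongrightarrow> 0"
    have S': "S m \<le> t1" for m using S(2)[of m] by simp
    have "filterlim S (at_right 0) sequentially" using S(1,3) less_imp_neq[OF S(1)] by (auto simp: filterlim_at intro!: always_eventually)
    then have pt: "(\<lambda>m. ?W (S m) x) \<longlonglongrightarrow> ?W 0 x" for x using filterlim_compose[OF lim] by blast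
    have "(\<lambda>m. integral (cbox 0 1) (\<lambda>x. complex_of_real (?W (S m) x) * cis (- (freq k \<bullet> x)))) \<longlonglongrightarrow> integral (cbox 0 1) (\<lambda>x. complex_of_real (?W 0 x) * cis (- (freq k \<bullet> x)))"
    proof (rule dominated_convergence(2)[where h="\<lambda>_. ?K"])
      show "(\<lambda>x. complex_of_real (?W (S m) x) * cis (- (freq k \<bullet> x))) integrable_on cbox 0 1" for m
        unfolding e[OF S(1) S'] by (intro integrable_continuous continuous_intros continuous_on_csyn sm[OF S(1) S'])
      show "norm (complex_of_real (?W (S m) x) * cis (- (freq k \<bullet> x))) \<le> ?K" for m x
        using bd[OF S(1) S', of m x] by (simp add: norm_mult)
      show "(\<lambda>m. complex_of_real (?W (S m) x) * cis (- (freq k \<bullet> x))) \<longlonglongrightarrow> complex_of_real (?W 0 x) * cis (- (freq k \<bullet> x))" for x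
        by (intro tendsto_intros pt)
    qed auto
    moreover have "integral (cbox 0 1) (\<lambda>x. complex_of_real (?W (S m) x) * cis (- (freq k \<bullet> x))) = exp (- (t - t1) * lam k) * duhamel nl_coef (S m) t1 k" for m
      unfolding e[OF S(1) S'] by (rule csyn_has_coeff[OF sm[OF S(1) S']])
    ultimately show "(\<lambda>m. exp (- (t - t1) * lam k) * duhamel nl_coef (S m) t1 k) \<longlonglongrightarrow> integral (cbox 0 1) (\<lambda>x. complex_of_real (?W 0 x) * cis (- (freq k \<bullet> x)))" by simp
  qed
  have L2: "((\<lambda>\<epsilon>. exp ((t - t1) * lam k) * (exp (- (t - t1) * lam k) * duhamel nl_coef \<epsilon> t1 k)) \<longlongrightarrow>
      exp ((t - t1) * lam k) * integral (cbox 0 1) (\<lambda>x. complex_of_real (?W 0 x) * cis (- (freq k \<bullet> x)))) (at_right 0)" for k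
    by (rule tendsto_mult[OF tendsto_const L])
  have E: "exp ((t - t1) * lam k) * (exp (- (t - t1) * lam k) * duhamel nl_coef \<epsilon> t1 k) = duhamel nl_coef \<epsilon> t1 k" for \<epsilon> k
    by (simp add: mult.assoc[symmetric] flip: of_real_mult exp_add) (simp add: algebra_simps)
  show thesis by (rule that) (rule L2[unfolded E])
qed

lemma duhamel_limit_bound:
  fixes c :: complex
  assumes b: "\<And>\<epsilon>. 0 < \<epsilon> \<Longrightarrow> \<epsilon> \<le> t1 \<Longrightarrow> norm (duhamel nl_coef \<epsilon> t1 k) * exp (- b0 * lam k) \<le> C" and t1: "0 < t1"
    and lim: "((\<lambda>\<epsilon>. duhamel nl_coef \<epsilon> t1 k) \<longlongrightarrow> c) (at_right 0)"
  shows "norm c * exp (- b0 * lam k) \<le> C"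
proof (rule tendsto_upperbound)
  show "((\<lambda>\<epsilon>. norm (duhamel nl_coef \<epsilon> t1 k) * exp (- b0 * lam k)) \<longlongrightarrow> norm c * exp (- b0 * lam k)) (at_right 0)"
    by (intro tendsto_intros lim)
  show "\<forall>\<^sub>F \<epsilon> in at_right 0. norm (duhamel nl_coef \<epsilon> t1 k) * exp (- b0 * lam k) \<le> C"
    unfolding eventually_at_right_field using b t1 by (intro exI[of _ t1]) auto
qed simp

text \<open>Any sigma > 0 suffices: the loss b0 is chosen below sigma, and the remaining exp (-
  (sigma - b0) lam k) is a summable majorant.\<close>

lemma syn_duhamel_tendsto:
  fixes c :: "int^2 \<Rightarrow> complex"
  assumes t1: "0 < t1" "t1 < Tm" and \<sigma>: "0 < \<sigma>"
    and lim: "\<And>k. ((\<lambda>\<epsilon>. duhamel nl_coef \<epsilon> t1 k) \<longlongrightarrow> c k) (at_right 0)"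
  shows "((\<lambda>\<epsilon>. syn (\<lambda>k. exp (- \<sigma> * lam k) * duhamel nl_coef \<epsilon> t1 k) x) \<longlongrightarrow> syn (\<lambda>k. exp (- \<sigma> * lam k) * c k) x) (at_right 0)"
    and "(\<lambda>k. norm (freq k) * norm (exp (- \<sigma> * lam k) * c k)) summable_on UNIV"
proof -
  define b0 where "b0 = min (\<sigma>/2) ((Tm - t1)/2)"
  have b0: "0 < b0" "t1 + b0 < Tm" "0 < \<sigma> - b0" using t1 \<sigma> by (auto simp: b0_def min_def field_simps)
  obtain C where C: "\<And>\<epsilon> k. 0 < \<epsilon> \<Longrightarrow> \<epsilon> \<le> t1 \<Longrightarrow> norm (duhamel nl_coef \<epsilon> t1 k) * exp (- b0 * lam k) \<le> C"
    using duhamel_bound[OF t1(1) b0(1,2)] by blast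
  have Cc: "norm (c k) * exp (- b0 * lam k) \<le> C" for k by (rule duhamel_limit_bound[where C=C, OF _ t1(1) lim]) (rule C)
  have "((\<lambda>\<epsilon>. \<Sum>\<^sub>\<infinity>k. exp (- \<sigma> * lam k) * duhamel nl_coef \<epsilon> t1 k * cis (freq k \<bullet> x)) \<longlongrightarrow> (\<Sum>\<^sub>\<infinity>k. exp (- \<sigma> * lam k) * c k * cis (freq k \<bullet> x))) (at_right 0)"
  proof (rule infsum_tendsto_dominated[OF _ _ summable_on_cmult_right[OF summable_exp_lam[OF b0(3)], of C]])
    show "((\<lambda>\<epsilon>. exp (- \<sigma> * lam k) * duhamel nl_coef \<epsilon> t1 k * cis (freq k \<bullet> x)) \<longlongrightarrow> exp (- \<sigma> * lam k) * c k * cis (freq k \<bullet> x)) (at_right 0)" for k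
      by (intro tendsto_intros lim)
    have "norm (exp (- \<sigma> * lam k) * duhamel nl_coef \<epsilon> t1 k * cis (freq k \<bullet> x)) \<le> C * exp (- (\<sigma> - b0) * lam k)" if "0 < \<epsilon>" "\<epsilon> < t1" for \<epsilon> k
      using exp_times_bound[OF C[of \<epsilon> k], of \<sigma>] that by (simp add: norm_mult)
    then show "\<forall>\<^sub>F \<epsilon> in at_right 0. \<forall>k. norm (exp (- \<sigma> * lam k) * duhamel nl_coef \<epsilon> t1 k * cis (freq k \<bullet> x)) \<le> C * exp (- (\<sigma> - b0) * lam k)"
      unfolding eventually_at_right_field using t1 by (intro exI[of _ t1]) auto
  qed
  then show "((\<lambda>\<epsilon>. syn (\<lambda>k. exp (- \<sigma> * lam k) * duhamel nl_coef \<epsilon> t1 k) x) \<longlongrightarrow> syn (\<lambda>k. exp (- \<sigma> * lam k) * c k) x) (at_right 0)"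
    unfolding syn_def csyn_def by (rule tendsto_Re)
  have sp: "(\<lambda>k. C * (norm (freq k) powr 1 * exp (- (\<sigma> - b0) * lam k))) summable_on UNIV"
    by (intro summable_on_cmult_right summable_freq_exp_lam b0) auto
  show "(\<lambda>k. norm (freq k) * norm (exp (- \<sigma> * lam k) * c k)) summable_on UNIV"
  proof (rule summable_on_real_comparison[OF sp])
    fix k
    show "norm (freq k) * norm (exp (- \<sigma> * lam k) * c k) \<le> C * (norm (freq k) powr 1 * exp (- (\<sigma> - b0) * lam k))"
      using mult_left_mono[OF exp_times_bound[OF Cc, of \<sigma> k], of "norm (freq k)"] by (simp add: mult_ac)
  qed auto
qed

text \<open>The Duhamel integral is cut at t1. The part before t1 is the free evolution of the limit
  \<open>c\<close>, the part after has a bounded source, so \<open>u t\<close> is an absolutely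
  convergent series although the source near time 0 is uncontrolled.\<close>

lemma u_coeffs_at:
  fixes c :: "int^2 \<Rightarrow> complex"
  assumes t: "0 < t1" "t1 < t" "t < Tm" and lim: "\<And>k. ((\<lambda>\<epsilon>. duhamel nl_coef \<epsilon> t1 k) \<longlongrightarrow> c k) (at_right 0)"
  shows "u t = syn (fcoef (u t))"
    and "(\<lambda>k. norm (freq k) * norm (fcoef (u t) k)) summable_on UNIV"
    and "fcoef (u t) k = exp (- t * lam k) * fcoef u0 k - exp (- (t - t1) * lam k) * c k - duhamel nl_coef t1 t k"
proof -
  define A where "A k = exp (- t * lam k) * fcoef u0 k - exp (- (t - t1) * lam k) * c k - duhamel nl_coef t1 t k" for k
  have t0: "0 < t" using t by linarith
  have t1T: "t1 < Tm" using t by linarith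
  obtain K where K: "\<And>x. \<bar>u0 x\<bar> \<le> K" using W1inf_norm_bounds(1)[OF u0] by blast
  have s1: "(\<lambda>k. norm (freq k) * norm (exp (- t * lam k) * fcoef u0 k)) summable_on UNIV"
  proof -
    have sp: "(\<lambda>k. K * (norm (freq k) powr 1 * exp (- t * lam k))) summable_on UNIV"
      by (intro summable_on_cmult_right summable_freq_exp_lam t0) auto
    show ?thesis
    proof (rule summable_on_real_comparison[OF sp])
      fix k
      have "norm (freq k) * exp (- t * lam k) * norm (fcoef u0 k) \<le> norm (freq k) * exp (- t * lam k) * K"
        by (intro mult_left_mono fcoef_bound K) auto
      then show "norm (freq k) * norm (exp (- t * lam k) * fcoef u0 k) \<le> K * (norm (freq k) powr 1 * exp (- t * lam k))"
        by (simp add: norm_mult mult_ac)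
    qed auto
  qed
  have s2: "(\<lambda>k. norm (freq k) * norm (exp (- (t - t1) * lam k) * c k)) summable_on UNIV"
    by (rule syn_duhamel_tendsto(2)[OF t(1) t1T _ lim]) (use t in auto)
  have s3: "(\<lambda>k. norm (freq k) * norm (duhamel nl_coef t1 t k)) summable_on UNIV"
    by (rule duhamel_flow_facts(5)) (use t in auto)
  have s12: "(\<lambda>k. norm (freq k) * norm (exp (- t * lam k) * fcoef u0 k - exp (- (t - t1) * lam k) * c k)) summable_on UNIV"
    by (rule summable_diff_weighted[OF s1 s2]) simp
  have sA: "(\<lambda>k. norm (freq k) * norm (A k)) summable_on UNIV"
    unfolding A_def by (rule summable_diff_weighted[OF s12 s3]) simp
  note n1 = weighted_summableD(1)[OF weighted_summableI[OF s1]] and n2 = weighted_summableD(1)[OF weighted_summableI[OF s2]]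
    and n3 = weighted_summableD(1)[OF weighted_summableI[OF s3]] and n12 = weighted_summableD(1)[OF weighted_summableI[OF s12]]
    and nA = weighted_summableD(1)[OF weighted_summableI[OF sA]]
  have hc: "hermitian_coeffs c"
    unfolding hermitian_coeffs_def
  proof
    fix k
    have "((\<lambda>\<epsilon>. duhamel nl_coef \<epsilon> t1 (- k)) \<longlongrightarrow> c (- k)) (at_right 0)" by (rule lim)
    moreover have "((\<lambda>\<epsilon>. duhamel nl_coef \<epsilon> t1 (- k)) \<longlongrightarrow> cnj (c k)) (at_right 0)"
      using tendsto_cnj[OF lim[of k]] duhamel_flow_hermitian by (simp add: hermitian_coeffs_def)
    ultimately show "c (- k) = cnj (c k)" by (intro tendsto_unique) auto
  qed
  have hA: "hermitian_coeffs A"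
    using hc duhamel_flow_hermitian hermitian_fcoef[of u0] by (simp add: A_def hermitian_coeffs_def)
  have uA: "u t x = syn A x" for x
  proof -
    let ?D = "\<lambda>s. syn (\<lambda>k. exp (- (t - s) * lam k) * nl_coef s k) x"
    have i: "?D integrable_on {0..t}" by (rule u_formula(1)[OF t0 t(3)])
    have i1: "?D integrable_on {0..t1}" by (rule integrable_on_subinterval[OF i]) (use t in auto)
    have "integral {0..t1} ?D = syn (\<lambda>k. exp (- (t - t1) * lam k) * c k) x"
    proof (rule tendsto_unique)
      show "((\<lambda>\<epsilon>. integral {\<epsilon>..t1} ?D) \<longlongrightarrow> integral {0..t1} ?D) (at_right 0)"
        by (rule integral_tendsto_at_right[OF i1 t(1)])
      have "\<forall>\<^sub>F \<epsilon> in at_right 0. syn (\<lambda>k. exp (- (t - t1) * lam k) * duhamel nl_coef \<epsilon> t1 k) x = integral {\<epsilon>..t1} ?D"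
        unfolding eventually_at_right_field using t by (intro exI[of _ t1]) (auto simp only: integral_eps less_imp_le)
      then show "((\<lambda>\<epsilon>. integral {\<epsilon>..t1} ?D) \<longlongrightarrow> syn (\<lambda>k. exp (- (t - t1) * lam k) * c k) x) (at_right 0)"
        by (rule Lim_transform_eventually[rotated]) (rule syn_duhamel_tendsto(1)[OF t(1) t1T _ lim], use t in auto)
    qed simp
    moreover have "integral {t1..t} ?D = syn (duhamel nl_coef t1 t) x" by (rule duhamel_flow_facts(3)) (use t in auto)
    moreover have "integral {0..t1} ?D + integral {t1..t} ?D = integral {0..t} ?D"
      by (rule Henstock_Kurzweil_Integration.integral_combine[OF _ _ i]) (use t in auto)
    ultimately have "u t x = syn (\<lambda>k. exp (- t * lam k) * fcoef u0 k) x - syn (\<lambda>k. exp (- (t - t1) * lam k) * c k) x - syn (duhamel nl_coef t1 t) x"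
      unfolding u_formula(2)[OF t0 t(3)] semigroup_eq_syn by simp
    also have "\<dots> = syn A x"
      unfolding A_def syn_diff[OF n1 n2] by (rule syn_diff[OF n12 n3])
    finally show ?thesis .
  qed
  then have us: "u t = syn A" by auto
  have fA: "fcoef (u t) = A" unfolding us by (rule ext) (rule fcoef_syn[OF hA nA])
  show "u t = syn (fcoef (u t))" unfolding fA by (rule us)
  show "(\<lambda>k. norm (freq k) * norm (fcoef (u t) k)) summable_on UNIV" unfolding fA by (rule sA)
  show "fcoef (u t) k = exp (- t * lam k) * fcoef u0 k - exp (- (t - t1) * lam k) * c k - duhamel nl_coef t1 t k"
    unfolding fA by (rule A_def)
qed

lemma u_fourier:
  assumes "0 < t" "t < Tm"
  shows "u t = syn (fcoef (u t))" and "(\<lambda>k. norm (freq k) * norm (fcoef (u t) k)) summable_on UNIV"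
proof -
  have h: "0 < t/2" "t/2 < Tm" "t/2 < t" using assms by auto
  obtain c where c: "\<And>k. ((\<lambda>\<epsilon>. duhamel nl_coef \<epsilon> (t/2) k) \<longlongrightarrow> c k) (at_right 0)" using duhamel_limit[OF h(1,2)] by blast
  show "u t = syn (fcoef (u t))" "(\<lambda>k. norm (freq k) * norm (fcoef (u t) k)) summable_on UNIV"
    by (rule u_coeffs_at[OF h(1,3) assms(2) c])+
qed

text \<open>Both u(r) and u(t) are written with the cut at r/2; the unknown past enters through the
  same \<open>c\<close> and is eliminated by the semigroup law.\<close>

lemma u_restart:
  assumes "0 < r" "r \<le> t" "t < Tm"
  shows "fcoef (u t) k = exp (- (t - r) * lam k) * fcoef (u r) k - duhamel nl_coef r t k"
proof (cases "r = t")
  case False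
  then have rt: "r < t" using assms by simp
  have h: "0 < r/2" "r/2 < Tm" "r/2 < r" "r/2 < t" "r < Tm" using assms by auto
  obtain c where c: "\<And>k. ((\<lambda>\<epsilon>. duhamel nl_coef \<epsilon> (r/2) k) \<longlongrightarrow> c k) (at_right 0)" using duhamel_limit[OF h(1,2)] by blast
  have d: "duhamel nl_coef (r/2) t k = exp (- (t - r) * lam k) * duhamel nl_coef (r/2) r k + duhamel nl_coef r t k"
    by (rule duhamel_flow_split) (use assms h in auto)
  have e: "exp (- t * lam k) = exp (- (t - r) * lam k) * exp (- r * lam k)"
    "exp (- (t - r/2) * lam k) = exp (- (t - r) * lam k) * exp (- (r - r/2) * lam k)"
    unfolding exp_add[symmetric] by (rule arg_cong[where f=exp], simp add: algebra_simps)+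
  show ?thesis
    unfolding u_coeffs_at(3)[OF h(1,4) assms(3) c, of k] u_coeffs_at(3)[OF h(1,3,5) c, of k] d
    by (simp only: e of_real_mult right_diff_distrib mult.assoc) simp
qed simp

text \<open>Identifies the contribution of (0, r] in terms of u0 and u(r), by comparing two formulas
  for u at a later time. \<open>past_integral\<close> needs it in this closed form.\<close>

lemma duhamel_limit_eq:
  assumes r: "0 < r" "r < Tm"
  shows "((\<lambda>\<epsilon>. duhamel nl_coef \<epsilon> r k) \<longlongrightarrow> exp (- r * lam k) * fcoef u0 k - fcoef (u r) k) (at_right 0)"
proof -
  obtain c where c: "\<And>k. ((\<lambda>\<epsilon>. duhamel nl_coef \<epsilon> r k) \<longlongrightarrow> c k) (at_right 0)" using duhamel_limit[OF r] by blast
  define t where "t = (r + Tm) / 2"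
  have t: "r < t" "t < Tm" using r by (auto simp: t_def)
  let ?E = "complex_of_real (exp (- (t - r) * lam k))"
  have "?E * fcoef (u r) k = exp (- t * lam k) * fcoef u0 k - ?E * c k"
    using u_coeffs_at(3)[OF r(1) t c, of k] u_restart[OF r(1) less_imp_le[OF t(1)] t(2), of k] by simp
  also have "exp (- t * lam k) = exp (- (t - r) * lam k) * exp (- r * lam k)"
    unfolding exp_add[symmetric] by (rule arg_cong[where f=exp]) (simp add: algebra_simps)
  finally have "?E * fcoef (u r) k = ?E * (exp (- r * lam k) * fcoef u0 k - c k)"
    by (simp add: algebra_simps)
  then have "c k = exp (- r * lam k) * fcoef u0 k - fcoef (u r) k" by simp
  then show ?thesis using c[of k] by simp
qed

end

section \<open>Continuation\<close>

text \<open>Gauge integrals contain the improper ones: \<open>I\<close> minus the integral over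
  [s, b], completed by 0 at a, is an antiderivative in the interior that is continuous on [a, b].
  Absolute integrability is not claimed.\<close>

lemma has_integral_improper_left:
  fixes f :: "real \<Rightarrow> real"
  assumes ab: "a < b" and c: "\<And>\<epsilon>. a < \<epsilon> \<Longrightarrow> \<epsilon> \<le> b \<Longrightarrow> continuous_on {\<epsilon>..b} f"
    and lim: "((\<lambda>\<epsilon>. integral {\<epsilon>..b} f) \<longlongrightarrow> I) (at_right a)"
  shows "(f has_integral I) {a..b}"
proof -
  define F where "F s = (if s = a then 0 else I - integral {s..b} f)" for s
  have "(f has_integral F b - F a) {a..b}"
  proof (rule fundamental_theorem_of_calculus_interior[OF less_imp_le[OF ab]])
    show "continuous_on {a..b} F"
      unfolding continuous_on_def
    proof
      fix s assume s: "s \<in> {a..b}"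
      show "(F \<longlongrightarrow> F s) (at s within {a..b})"
      proof (cases "s = a")
        case True
        have "((\<lambda>\<epsilon>. I - integral {\<epsilon>..b} f) \<longlongrightarrow> I - I) (at_right a)" by (intro tendsto_intros lim)
        moreover have "\<forall>\<^sub>F \<epsilon> in at_right a. I - integral {\<epsilon>..b} f = F \<epsilon>"
          unfolding eventually_at_right_field using ab by (intro exI[of _ b]) (auto simp: F_def)
        ultimately have "(F \<longlongrightarrow> I - I) (at_right a)" by (rule Lim_transform_eventually)
        then show ?thesis unfolding True using ab by (simp add: F_def at_within_Icc_at_right)
      next
        case False
        define e where "e = (a + s) / 2"
        have e: "a < e" "e < s" "e \<le> b" using s False by (auto simp: e_def)
        have "continuous_on {e..b} (\<lambda>\<epsilon>. I - integral {\<epsilon>..b} f)"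
          by (intro continuous_intros indefinite_integral_continuous_1' integrable_continuous_real c e)
        then have "((\<lambda>\<epsilon>. I - integral {\<epsilon>..b} f) \<longlongrightarrow> I - integral {s..b} f) (at s within {e..b})"
          using s e unfolding continuous_on_def by auto
        moreover have "at s within {a..b} = at s within {e..b}"
          by (rule at_within_nhd[of s "{e<..}"]) (use e in auto)
        moreover have "\<forall>\<^sub>F \<epsilon> in at s within {e..b}. I - integral {\<epsilon>..b} f = F \<epsilon>"
          unfolding eventually_at_filter using e by (intro always_eventually) (auto simp: F_def)
        ultimately show ?thesis using False
          by (simp add: F_def Lim_transform_eventually)
      qed
    qed
    fix s assume s: "s \<in> {a<..<b}"
    define e where "e = (a + s) / 2"
    have e: "a < e" "e < s" "e \<le> b" using s by (auto simp: e_def)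
    have "((\<lambda>u. integral {u..b} f) has_vector_derivative - f s) (at s within {e..b})"
      by (rule integral_has_vector_derivative'[OF c]) (use e s in auto)
    moreover have "at s within {e..b} = at s"
      by (rule at_within_nhd[of s "{e<..<b}" _ UNIV]) (use e s in auto)
    ultimately have "((\<lambda>u. integral {u..b} f) has_vector_derivative - f s) (at s)" by simp
    then have d: "((\<lambda>u. I - integral {u..b} f) has_vector_derivative 0 - (- f s)) (at s)"
      by (intro has_vector_derivative_diff has_vector_derivative_const)
    have "(F has_vector_derivative 0 - (- f s)) (at s)"
      by (rule has_vector_derivative_transform_within_open[OF d, of "{e<..<b}"]) (use e s in \<open>auto simp: F_def\<close>)
    then show "(F has_vector_derivative f s) (at s)" by simp
  qed
  then show ?thesis using ab by (simp add: F_def)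
qed

lemma norm_exp_lam_mult_le:
  fixes z :: complex
  assumes "0 \<le> \<sigma>" shows "norm (exp (- \<sigma> * lam k) * z) \<le> norm z"
proof -
  have "exp (- \<sigma> * lam k) \<le> 1" using assms by simp
  from mult_right_mono[OF this, of "norm z"] show ?thesis by (simp add: norm_mult)
qed

context mild_flow
begin

section \<open>Regularity of the flow away from time 0\<close>

lemma u_weighted: "0 < t \<Longrightarrow> t < Tm \<Longrightarrow> (\<lambda>k. (1 + norm (freq k)) * norm (fcoef (u t) k)) summable_on UNIV"
  by (rule weighted_summableI[OF u_fourier(2)])

lemma u_has_derivative:
  assumes "0 < t" "t < Tm"
  shows "(u t has_derivative (\<lambda>h. grad (u t) x \<bullet> h)) (at x)" and "grad (u t) = gsyn (fcoef (u t))"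
proof -
  show g: "grad (u t) = gsyn (fcoef (u t))"
    using grad_syn[OF u_weighted[OF assms]] u_fourier(1)[OF assms] by simp
  show "(u t has_derivative (\<lambda>h. grad (u t) x \<bullet> h)) (at x)"
    unfolding g using syn_has_derivative[OF u_weighted[OF assms], of x] u_fourier(1)[OF assms] by simp
qed

lemma grad_u_continuous: "0 < t \<Longrightarrow> t < Tm \<Longrightarrow> continuous_on S (grad (u t))"
  unfolding u_has_derivative(2) by (rule continuous_on_gsyn[OF u_fourier(2)])

lemma grad_u_diff:
  assumes "0 < s" "s < Tm" "0 < t" "t < Tm"
  shows "norm (grad (u s) x - grad (u t) x) \<le> 2 * W1inf_norm (\<lambda>x. u s x - u t x)"
proof -
  have "((\<lambda>x. u s x - u t x) has_derivative (\<lambda>h. (grad (u s) x - grad (u t) x) \<bullet> h)) (at x)"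
    using has_derivative_diff[OF u_has_derivative(1)[OF assms(1,2)] u_has_derivative(1)[OF assms(3,4)]]
    by (simp add: inner_diff_left)
  then have e: "grad (\<lambda>x. u s x - u t x) x = grad (u s) x - grad (u t) x" by (rule grad_eq)
  have W: "W1inf (\<lambda>x. u s x - u t x)" by (rule W1inf_diff) (use u_W1inf assms in auto)
  show ?thesis unfolding e[symmetric] by (rule norm_grad_le[OF W1inf_norm_bounds(2,3)[OF W]])
qed

lemma nl_coef_tendsto:
  assumes t: "0 < t" "t < Tm" shows "((\<lambda>s. nl_coef s k) \<longlongrightarrow> nl_coef t k) (at t)"
proof -
  define e where "e = t / 2"
  define T where "T = (t + Tm) / 2"
  have eT: "0 < e" "e < t" "t < T" "T < Tm" "e \<le> T" using t by (auto simp: e_def T_def)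
  obtain L where L: "0 \<le> L" "\<And>s x. s \<in> {e..T} \<Longrightarrow> norm (grad (u s) x) \<le> L" using u_bounded[OF eT(1,5,4)] by blast
  have le: "norm (nl_coef s k - nl_coef t k) \<le> norm (freq k) * (2 * (2 * L powr (p - 2) * (2 * W1inf_norm (\<lambda>x. u s x - u t x))))" if s: "s \<in> {e..T}" for s
  proof -
    have s0: "0 < s" "s < Tm" using s eT by auto
    have "nl_coef s k - nl_coef t k = div_coef (\<lambda>x. NL p (grad (u s) x) - NL p (grad (u t) x)) k"
      unfolding nl_coef_def nonlin_eq by (rule div_coef_diff) (intro continuous_on_NL p2 grad_u_continuous s0 t)+
    also have "norm \<dots> \<le> norm (freq k) * (2 * (2 * L powr (p - 2) * (2 * W1inf_norm (\<lambda>x. u s x - u t x))))"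
    proof (rule norm_div_coef_bounded)
      fix x
      have "norm (NL p (grad (u s) x) - NL p (grad (u t) x)) \<le> 2 * L powr (p - 2) * norm (grad (u s) x - grad (u t) x)"
        by (rule NL_lipschitz[OF p2 p3]) (rule L, use s eT in auto)+
      also have "\<dots> \<le> 2 * L powr (p - 2) * (2 * W1inf_norm (\<lambda>x. u s x - u t x))"
        by (intro mult_left_mono grad_u_diff s0 t) auto
      finally show "norm (NL p (grad (u s) x) - NL p (grad (u t) x)) \<le> 2 * L powr (p - 2) * (2 * W1inf_norm (\<lambda>x. u s x - u t x))" .
    qed
    finally show ?thesis .
  qed
  have "((\<lambda>s. norm (freq k) * (2 * (2 * L powr (p - 2) * (2 * W1inf_norm (\<lambda>x. u s x - u t x))))) \<longlongrightarrow> norm (freq k) * (2 * (2 * L powr (p - 2) * (2 * 0)))) (at t)"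
    by (intro tendsto_intros u_continuous t)
  then have lim: "((\<lambda>s. norm (freq k) * (2 * (2 * L powr (p - 2) * (2 * W1inf_norm (\<lambda>x. u s x - u t x))))) \<longlongrightarrow> 0) (at t)" by simp
  have ev: "\<forall>\<^sub>F s in at t. s \<in> {e<..<T}" by (rule eventually_at_in_open') (use eT in auto)
  have "((\<lambda>s. nl_coef s k - nl_coef t k) \<longlongrightarrow> 0) (at t)"
    by (rule Lim_null_comparison[OF _ lim]) (use ev le in \<open>auto elim: eventually_mono\<close>)
  then show ?thesis by (rule LIM_zero_cancel)
qed

lemma norm_nl_coef_le:
  assumes "0 < \<epsilon>" "\<epsilon> \<le> T" "T < Tm"
  obtains K where "0 \<le> K" "\<And>s k. s \<in> {\<epsilon>..T} \<Longrightarrow> norm (nl_coef s k) \<le> norm (freq k) * K"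
proof -
  obtain L where L: "0 \<le> L" "\<And>s x. s \<in> {\<epsilon>..T} \<Longrightarrow> norm (grad (u s) x) \<le> L" using u_bounded[OF assms] by blast
  have "norm (nl_coef s k) \<le> norm (freq k) * (2 * L powr (p - 1))" if "s \<in> {\<epsilon>..T}" for s k
    unfolding nl_coef_def nonlin_eq by (rule norm_div_coef_bounded) (rule norm_NL_le[OF p2 L(2)[OF that]])
  then show thesis by (intro that[of "2 * L powr (p - 1)"]) auto
qed

text \<open>The continued solution must satisfy Duhamel's formula from time 0, in the gauge sense,
  also at times t >= Tm, where \<open>u_formula\<close> says nothing. On [eps, r] the integrand is
  continuous because t > r damps all modes, and the integrals converge as eps tends to 0.\<close>

lemma past_integral:
  assumes r: "0 < r" "r < Tm" and t: "r < t"
  shows "((\<lambda>s. syn (\<lambda>k. exp (- (t - s) * lam k) * nl_coef s k) x) has_integral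
     (syn (\<lambda>k. exp (- t * lam k) * fcoef u0 k) x - syn (\<lambda>k. exp (- (t - r) * lam k) * fcoef (u r) k) x)) {0..r}"
proof (rule has_integral_improper_left[OF r(1)])
  let ?f = "\<lambda>k s. exp (- (t - s) * lam k) * nl_coef s k * cis (freq k \<bullet> x)"
  let ?D = "\<lambda>s. syn (\<lambda>k. exp (- (t - s) * lam k) * nl_coef s k) x"
  have Dsum: "?D = (\<lambda>s. Re (\<Sum>\<^sub>\<infinity>k. ?f k s))" by (simp add: syn_def csyn_def)
  have bound: "\<exists>h. h summable_on UNIV \<and> (\<forall>s\<in>{\<epsilon>..r}. \<forall>k. norm (?f k s) \<le> h k)" if e: "0 < \<epsilon>" "\<epsilon> \<le> r" for \<epsilon>
  proof -
    obtain K where K: "0 \<le> K" "\<And>s k. s \<in> {\<epsilon>..r} \<Longrightarrow> norm (nl_coef s k) \<le> norm (freq k) * K" using norm_nl_coef_le[OF e r(2)] by blast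
    have sp: "(\<lambda>k. K * (norm (freq k) powr 1 * exp (- (t - r) * lam k))) summable_on UNIV"
      by (intro summable_on_cmult_right summable_freq_exp_lam) (use t in auto)
    have "norm (?f k s) \<le> K * (norm (freq k) powr 1 * exp (- (t - r) * lam k))" if s: "s \<in> {\<epsilon>..r}" for s k
    proof -
      have "norm (?f k s) = exp (- (t - s) * lam k) * norm (nl_coef s k)" by (simp add: norm_mult)
      also have "\<dots> \<le> exp (- (t - r) * lam k) * (norm (freq k) * K)"
        using s by (intro mult_mono K) (auto intro: mult_right_mono)
      finally show ?thesis by (simp add: mult_ac)
    qed
    then show ?thesis using sp by blast
  qed
  have fc: "continuous_on {\<epsilon>..r} (?f k)" if "0 < \<epsilon>" for \<epsilon> k
  proof -
    have "continuous_on {\<epsilon>..r} (\<lambda>s. nl_coef s k)"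
      unfolding continuous_on_def
    proof
      fix s assume "s \<in> {\<epsilon>..r}"
      then show "((\<lambda>s. nl_coef s k) \<longlongrightarrow> nl_coef s k) (at s within {\<epsilon>..r})"
        using that r by (intro Lim_at_imp_Lim_at_within[OF nl_coef_tendsto]) auto
    qed
    then show ?thesis by (intro continuous_intros)
  qed
  show "continuous_on {\<epsilon>..r} ?D" if e: "0 < \<epsilon>" "\<epsilon> \<le> r" for \<epsilon>
  proof -
    obtain h where h: "h summable_on UNIV" "\<And>s k. s \<in> {\<epsilon>..r} \<Longrightarrow> norm (?f k s) \<le> h k" using bound[OF e] by blast
    have "continuous_on {\<epsilon>..r} (\<lambda>s. \<Sum>\<^sub>\<infinity>k. ?f k s)"
      unfolding continuous_on_def
    proof
      fix s assume s: "s \<in> {\<epsilon>..r}"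
      show "((\<lambda>s. \<Sum>\<^sub>\<infinity>k. ?f k s) \<longlongrightarrow> (\<Sum>\<^sub>\<infinity>k. ?f k s)) (at s within {\<epsilon>..r})"
      proof (rule infsum_tendsto_dominated[OF _ _ h(1)])
        show "(?f k \<longlongrightarrow> ?f k s) (at s within {\<epsilon>..r})" for k using fc[OF e(1)] s by (simp add: continuous_on_def)
        show "\<forall>\<^sub>F s in at s within {\<epsilon>..r}. \<forall>k. norm (?f k s) \<le> h k"
          unfolding eventually_at_filter using h(2) by (intro always_eventually) blast
      qed
    qed
    then show ?thesis unfolding Dsum by (rule continuous_on_Re)
  qed
  have J: "integral {\<epsilon>..r} ?D = syn (\<lambda>k. exp (- (t - r) * lam k) * duhamel nl_coef \<epsilon> r k) x" if e: "0 < \<epsilon>" "\<epsilon> \<le> r" for \<epsilon>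
  proof -
    obtain h where h: "h summable_on UNIV" "\<And>s k. s \<in> {\<epsilon>..r} \<Longrightarrow> norm (?f k s) \<le> h k" using bound[OF e] by blast
    have h0: "0 \<le> h k" for k using h(2)[of r k] e by (meson atLeastAtMost_iff norm_ge_zero order_refl order_trans)
    have fi: "?f k integrable_on {\<epsilon>..r}" for k by (intro integrable_continuous_real fc e)
    have fb: "(\<Sum>k\<in>F. norm (?f k s)) \<le> infsum h UNIV" if "finite F" "s \<in> {\<epsilon>..r}" for F s
    proof -
      have "(\<Sum>k\<in>F. norm (?f k s)) \<le> sum h F" using h(2)[OF that(2)] by (rule sum_mono)
      also have "\<dots> \<le> infsum h UNIV" by (rule finite_sum_le_infsum[OF h(1) that(1)]) (use h0 in auto)
      finally show ?thesis .
    qed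
    note sw = integral_infsum_dominated[OF fi integrable_const_ivl fb]
    have "integral {\<epsilon>..r} ?D = Re (integral {\<epsilon>..r} (\<lambda>s. \<Sum>\<^sub>\<infinity>k. ?f k s))"
      unfolding Dsum using integral_linear[OF sw(1) bounded_linear_Re] by (simp only: o_def)
    also have "integral {\<epsilon>..r} (\<lambda>s. \<Sum>\<^sub>\<infinity>k. ?f k s) = (\<Sum>\<^sub>\<infinity>k. integral {\<epsilon>..r} (?f k))" by (rule sw(3))
    also have "\<dots> = (\<Sum>\<^sub>\<infinity>k. exp (- (t - r) * lam k) * duhamel nl_coef \<epsilon> r k * cis (freq k \<bullet> x))"
    proof (rule infsum_cong)
      fix k
      have E: "exp (- (t - s) * lam k) = exp (- (t - r) * lam k) * exp (- (r - s) * lam k)" for s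
        unfolding exp_add[symmetric] by (rule arg_cong[where f=exp]) (simp add: algebra_simps)
      have "?f k = (\<lambda>s. exp (- (t - r) * lam k) * (exp (- (r - s) * lam k) * nl_coef s k) * cis (freq k \<bullet> x))"
        by (rule ext, subst E) (simp only: of_real_mult mult.assoc)
      then show "integral {\<epsilon>..r} (?f k) = exp (- (t - r) * lam k) * duhamel nl_coef \<epsilon> r k * cis (freq k \<bullet> x)"
        unfolding duhamel_def by (simp only: integral_mult_left integral_mult_right)
    qed
    finally show ?thesis by (simp add: syn_def csyn_def)
  qed
  let ?c = "\<lambda>k. exp (- r * lam k) * fcoef u0 k - fcoef (u r) k"
  have "((\<lambda>\<epsilon>. syn (\<lambda>k. exp (- (t - r) * lam k) * duhamel nl_coef \<epsilon> r k) x) \<longlongrightarrow> syn (\<lambda>k. exp (- (t - r) * lam k) * ?c k) x) (at_right 0)"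
    by (rule syn_duhamel_tendsto(1)[OF r _ duhamel_limit_eq[OF r]]) (use t in auto)
  moreover have "\<forall>\<^sub>F \<epsilon> in at_right 0. syn (\<lambda>k. exp (- (t - r) * lam k) * duhamel nl_coef \<epsilon> r k) x = integral {\<epsilon>..r} ?D"
    unfolding eventually_at_right_field using r by (intro exI[of _ r] conjI allI impI J[symmetric] less_imp_le)
  ultimately have L: "((\<lambda>\<epsilon>. integral {\<epsilon>..r} ?D) \<longlongrightarrow> syn (\<lambda>k. exp (- (t - r) * lam k) * ?c k) x) (at_right 0)"
    by (rule Lim_transform_eventually)
  have e: "complex_of_real (exp (- (t - r) * lam k)) * ?c k = exp (- t * lam k) * fcoef u0 k - exp (- (t - r) * lam k) * fcoef (u r) k" for k
  proof -
    have "exp (- t * lam k) = exp (- (t - r) * lam k) * exp (- r * lam k)"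
      unfolding exp_add[symmetric] by (rule arg_cong[where f=exp]) (simp add: algebra_simps)
    then show ?thesis by (simp only: of_real_mult right_diff_distrib mult.assoc)
  qed
  obtain K where K: "\<And>x. \<bar>u0 x\<bar> \<le> K" using W1inf_norm_bounds(1)[OF u0] by blast
  have s1: "(\<lambda>k. norm (exp (- t * lam k) * fcoef u0 k)) summable_on UNIV"
  proof (rule summable_on_real_comparison[OF summable_on_cmult_right[OF summable_exp_lam[of t], of K]])
    show "norm (exp (- t * lam k) * fcoef u0 k) \<le> K * exp (- t * lam k)" for k
      using mult_right_mono[OF fcoef_bound[of u0 K k, OF K], of "exp (- t * lam k)"] by (simp add: norm_mult mult.commute)
  qed (use r t in auto)
  have s2: "(\<lambda>k. norm (exp (- (t - r) * lam k) * fcoef (u r) k)) summable_on UNIV"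
  proof (rule summable_on_real_comparison[OF weighted_summableD(1)[OF u_weighted[OF r]]])
    show "norm (exp (- (t - r) * lam k) * fcoef (u r) k) \<le> norm (fcoef (u r) k)" for k
      by (rule norm_exp_lam_mult_le) (use t in simp)
  qed auto
  show "((\<lambda>\<epsilon>. integral {\<epsilon>..r} ?D) \<longlongrightarrow> syn (\<lambda>k. exp (- t * lam k) * fcoef u0 k) x - syn (\<lambda>k. exp (- (t - r) * lam k) * fcoef (u r) k) x) (at_right 0)"
    unfolding syn_diff[OF s1 s2] using L unfolding e .
qed

text \<open>Glues \<open>u\<close> up to time r to the local solution started from u(r). The step
  tau depends on r only through the bound \<open>M\<close>, so a bound valid up to \<open>Tm\<close>
  permits a step across it.\<close>

lemma continuation:
  assumes r: "0 < r" "r < Tm" and M: "0 < M" "(\<Sum>\<^sub>\<infinity>k. norm (freq k) * norm (fcoef (u r) k)) \<le> M"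
    and \<tau>: "0 < \<tau>" "\<tau> \<le> 1" "288 * (2 * M) powr (p - 2) * \<tau> powr (1/4) \<le> 1/2"
  shows "\<exists>v. mild_solution p u0 v (r + \<tau>)"
proof -
  obtain a nn q B where h: "\<And>t. hermitian_coeffs (a t)"
    and as: "\<And>t. t \<in> {0..\<tau>} \<Longrightarrow> (\<lambda>k. norm (freq k) * norm (a t k)) summable_on UNIV"
    and ae: "\<And>t k. t \<in> {0..\<tau>} \<Longrightarrow> a t k = exp (- t * lam k) * fcoef (u r) k - duhamel nn 0 t k"
    and nn: "\<And>t k. t \<in> {0..\<tau>} \<Longrightarrow> nn t k = div_coef (nonlin p (syn (a t))) k"
    and src: "source nn q (\<lambda>_. B) 0 \<tau>" and B: "0 \<le> B"
    using local_existence[OF p2 p3 M(1) \<tau> u_fourier(2)[OF r] M(2) hermitian_fcoef] by blast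
  define v where "v t = (if t \<le> r then u t else syn (a (t - r)))" for t
  have aw: "(\<lambda>k. (1 + norm (freq k)) * norm (a t k)) summable_on UNIV" if "t \<in> {0..\<tau>}" for t
    by (rule weighted_summableI[OF as[OF that]])
  have a0: "a 0 k = fcoef (u r) k" for k using ae[of 0 k] \<tau> by simp
  have vr: "v t = syn (a (t - r))" if "r \<le> t" for t
  proof (cases "t = r")
    case True
    have "a 0 = fcoef (u r)" using a0 by auto
    then show ?thesis using True u_fourier(1)[OF r] by (simp add: v_def)
  qed (use that in \<open>auto simp: v_def\<close>)
  have Wv: "W1inf (v t)" if "0 < t" "t \<le> r + \<tau>" for t
  proof (cases "t \<le> r")
    case True then show ?thesis using u_W1inf[of t] that r by (simp add: v_def)
  next
    case False then show ?thesis using W1inf_syn[OF aw[of "t - r"]] that by (simp add: v_def)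
  qed
  \<comment> \<open>The mean is constant after r, so differences have no zero mode and the
    |k|-weighted sum controls the whole W^{1,infinity} norm, with a factor 2.\<close>
  have zero_mode: "a s 0 - a t 0 = 0" if "s \<in> {0..\<tau>}" "t \<in> {0..\<tau>}" for s t
  proof -
    have "duhamel nn 0 s 0 = 0" if "s \<in> {0..\<tau>}" for s
    proof -
      have "integral {0..s} (\<lambda>\<sigma>. complex_of_real (exp (- (s - \<sigma>) * lam 0)) * nn \<sigma> 0) = integral {0..s} (\<lambda>\<sigma>. 0)"
        by (rule integral_cong) (use nn that in auto)
      then show ?thesis by (simp add: duhamel_def)
    qed
    then show ?thesis using ae that by simp
  qed
  have vcont: "((\<lambda>s. W1inf_norm (\<lambda>x. v s x - v t x)) \<longlongrightarrow> 0) (at t within {r..r + \<tau>})" if t: "t \<in> {r..r + \<tau>}" for t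
  proof -
    have t': "t - r \<in> {0..\<tau>}" using t by auto
    have "((\<lambda>s. \<Sum>\<^sub>\<infinity>k. norm (freq k) * norm (a s k - a (t - r) k)) \<longlongrightarrow> 0) (at (t - r) within {0..\<tau>})"
      by (rule mild_coeffs_continuous[OF u_fourier(2)[OF r] src B _ t']) (use ae \<tau> in auto)
    moreover have "filterlim (\<lambda>s. s - r) (at (t - r) within {0..\<tau>}) (at t within {r..r + \<tau>})"
      unfolding filterlim_at by (auto simp: eventually_at_filter intro!: tendsto_intros)
    ultimately have l: "((\<lambda>s. \<Sum>\<^sub>\<infinity>k. norm (freq k) * norm (a (s - r) k - a (t - r) k)) \<longlongrightarrow> 0) (at t within {r..r + \<tau>})"
      by (rule filterlim_compose)
    have "((\<lambda>s. 2 * (\<Sum>\<^sub>\<infinity>k. norm (freq k) * norm (a (s - r) k - a (t - r) k))) \<longlongrightarrow> 2 * 0) (at t within {r..r + \<tau>})"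
      by (intro tendsto_intros l)
    then have l2: "((\<lambda>s. 2 * (\<Sum>\<^sub>\<infinity>k. norm (freq k) * norm (a (s - r) k - a (t - r) k))) \<longlongrightarrow> 0) (at t within {r..r + \<tau>})" by simp
    have le: "W1inf_norm (\<lambda>x. v s x - v t x) \<le> 2 * (\<Sum>\<^sub>\<infinity>k. norm (freq k) * norm (a (s - r) k - a (t - r) k))" and ge: "0 \<le> W1inf_norm (\<lambda>x. v s x - v t x)"
      if s: "s \<in> {r..r + \<tau>}" for s
    proof -
      have s': "s - r \<in> {0..\<tau>}" using s by auto
      let ?d = "\<lambda>k. a (s - r) k - a (t - r) k"
      have dw: "(\<lambda>k. norm (freq k) * norm (?d k)) summable_on UNIV"
        by (rule summable_diff_weighted[OF as[OF s'] as[OF t']]) simp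
      have e: "(\<lambda>x. v s x - v t x) = syn ?d"
        using s t vr[of s] vr[of t] syn_diff[OF weighted_summableD(1)[OF aw[OF s']] weighted_summableD(1)[OF aw[OF t']]] by auto
      have "W1inf_norm (\<lambda>x. v s x - v t x) \<le> (\<Sum>\<^sub>\<infinity>k. (1 + norm (freq k)) * norm (?d k))"
        unfolding e by (rule W1inf_norm_syn_le[OF weighted_summableI[OF dw]])
      also have "\<dots> \<le> (\<Sum>\<^sub>\<infinity>k. 2 * (norm (freq k) * norm (?d k)))"
      proof (rule infsum_mono[OF weighted_summableI[OF dw] summable_on_cmult_right[OF dw]])
        fix k
        show "(1 + norm (freq k)) * norm (?d k) \<le> 2 * (norm (freq k) * norm (?d k))"
        proof (cases "k = 0")
          case True then show ?thesis using zero_mode[OF s' t'] by simp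
        next
          case False
          have "1 * norm (?d k) \<le> norm (freq k) * norm (?d k)" by (intro mult_right_mono norm_freq_ge_1[OF False]) simp
          then show ?thesis by (simp add: distrib_right)
        qed
      qed
      also have "\<dots> = 2 * (\<Sum>\<^sub>\<infinity>k. norm (freq k) * norm (?d k))" by (rule infsum_cmult_right')
      finally show "W1inf_norm (\<lambda>x. v s x - v t x) \<le> 2 * (\<Sum>\<^sub>\<infinity>k. norm (freq k) * norm (?d k))" .
      show "0 \<le> W1inf_norm (\<lambda>x. v s x - v t x)"
        unfolding e by (rule W1inf_norm_bounds(3)[OF W1inf_syn[OF weighted_summableI[OF dw]]])
    qed
    show ?thesis
      by (rule tendsto_sandwich[OF _ _ tendsto_const l2]; unfold eventually_at_filter; intro always_eventually allI impI; rule le ge; assumption)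
  qed
  have ucont: "((\<lambda>s. W1inf_norm (\<lambda>x. v s x - v t x)) \<longlongrightarrow> 0) (at t within {0<..r})" if t: "0 < t" "t \<le> r" for t
  proof -
    have "((\<lambda>s. W1inf_norm (\<lambda>x. u s x - u t x)) \<longlongrightarrow> 0) (at t within {0<..r})"
      by (rule Lim_at_imp_Lim_at_within[OF u_continuous]) (use t r in auto)
    moreover have "\<forall>\<^sub>F s in at t within {0<..r}. W1inf_norm (\<lambda>x. u s x - u t x) = W1inf_norm (\<lambda>x. v s x - v t x)"
      unfolding eventually_at_filter using t by (intro always_eventually) (auto simp: v_def)
    ultimately show ?thesis by (rule Lim_transform_eventually)
  qed
  have cont: "((\<lambda>s. W1inf_norm (\<lambda>x. v s x - v t x)) \<longlongrightarrow> 0) (at t within {0<..r + \<tau>})" if t: "0 < t" "t \<le> r + \<tau>" for t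
  proof -
    consider "t < r" | "t = r" | "r < t" by linarith
    then show ?thesis
    proof cases
      case 1
      have "at t within {0<..r + \<tau>} = at t within {0<..r}"
        by (rule at_within_nhd[of t "{0<..<r}"]) (use 1 t \<tau> in auto)
      then show ?thesis using ucont[of t] 1 t by simp
    next
      case 2
      \<comment> \<open>At the gluing time the two one-sided limits are combined; by
        \<open>vr\<close> both descriptions of \<open>v\<close> agree there.\<close>
      have "{0<..r + \<tau>} = {0<..r} \<union> {r..r + \<tau>}" using r \<tau> by auto
      then show ?thesis using ucont[of t] vcont[of t] 2 t \<tau> by (simp add: Lim_within_Un)
    next
      case 3
      have "at t within {0<..r + \<tau>} = at t within {r..r + \<tau>}"
        by (rule at_within_nhd[of t "{r<..}"]) (use 3 t r in auto)
      then show ?thesis using vcont[of t] 3 t by simp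
    qed
  qed
  have form: "((\<lambda>s. div_semigroup (t - s) (nonlin p (v s)) x) has_integral (semigroup t u0 x - v t x)) {0..t}" if t: "0 < t" "t \<le> r + \<tau>" for t x
  proof (cases "t \<le> r")
    case True
    have tT: "t < Tm" using True r by simp
    have "((\<lambda>s. syn (\<lambda>k. exp (- (t - s) * lam k) * nl_coef s k) x) has_integral (semigroup t u0 x - u t x)) {0..t}"
      using integrable_integral[OF u_formula(1)[OF t(1) tT, of x]] u_formula(2)[OF t(1) tT, of x] by simp
    then have "((\<lambda>s. div_semigroup (t - s) (nonlin p (v s)) x) has_integral (semigroup t u0 x - u t x)) {0..t}"
      by (rule has_integral_eq[rotated]) (use True in \<open>simp only: div_semigroup_flow[symmetric], simp add: v_def\<close>)
    then show ?thesis using True by (simp add: v_def)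
  next
    case False
    \<comment> \<open>The integral over [0, t] is the past part on [0, r] plus the local one shifted
      by r; the terms containing u(r) cancel.\<close>
    let ?T = "t - r"
    have T: "?T \<in> {0..\<tau>}" "0 \<le> ?T" using False t by auto
    have "((\<lambda>s. syn (\<lambda>k. exp (- (t - s) * lam k) * nl_coef s k) x) has_integral
       (syn (\<lambda>k. exp (- t * lam k) * fcoef u0 k) x - syn (\<lambda>k. exp (- (t - r) * lam k) * fcoef (u r) k) x)) {0..r}"
      by (rule past_integral[OF r]) (use False in simp)
    then have 1: "((\<lambda>s. div_semigroup (t - s) (nonlin p (v s)) x) has_integral
       (syn (\<lambda>k. exp (- t * lam k) * fcoef u0 k) x - syn (\<lambda>k. exp (- (t - r) * lam k) * fcoef (u r) k) x)) {0..r}"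
      by (rule has_integral_eq[rotated]) (simp only: div_semigroup_flow[symmetric], simp add: v_def)
    have src': "source nn q (\<lambda>_. B) 0 ?T" by (rule source_subinterval[OF src]) (use T in auto)
    note d = duhamel_const_integrable[OF src' T(2) B]
    have "((\<lambda>\<sigma>. syn (\<lambda>k. exp (- (?T - \<sigma>) * lam k) * nn \<sigma> k) x) has_integral syn (duhamel nn 0 ?T) x) {0..?T}"
      using integrable_integral[OF d(2)] unfolding d(3) .
    then have "(((\<lambda>s. div_semigroup (t - s) (nonlin p (v s)) x) \<circ> (+) r) has_integral syn (duhamel nn 0 ?T) x) {0..?T}"
    proof (rule has_integral_eq[rotated])
      fix \<sigma> assume \<sigma>: "\<sigma> \<in> {0..?T}"
      then have \<sigma>': "\<sigma> \<in> {0..\<tau>}" using T by auto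
      have "v (r + \<sigma>) = syn (a \<sigma>)" using vr[of "r + \<sigma>"] \<sigma> by simp
      then have "div_coef (nonlin p (v (r + \<sigma>))) = nn \<sigma>" using nn[OF \<sigma>'] by auto
      moreover have "t - (r + \<sigma>) = ?T - \<sigma>" by simp
      ultimately show "syn (\<lambda>k. exp (- (?T - \<sigma>) * lam k) * nn \<sigma> k) x = ((\<lambda>s. div_semigroup (t - s) (nonlin p (v s)) x) \<circ> (+) r) \<sigma>"
        by (simp only: o_def div_semigroup_eq_syn)
    qed
    then have 2: "((\<lambda>s. div_semigroup (t - s) (nonlin p (v s)) x) has_integral syn (duhamel nn 0 ?T) x) {r..t}"
      unfolding has_integral_shift_Icc_real by simp
    have s2: "(\<lambda>k. norm (exp (- ?T * lam k) * fcoef (u r) k)) summable_on UNIV"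
    proof (rule summable_on_real_comparison[OF weighted_summableD(1)[OF u_weighted[OF r]]])
      show "norm (exp (- ?T * lam k) * fcoef (u r) k) \<le> norm (fcoef (u r) k)" for k
        by (rule norm_exp_lam_mult_le[OF T(2)])
    qed auto
    have "a ?T = (\<lambda>k. exp (- ?T * lam k) * fcoef (u r) k - duhamel nn 0 ?T k)" using ae[OF T(1)] by auto
    then have "v t x = syn (\<lambda>k. exp (- ?T * lam k) * fcoef (u r) k) x - syn (duhamel nn 0 ?T) x"
      using vr[of t] False syn_diff[OF s2 d(4), of x] by simp
    then have "semigroup t u0 x - v t x = (syn (\<lambda>k. exp (- t * lam k) * fcoef u0 k) x - syn (\<lambda>k. exp (- (t - r) * lam k) * fcoef (u r) k) x) + syn (duhamel nn 0 ?T) x"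
      by (simp only: semigroup_eq_syn)
    then show ?thesis using has_integral_combine[OF _ _ 1 2] r False by simp
  qed
  have "mild_solution p u0 v (r + \<tau>)"
    unfolding mild_solution_def
  proof (intro conjI ballI allI)
    show "0 < r + \<tau>" using r \<tau> by simp
    fix t assume "t \<in> {0<..r + \<tau>}"
    then have t: "0 < t" "t \<le> r + \<tau>" by auto
    show "W1inf (v t)" by (rule Wv[OF t])
    show "((\<lambda>s. W1inf_norm (\<lambda>x. v s x - v t x)) \<longlongrightarrow> 0) (at t within {0<..r + \<tau>})" by (rule cont[OF t])
    fix x
    show "(\<lambda>s. div_semigroup (t - s) (nonlin p (v s)) x) integrable_on {0..t}"
      by (rule has_integral_integrable[OF form[OF t]])
    show "v t x = semigroup t u0 x - integral {0..t} (\<lambda>s. div_semigroup (t - s) (nonlin p (v s)) x)"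
      using integral_unique[OF form[OF t]] by simp
  qed
  then show ?thesis by blast
qed

end

section \<open>Lower bound on the lifespan\<close>

text \<open>At the first time where phi reaches K all earlier values are at most K, and
  \<open>step\<close> gives the strict inequality there, a contradiction. The premise of
  \<open>step\<close> leaves out sigma = 0, where a weighted norm carries no information.\<close>

lemma barrier:
  fixes \<phi> :: "real \<Rightarrow> real"
  assumes c: "continuous_on {0..T} \<phi>" and 0: "\<phi> 0 < K"
    and step: "\<And>\<tau>. 0 < \<tau> \<Longrightarrow> \<tau> \<le> T \<Longrightarrow> (\<And>\<sigma>. 0 < \<sigma> \<Longrightarrow> \<sigma> < \<tau> \<Longrightarrow> \<phi> \<sigma> \<le> K) \<Longrightarrow> \<phi> \<tau> < K"
    and \<tau>: "\<tau> \<in> {0..T}"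
  shows "\<phi> \<tau> < K"
proof (rule ccontr)
  assume "\<not> \<phi> \<tau> < K"
  define S where "S = {0..T} \<inter> \<phi> -` {K..}"
  have S: "closed S" unfolding S_def by (rule continuous_closed_preimage[OF c]) auto
  have ne: "S \<noteq> {}" using \<tau> \<open>\<not> \<phi> \<tau> < K\<close> by (auto simp: S_def)
  have bd: "bdd_below S" by (rule bdd_belowI[of _ 0]) (auto simp: S_def)
  have I: "Inf S \<in> S" by (rule closed_contains_Inf[OF ne bd S])
  then have I': "0 \<le> Inf S" "Inf S \<le> T" "K \<le> \<phi> (Inf S)" by (auto simp: S_def)
  have "0 < Inf S" using I' 0 by (metis less_eq_real_def not_le)
  moreover have "\<phi> \<sigma> \<le> K" if "0 < \<sigma>" "\<sigma> < Inf S" for \<sigma>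
  proof (rule ccontr)
    assume "\<not> \<phi> \<sigma> \<le> K"
    then have "\<sigma> \<in> S" using that I' by (auto simp: S_def)
    then have "Inf S \<le> \<sigma>" by (rule cInf_lower[OF _ bd])
    then show False using that by simp
  qed
  ultimately show False using step[of "Inf S"] I' by auto
qed

text \<open>Minkowski's integral inequality in l^2, by duality: S^2 is written as a pairing of the
  coefficients with time integrals, Cauchy-Schwarz is applied inside the integral, and one factor S
  is cancelled. The exponent 1/2 is two derivatives over order four.\<close>

lemma duhamel_l2:
  fixes n :: "real \<Rightarrow> int^2 \<Rightarrow> complex"
  assumes src: "source n q \<beta> r t" and g: "g integrable_on {r..t}"
    and gb: "\<And>s. r < s \<Longrightarrow> s < t \<Longrightarrow> 2 * (t - s) powr (- (1/2)) * \<beta> s \<le> g s" and F: "finite F"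
  shows "L2_set (\<lambda>k. norm (freq k) * norm (duhamel n r t k)) F \<le> integral {r..t} g"
proof -
  let ?I = "{r<..<t}" and ?e = "\<lambda>k s. exp (- (t - s) * lam k) * n s k"
  let ?w = "\<lambda>k s. norm (freq k) * norm (?e k s)" and ?d = "\<lambda>k. norm (freq k) * norm (duhamel n r t k)"
  have gI: "g integrable_on ?I" using g by (simp add: integrable_on_open_interval_real)
  have fin: "L2_set (\<lambda>k. ?w k s) A \<le> g s" if A: "finite A" and s: "s \<in> ?I" for A s
  proof -
    have s': "r < s" "s < t" using s by auto
    have q: "\<And>k. 0 \<le> q s k" "\<And>k. norm (n s k) \<le> norm (freq k) * q s k" "0 \<le> \<beta> s" "(\<Sum>k\<in>A. (q s k)^2) \<le> (\<beta> s)^2"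
      using src s' A unfolding source_def by blast+
    have "(\<Sum>k\<in>A. (?w k s)^2) \<le> (\<Sum>k\<in>A. (norm (freq k) powr 2 * exp (- (t - s) * lam k) * q s k)^2)"
    proof (intro sum_mono power_mono)
      fix k
      have "?w k s = norm (freq k) * exp (- (t - s) * lam k) * norm (n s k)" by (simp add: norm_mult)
      also have "\<dots> \<le> norm (freq k) * exp (- (t - s) * lam k) * (norm (freq k) * q s k)" by (intro mult_left_mono q) auto
      also have "\<dots> = norm (freq k) powr 2 * exp (- (t - s) * lam k) * q s k" by (simp add: power2_eq_square)
      finally show "?w k s \<le> norm (freq k) powr 2 * exp (- (t - s) * lam k) * q s k" .
    qed simp
    also have "\<dots> \<le> (2 * (t - s) powr (- 2 / 4) * \<beta> s)^2"
      by (rule smoothing_l2) (use s' A q in auto)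
    finally have "L2_set (\<lambda>k. ?w k s) A \<le> 2 * (t - s) powr (- 2 / 4) * \<beta> s"
      unfolding L2_set_def using q(3) by (intro real_le_lsqrt) auto
    then show ?thesis using gb[OF s'] by simp
  qed
  have one: "norm (?e k s) \<le> g s" if s: "s \<in> ?I" for k s
  proof (cases "k = 0")
    case True
    have s': "r < s" "s < t" using s by auto
    have "norm (n s 0) \<le> norm (freq 0) * q s 0" using src s' unfolding source_def by blast
    then show ?thesis using True fin[of "{}" s] s by simp
  next
    case False
    have "1 * norm (?e k s) \<le> ?w k s" by (intro mult_right_mono norm_freq_ge_1[OF False]) simp
    also have "\<dots> \<le> g s" using fin[of "{k}" s] s by (simp add: L2_set_def)
    finally show ?thesis by simp
  qed
  have m: "?e k \<in> borel_measurable (lebesgue_on ?I)" for k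
  proof -
    have "(\<lambda>s. complex_of_real (exp (- (t - s) * lam k))) \<in> borel_measurable (lebesgue_on ?I)"
      by (intro continuous_imp_measurable_on_sets_lebesgue continuous_intros) auto
    moreover have "(\<lambda>s. n s k) \<in> borel_measurable (lebesgue_on ?I)" using src by (simp add: source_def)
    ultimately show ?thesis by (rule borel_measurable_times)
  qed
  have i: "?e k integrable_on ?I" for k
    by (rule measurable_bounded_by_integrable_imp_integrable[OF m gI one]) auto
  have ni: "(\<lambda>s. norm (?e k s)) integrable_on ?I" for k
    using absolutely_integrable_integrable_bound[OF one i gI] by (simp only: absolutely_integrable_on_def)
  have dle: "?d k \<le> integral ?I (?w k)" for k
  proof -
    have "norm (duhamel n r t k) \<le> integral ?I (\<lambda>s. norm (?e k s))"
      unfolding duhamel_def integral_open_interval_real by (intro integral_norm_bound_integral i ni) auto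
    from mult_left_mono[OF this, of "norm (freq k)"] show ?thesis by (simp only: integral_mult_right norm_ge_zero)
  qed
  let ?S = "L2_set ?d F"
  have "?S * ?S = (\<Sum>k\<in>F. ?d k * ?d k)" by (simp add: L2_set_def power2_eq_square sum_nonneg)
  also have "\<dots> \<le> (\<Sum>k\<in>F. ?d k * integral ?I (?w k))" by (intro sum_mono mult_left_mono dle) auto
  also have "\<dots> = integral ?I (\<lambda>s. \<Sum>k\<in>F. ?d k * ?w k s)"
    by (subst integral_sum[OF F]) (intro integrable_on_mult_right ni, simp only: integral_mult_right)
  also have "\<dots> \<le> integral ?I (\<lambda>s. ?S * g s)"
  proof (rule integral_le)
    fix s assume s: "s \<in> ?I"
    have "(\<Sum>k\<in>F. ?d k * ?w k s) \<le> (\<Sum>k\<in>F. \<bar>?d k\<bar> * \<bar>?w k s\<bar>)" by simp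
    also have "\<dots> \<le> ?S * L2_set (\<lambda>k. ?w k s) F" by (rule L2_set_mult_ineq)
    also have "\<dots> \<le> ?S * g s" by (intro mult_left_mono fin F s) auto
    finally show "(\<Sum>k\<in>F. ?d k * ?w k s) \<le> ?S * g s" .
  qed (intro integrable_sum F integrable_on_mult_right ni gI)+
  also have "\<dots> = ?S * integral {r..t} g" by (simp only: integral_mult_right integral_open_interval_real)
  finally have SS: "?S * ?S \<le> ?S * integral {r..t} g" .
  show ?thesis
  proof (cases "?S = 0")
    case True
    have "0 \<le> integral ?I g" by (rule integral_nonneg[OF gI]) (use one in \<open>auto intro: order_trans[OF norm_ge_zero]\<close>)
    then show ?thesis unfolding True by (simp add: integral_open_interval_real)
  next
    case False
    then have "0 < ?S" using L2_set_nonneg[of ?d F] by linarith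
    then show ?thesis using SS by simp
  qed
qed

text \<open>A Beta integral with explicit constant. On each half of the interval only one factor is
  singular, the other being at most h^{-c} or h^{-mu}. Since 2^c, 2^mu <= 2 and 1/(1 - c), 1/(1 -
  mu) <= 4, each half contributes 2 * 4.\<close>

lemma beta_integral_bound:
  fixes r t c \<mu> :: real
  assumes rt: "r < t" and c: "0 < c" "c \<le> 3/4" and \<mu>: "0 < \<mu>" "\<mu> < 3/4"
  obtains g where "g integrable_on {r..t}" "integral {r..t} g \<le> 16 * (t - r) powr (1 - c - \<mu>)"
    "\<And>s. r < s \<Longrightarrow> s < t \<Longrightarrow> (t - s) powr (- c) * (s - r) powr (- \<mu>) \<le> g s"
proof -
  define h where "h = (t - r) / 2"
  have h: "0 < h" using rt by (simp add: h_def)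
  let ?g = "\<lambda>s. h powr (- c) * (s - r) powr (- \<mu>) + h powr (- \<mu>) * (t - s) powr (- c)"
  have hi: "(?g has_integral (h powr (- c) * ((t - r) powr (1 - \<mu>) / (1 - \<mu>)) + h powr (- \<mu>) * ((t - r) powr (1 - c) / (1 - c)))) {r..t}"
    by (intro has_integral_add has_integral_mult_right has_integral_powr_left has_integral_powr_right) (use rt c \<mu> in auto)
  have pw: "h powr (- a) \<le> 2 * (t - r) powr (- a)" if "0 < a" "a \<le> 3/4" for a
  proof -
    have "h powr (- a) = (t - r) powr (- a) * 2 powr a" using rt by (simp add: h_def powr_divide powr_minus field_simps)
    also have "2 powr a \<le> 2 powr 1" using that by (intro powr_mono) auto
    finally show ?thesis using rt by (simp add: mult_left_mono mult.commute)
  qed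
  have "integral {r..t} ?g = h powr (- c) * ((t - r) powr (1 - \<mu>) / (1 - \<mu>)) + h powr (- \<mu>) * ((t - r) powr (1 - c) / (1 - c))"
    by (rule integral_unique[OF hi])
  also have "\<dots> \<le> (2 * (t - r) powr (- c)) * ((t - r) powr (1 - \<mu>) * 4) + (2 * (t - r) powr (- \<mu>)) * ((t - r) powr (1 - c) * 4)"
  proof (intro add_mono mult_mono pw)
    have d: "x / (1 - a) \<le> x * 4" if "0 \<le> x" "a \<le> 3/4" for x a :: real
    proof -
      have "x * 1 \<le> x * (4 * (1 - a))" using that by (intro mult_left_mono) auto
      then show ?thesis using that by (simp add: pos_divide_le_eq mult.assoc)
    qed
    show "(t - r) powr (1 - \<mu>) / (1 - \<mu>) \<le> (t - r) powr (1 - \<mu>) * 4" using \<mu> by (intro d) auto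
    show "(t - r) powr (1 - c) / (1 - c) \<le> (t - r) powr (1 - c) * 4" using c by (intro d) auto
  qed (use c \<mu> rt in auto)
  also have "\<dots> = 8 * ((t - r) powr (- c) * (t - r) powr (1 - \<mu>)) + 8 * ((t - r) powr (- \<mu>) * (t - r) powr (1 - c))" by simp
  also have "\<dots> = 16 * (t - r) powr (1 - c - \<mu>)"
  proof -
    have e: "- c + (1 - \<mu>) = 1 - c - \<mu>" "- \<mu> + (1 - c) = 1 - c - \<mu>" by auto
    show ?thesis unfolding powr_add[symmetric] e by simp
  qed
  finally have I: "integral {r..t} ?g \<le> 16 * (t - r) powr (1 - c - \<mu>)" .
  show thesis
  proof (rule that[OF has_integral_integrable[OF hi] I])
    fix s assume s: "r < s" "s < t"
    show "(t - s) powr (- c) * (s - r) powr (- \<mu>) \<le> ?g s"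
    proof (cases "h \<le> t - s")
      case True
      then have "(t - s) powr (- c) \<le> h powr (- c)" using h c by (intro powr_mono2') auto
      then have "(t - s) powr (- c) * (s - r) powr (- \<mu>) \<le> h powr (- c) * (s - r) powr (- \<mu>)" by (rule mult_right_mono) simp
      then show ?thesis by (smt (verit) mult_nonneg_nonneg powr_ge_zero)
    next
      case False
      then have "h \<le> s - r" by (simp add: h_def field_simps)
      then have "(s - r) powr (- \<mu>) \<le> h powr (- \<mu>)" using h \<mu> by (intro powr_mono2') auto
      then have "(t - s) powr (- c) * (s - r) powr (- \<mu>) \<le> (t - s) powr (- c) * h powr (- \<mu>)" by (rule mult_left_mono) simp
      then show ?thesis by (smt (verit) mult_nonneg_nonneg powr_ge_zero mult.commute)
    qed
  qed
qed

text \<open>|x^2 - y^2| = (x + y) |x - y|, with x and y below their l^1 norms; continuity of the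
  weighted coefficients in l^1 thus passes to their l^2 norm.\<close>

lemma l1_l2_difference_bounds:
  fixes x y :: "'k \<Rightarrow> real"
  assumes s: "x summable_on UNIV" "y summable_on UNIV" "\<And>k. 0 \<le> x k" "\<And>k. 0 \<le> y k"
    and d: "(\<lambda>k. \<bar>x k - y k\<bar>) summable_on UNIV"
  shows "\<bar>infsum x UNIV - infsum y UNIV\<bar> \<le> (\<Sum>\<^sub>\<infinity>k. \<bar>x k - y k\<bar>)"
    and "(\<lambda>k. (x k)^2) summable_on UNIV"
    and "\<bar>(\<Sum>\<^sub>\<infinity>k. (x k)^2) - (\<Sum>\<^sub>\<infinity>k. (y k)^2)\<bar> \<le> (infsum x UNIV + infsum y UNIV) * (\<Sum>\<^sub>\<infinity>k. \<bar>x k - y k\<bar>)"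
proof -
  have pt: "z k \<le> infsum z UNIV" if "z summable_on UNIV" "\<And>k. 0 \<le> z k" for z :: "'k \<Rightarrow> real" and k
    using finite_sum_le_infsum[OF that(1), of "{k}"] that(2) by simp
  have sq: "(\<lambda>k. (z k)^2) summable_on UNIV" if z: "z summable_on UNIV" "\<And>k. 0 \<le> z k" for z :: "'k \<Rightarrow> real"
  proof (rule summable_on_real_comparison[OF summable_on_cmult_right[OF z(1), of "infsum z UNIV"]])
    show "(z k)^2 \<le> infsum z UNIV * z k" for k
      unfolding power2_eq_square by (intro mult_right_mono pt z)
  qed simp
  show "\<bar>infsum x UNIV - infsum y UNIV\<bar> \<le> (\<Sum>\<^sub>\<infinity>k. \<bar>x k - y k\<bar>)"
    unfolding infsum_diff_banach[OF s(1,2)] using norm_infsum_bound[of "\<lambda>k. x k - y k" UNIV] d by simp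
  show "(\<lambda>k. (x k)^2) summable_on UNIV" by (rule sq[OF s(1,3)])
  have b: "\<bar>(x k)^2 - (y k)^2\<bar> \<le> (infsum x UNIV + infsum y UNIV) * \<bar>x k - y k\<bar>" for k
  proof -
    have "\<bar>(x k)^2 - (y k)^2\<bar> = (x k + y k) * \<bar>x k - y k\<bar>"
      using s(3)[of k] s(4)[of k] by (simp add: power2_eq_square square_diff_square_factored abs_mult)
    also have "\<dots> \<le> (infsum x UNIV + infsum y UNIV) * \<bar>x k - y k\<bar>"
      by (intro mult_right_mono add_mono pt s) auto
    finally show ?thesis .
  qed
  have "\<bar>(\<Sum>\<^sub>\<infinity>k. (x k)^2) - (\<Sum>\<^sub>\<infinity>k. (y k)^2)\<bar> \<le> (\<Sum>\<^sub>\<infinity>k. (infsum x UNIV + infsum y UNIV) * \<bar>x k - y k\<bar>)"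
    unfolding infsum_diff_banach[OF sq[OF s(1,3)] sq[OF s(2,4)]]
    using summable_on_norm_comparison(2)[OF summable_on_cmult_right[OF d], of "\<lambda>k. (x k)^2 - (y k)^2" "infsum x UNIV + infsum y UNIV"] b by simp
  also have "\<dots> = (infsum x UNIV + infsum y UNIV) * (\<Sum>\<^sub>\<infinity>k. \<bar>x k - y k\<bar>)" by (rule infsum_cmult_right')
  finally show "\<bar>(\<Sum>\<^sub>\<infinity>k. (x k)^2) - (\<Sum>\<^sub>\<infinity>k. (y k)^2)\<bar> \<le> (infsum x UNIV + infsum y UNIV) * (\<Sum>\<^sub>\<infinity>k. \<bar>x k - y k\<bar>)" .
qed

context mild_flow
begin

section \<open>Weighted norms of the solution and the a priori bound\<close>

definition grad_coef :: "real \<Rightarrow> int^2 \<Rightarrow> real" where "grad_coef t k = norm (freq k) * norm (fcoef (u t) k)"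

text \<open>Norm of the gradient in the Wiener algebra; it dominates the supremum and decides the
  length of the continuation step.\<close>

definition wiener :: "real \<Rightarrow> real" where "wiener t = (\<Sum>\<^sub>\<infinity>k. grad_coef t k)"

text \<open>The L2 norm of the gradient, by Parseval.\<close>

definition dirichlet :: "real \<Rightarrow> real" where "dirichlet t = sqrt (\<Sum>\<^sub>\<infinity>k. (grad_coef t k)^2)"

lemma grad_coef_nonneg [simp]: "0 \<le> grad_coef t k" by (simp add: grad_coef_def)

lemma grad_coef_summable: "0 < t \<Longrightarrow> t < Tm \<Longrightarrow> grad_coef t summable_on UNIV"
  unfolding grad_coef_def[abs_def] by (rule u_fourier(2))

lemma wiener_nonneg: "0 \<le> wiener t" unfolding wiener_def by (rule infsum_nonneg) simp

lemma grad_coef_sq_summable: "0 < t \<Longrightarrow> t < Tm \<Longrightarrow> (\<lambda>k. (grad_coef t k)^2) summable_on UNIV"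
  by (rule l1_l2_difference_bounds(2)[of "grad_coef t" "grad_coef t"]) (auto intro: grad_coef_summable)

lemma dirichlet_nonneg: "0 \<le> dirichlet t" unfolding dirichlet_def by (intro real_sqrt_ge_zero infsum_nonneg) simp

lemma grad_le_wiener: "0 < t \<Longrightarrow> t < Tm \<Longrightarrow> norm (grad (u t) y) \<le> wiener t"
  unfolding u_has_derivative(2) wiener_def grad_coef_def by (rule gsyn_summable(2)[OF u_fourier(2)])

text \<open>One factor of the gradient is kept in L2, where its singularity after a restart is only
  (s - r)^{-1/4}. Using \<open>wiener\<close> for all factors would give the singularity (p - 1)/2,
  which closes only for p < 5/2 and with a different rate.\<close>

lemma nonlin_l2_bound:
  assumes t: "0 < t" "t < Tm" and F: "finite F"
  shows "(\<Sum>k\<in>F. (vcoef (nonlin p (u t)) k)^2) \<le> (2 * (wiener t powr (p - 2) * dirichlet t))^2"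
proof -
  have gc: "continuous_on S (grad (u t))" for S by (rule grad_u_continuous[OF t])
  have "(\<Sum>k\<in>F. (vcoef (nonlin p (u t)) k)^2) \<le> integral (cbox 0 1) (\<lambda>y. (norm (NL p (grad (u t) y)))^2)"
    unfolding nonlin_eq by (rule sum_vcoef_le_integral[OF continuous_on_NL[OF p2 gc] F])
  also have "\<dots> \<le> integral (cbox 0 1) (\<lambda>y. (wiener t powr (p - 2))^2 * (norm (grad (u t) y))^2)"
  proof (rule integral_le)
    show "(\<lambda>y. (norm (NL p (grad (u t) y)))^2) integrable_on cbox 0 1"
      by (intro integrable_continuous continuous_intros continuous_on_NL p2 gc)
    show "(\<lambda>y. (wiener t powr (p - 2))^2 * (norm (grad (u t) y))^2) integrable_on cbox 0 1"
      by (intro integrable_continuous continuous_intros gc)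
    fix y
    have "norm (NL p (grad (u t) y)) \<le> wiener t powr (p - 2) * norm (grad (u t) y)"
      unfolding NL_def using p2 by (simp add: mult_right_mono powr_mono2 grad_le_wiener[OF t])
    then have "(norm (NL p (grad (u t) y)))^2 \<le> (wiener t powr (p - 2) * norm (grad (u t) y))^2" by (rule power_mono) simp
    then show "(norm (NL p (grad (u t) y)))^2 \<le> (wiener t powr (p - 2))^2 * (norm (grad (u t) y))^2" by (simp only: power_mult_distrib)
  qed
  also have "\<dots> = (wiener t powr (p - 2))^2 * integral (cbox 0 1) (\<lambda>y. (norm (grad (u t) y))^2)" by (rule integral_mult_right)
  also have "integral (cbox 0 1) (\<lambda>y. (norm (grad (u t) y))^2) \<le> 2 * (\<Sum>\<^sub>\<infinity>k. (grad_coef t k)^2)"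
    unfolding u_has_derivative(2)[OF t]
  proof (rule integral_norm2_gsyn_le[OF u_fourier(2)[OF t]])
    show "(\<Sum>k\<in>F. (norm (freq k) * norm (fcoef (u t) k))^2) \<le> (\<Sum>\<^sub>\<infinity>k. (grad_coef t k)^2)" if "finite F" for F
      using finite_sum_le_infsum[OF grad_coef_sq_summable[OF t] that] by (simp add: grad_coef_def)
  qed
  also have "(\<Sum>\<^sub>\<infinity>k. (grad_coef t k)^2) = (dirichlet t)^2" unfolding dirichlet_def by (simp add: infsum_nonneg)
  finally have "(\<Sum>k\<in>F. (vcoef (nonlin p (u t)) k)^2) \<le> (wiener t powr (p - 2))^2 * (2 * (dirichlet t)^2)" by (simp add: mult_left_mono)
  also have "\<dots> \<le> (2 * (wiener t powr (p - 2) * dirichlet t))^2"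
    unfolding power_mult_distrib by (simp add: mult_left_mono)
  finally show ?thesis .
qed

lemma wiener_dirichlet_continuous:
  assumes r: "0 < r" "r \<le> T" "T < Tm" "T - r \<le> 1"
  shows "continuous_on {r..T} wiener" "continuous_on {r..T} dirichlet"
proof -
  obtain B where B: "0 \<le> B" "source nl_coef (\<lambda>s. vcoef (nonlin p (u s))) (\<lambda>_. B) r T" by (rule nl_coef_source[OF r(1-3)])
  have rT: "r < Tm" using r by linarith
  have lim: "((\<lambda>s. \<Sum>\<^sub>\<infinity>k. norm (freq k) * norm (fcoef (u s) k - fcoef (u t) k)) \<longlongrightarrow> 0) (at t within {r..T})" if t: "t \<in> {r..T}" for t
    by (rule mild_coeffs_continuous[OF u_fourier(2)[OF r(1) rT] B(2,1) r(4) t]) (rule u_restart, use r in auto)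
  have in_rng: "0 < t" "t < Tm" if "t \<in> {r..T}" for t using that r by auto
  let ?\<Delta> = "\<lambda>t s. \<Sum>\<^sub>\<infinity>k. norm (freq k) * norm (fcoef (u s) k - fcoef (u t) k)"
  have dsum: "(\<lambda>k. norm (freq k) * norm (fcoef (u s) k - fcoef (u t) k)) summable_on UNIV" if "s \<in> {r..T}" "t \<in> {r..T}" for s t
    by (rule summable_diff_weighted[OF u_fourier(2)[OF in_rng[OF that(1)]] u_fourier(2)[OF in_rng[OF that(2)]]]) simp
  have dx: "\<bar>grad_coef s k - grad_coef t k\<bar> \<le> norm (freq k) * norm (fcoef (u s) k - fcoef (u t) k)" for s t k
  proof -
    have "\<bar>grad_coef s k - grad_coef t k\<bar> = norm (freq k) * \<bar>norm (fcoef (u s) k) - norm (fcoef (u t) k)\<bar>"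
      unfolding grad_coef_def right_diff_distrib[symmetric] by (simp only: abs_mult abs_norm_cancel)
    also have "\<dots> \<le> norm (freq k) * norm (fcoef (u s) k - fcoef (u t) k)" by (intro mult_left_mono norm_triangle_ineq3) simp
    finally show ?thesis .
  qed
  have dxs: "(\<lambda>k. \<bar>grad_coef s k - grad_coef t k\<bar>) summable_on UNIV" "(\<Sum>\<^sub>\<infinity>k. \<bar>grad_coef s k - grad_coef t k\<bar>) \<le> ?\<Delta> t s" if "s \<in> {r..T}" "t \<in> {r..T}" for s t
  proof -
    show 1: "(\<lambda>k. \<bar>grad_coef s k - grad_coef t k\<bar>) summable_on UNIV"
      by (rule summable_on_real_comparison[OF dsum[OF that] _ dx]) simp
    show "(\<Sum>\<^sub>\<infinity>k. \<bar>grad_coef s k - grad_coef t k\<bar>) \<le> ?\<Delta> t s" by (rule infsum_mono[OF 1 dsum[OF that] dx])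
  qed
  have W: "(wiener \<longlongrightarrow> wiener t) (at t within {r..T})" if t: "t \<in> {r..T}" for t
  proof -
    have "norm (wiener s - wiener t) \<le> ?\<Delta> t s" if s: "s \<in> {r..T}" for s
      using l1_l2_difference_bounds(1)[OF grad_coef_summable[OF in_rng[OF s]] grad_coef_summable[OF in_rng[OF t]] _ _ dxs(1)[OF s t]] dxs(2)[OF s t]
      by (simp add: wiener_def)
    then have "((\<lambda>s. wiener s - wiener t) \<longlongrightarrow> 0) (at t within {r..T})"
      by (intro Lim_null_comparison[OF _ lim[OF t]]) (simp add: eventually_at_filter)
    then show ?thesis by (rule LIM_zero_cancel)
  qed
  then show "continuous_on {r..T} wiener" by (simp add: continuous_on_def)
  have D: "((\<lambda>s. \<Sum>\<^sub>\<infinity>k. (grad_coef s k)^2) \<longlongrightarrow> (\<Sum>\<^sub>\<infinity>k. (grad_coef t k)^2)) (at t within {r..T})" if t: "t \<in> {r..T}" for t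
  proof -
    have b: "norm ((\<Sum>\<^sub>\<infinity>k. (grad_coef s k)^2) - (\<Sum>\<^sub>\<infinity>k. (grad_coef t k)^2)) \<le> (wiener s + wiener t) * ?\<Delta> t s" if s: "s \<in> {r..T}" for s
    proof -
      have "norm ((\<Sum>\<^sub>\<infinity>k. (grad_coef s k)^2) - (\<Sum>\<^sub>\<infinity>k. (grad_coef t k)^2)) \<le> (wiener s + wiener t) * (\<Sum>\<^sub>\<infinity>k. \<bar>grad_coef s k - grad_coef t k\<bar>)"
        using l1_l2_difference_bounds(3)[OF grad_coef_summable[OF in_rng[OF s]] grad_coef_summable[OF in_rng[OF t]] _ _ dxs(1)[OF s t]]
        by (simp add: wiener_def)
      also have "\<dots> \<le> (wiener s + wiener t) * ?\<Delta> t s"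
        by (intro mult_left_mono dxs(2)[OF s t] add_nonneg_nonneg wiener_nonneg)
      finally show ?thesis .
    qed
    have "((\<lambda>s. (wiener s + wiener t) * ?\<Delta> t s) \<longlongrightarrow> (wiener t + wiener t) * 0) (at t within {r..T})"
      by (intro tendsto_intros W lim t)
    then have l0: "((\<lambda>s. (wiener s + wiener t) * ?\<Delta> t s) \<longlongrightarrow> 0) (at t within {r..T})" by simp
    have "((\<lambda>s. (\<Sum>\<^sub>\<infinity>k. (grad_coef s k)^2) - (\<Sum>\<^sub>\<infinity>k. (grad_coef t k)^2)) \<longlongrightarrow> 0) (at t within {r..T})"
      by (rule Lim_null_comparison[OF _ l0]) (unfold eventually_at_filter, intro always_eventually allI impI b)
    then show ?thesis by (rule LIM_zero_cancel)
  qed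
  show "continuous_on {r..T} dirichlet"
    unfolding continuous_on_def dirichlet_def by (intro ballI tendsto_real_sqrt D)
qed

text \<open>Duhamel's formula from r with the assumed weighted bounds inserted. The source has L2
  size 2 K^{p-1} (s - r)^{-mu} and the kernel exponents are 3/4 for \<open>wiener\<close> and 1/2
  for \<open>dirichlet\<close>, so the constants are 18 * 2 * 16 = 576 and 2 * 2 * 16 = 64.\<close>

lemma bootstrap_step:
  assumes r: "0 < r" "r < t" "t < Tm" "t - r \<le> 1" and m: "L2norm (u r) \<le> m" and K: "0 \<le> K"
    and w: "\<And>s. r < s \<Longrightarrow> s < t \<Longrightarrow> wiener s \<le> K * (s - r) powr (- (1/2))"
    and d: "\<And>s. r < s \<Longrightarrow> s < t \<Longrightarrow> dirichlet s \<le> K * (s - r) powr (- (1/4))"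
  shows "wiener t \<le> 18 * (t - r) powr (- (1/2)) * m + 576 * K powr (p - 1) * (t - r) powr ((3 - p) / 2 - 1/2)"
    and "dirichlet t \<le> 2 * (t - r) powr (- (1/4)) * m + 64 * K powr (p - 1) * (t - r) powr ((3 - p) / 2 - 1/4)"
proof -
  \<comment> \<open>(p - 2)/2 from the power of \<open>wiener\<close> and 1/4 from
    \<open>dirichlet\<close>; p < 3 keeps the sum below 3/4, as \<open>beta_integral_bound\<close>
    requires.\<close>
  define \<mu> where "\<mu> = (p - 2) / 2 + 1/4"
  have \<mu>: "0 < \<mu>" "\<mu> < 3/4" unfolding \<mu>_def using p2 p3 by (auto intro: add_pos_pos)
  define \<beta> where "\<beta> s = 2 * K powr (p - 1) * (s - r) powr (- \<mu>)" for s
  have rT: "r < Tm" using r by linarith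
  have tau: "0 < t - r" using r by simp
  have src: "source nl_coef (\<lambda>s. vcoef (nonlin p (u s))) \<beta> r t"
  proof -
    obtain B where B: "0 \<le> B" "source nl_coef (\<lambda>s. vcoef (nonlin p (u s))) (\<lambda>_. B) r t"
      by (rule nl_coef_source[OF r(1) less_imp_le[OF r(2)] r(3)])
    have "(\<Sum>k\<in>F. (vcoef (nonlin p (u s)) k)^2) \<le> (\<beta> s)^2" if s: "r < s" "s < t" and F: "finite F" for s F
    proof -
      have s0: "0 < s" "s < Tm" using s r by auto
      let ?z = "s - r"
      have z: "0 < ?z" using s by simp
      have "wiener s powr (p - 2) * dirichlet s \<le> (K * ?z powr (- (1/2))) powr (p - 2) * (K * ?z powr (- (1/4)))"
        using p2 by (intro mult_mono powr_mono2 w d s wiener_nonneg dirichlet_nonneg) auto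
      also have "\<dots> = (K powr (p - 2) * K) * (?z powr (- (1/2) * (p - 2)) * ?z powr (- (1/4)))"
        using K z by (simp add: powr_mult powr_powr)
      also have "K powr (p - 2) * K = K powr (p - 1)"
      proof -
        have "K powr (p - 2) * K powr 1 = K powr (p - 2 + 1)" by (rule powr_add[symmetric])
        then show ?thesis using K by simp
      qed
      also have "?z powr (- (1/2) * (p - 2)) * ?z powr (- (1/4)) = ?z powr (- \<mu>)"
        unfolding powr_add[symmetric] \<mu>_def by (rule arg_cong[of _ _ "(powr) (s - r)"]) (simp add: field_simps)
      finally have "2 * (wiener s powr (p - 2) * dirichlet s) \<le> \<beta> s" by (simp add: \<beta>_def)
      then have "(2 * (wiener s powr (p - 2) * dirichlet s))^2 \<le> (\<beta> s)^2"
        by (intro power_mono mult_nonneg_nonneg dirichlet_nonneg) auto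
      then show ?thesis using nonlin_l2_bound[OF s0 F] by linarith
    qed
    moreover have "0 \<le> \<beta> s" for s by (simp add: \<beta>_def)
    ultimately show ?thesis using B(2) unfolding source_def by blast
  qed
  have m0: "0 \<le> m"
  proof -
    have "0 \<le> L2norm (u r)"
      unfolding L2norm_def using integral_nonneg[of "\<lambda>y. (u r y)^2" "cbox 0 1"]
      by (cases "(\<lambda>y. (u r y)^2) integrable_on cbox 0 1") (auto simp: not_integrable_integral)
    then show ?thesis using m by linarith
  qed
  have bes: "(\<Sum>k\<in>F. (norm (fcoef (u r) k))^2) \<le> m^2" if F: "finite F" for F
  proof -
    have W: "W1inf (u r)" by (rule u_W1inf[OF r(1) rT])
    have uc: "continuous_on S (u r)" for S
    proof -
      have "continuous_on S (\<lambda>y. Re (csyn (fcoef (u r)) y))"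
        by (intro continuous_intros continuous_on_csyn weighted_summableD(1)[OF u_weighted[OF r(1) rT]])
      then have "continuous_on S (syn (fcoef (u r)))" by (simp add: syn_def[abs_def])
      then show ?thesis using u_fourier(1)[OF r(1) rT] by simp
    qed
    have "(\<Sum>k\<in>F. (norm (fcoef (u r) k))^2) \<le> integral (cbox 0 1) (\<lambda>y. (u r y)^2)"
      by (rule bessel[OF integrable_continuous[OF uc] W1inf_norm_bounds(1)[OF W] F])
    also have "\<dots> = (L2norm (u r))^2"
    proof -
      have "0 \<le> integral (cbox 0 1) (\<lambda>y. (u r y)^2)"
        by (rule integral_nonneg) (auto intro!: integrable_continuous continuous_intros uc)
      then show ?thesis by (simp add: L2norm_def)
    qed
    also have "\<dots> \<le> m^2" using m by (intro power_mono) (auto simp: L2norm_def intro!: integral_nonneg integrable_continuous continuous_intros uc)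
    finally show ?thesis .
  qed
  have xle: "grad_coef t k \<le> norm (freq k) powr 1 * exp (- (t - r) * lam k) * norm (fcoef (u r) k) + norm (freq k) * norm (duhamel nl_coef r t k)" for k
  proof -
    have e: "fcoef (u t) k = exp (- (t - r) * lam k) * fcoef (u r) k - duhamel nl_coef r t k"
      by (rule u_restart) (use r in auto)
    have "norm (fcoef (u t) k) \<le> exp (- (t - r) * lam k) * norm (fcoef (u r) k) + norm (duhamel nl_coef r t k)"
      unfolding e by (rule order_trans[OF norm_triangle_ineq4]) (simp add: norm_mult)
    from mult_left_mono[OF this, of "norm (freq k)"] show ?thesis
      by (simp add: grad_coef_def distrib_left mult.assoc)
  qed
  have tT: "0 < t" using r by linarith
  show "wiener t \<le> 18 * (t - r) powr (- (1/2)) * m + 576 * K powr (p - 1) * (t - r) powr ((3 - p) / 2 - 1/2)"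
  proof -
    obtain g where g: "g integrable_on {r..t}" "integral {r..t} g \<le> 16 * (t - r) powr (1 - 3/4 - \<mu>)"
      "\<And>s. r < s \<Longrightarrow> s < t \<Longrightarrow> (t - s) powr (- (3/4)) * (s - r) powr (- \<mu>) \<le> g s"
      using beta_integral_bound[OF r(2), of "3/4" \<mu>] \<mu> by auto
    have gi: "(\<lambda>s. (36 * K powr (p - 1)) * g s) integrable_on {r..t}" by (rule integrable_on_mult_right[OF g(1)])
    have gb: "18 * (min (t - s) 1) powr (- (1 + 2) / 4) * \<beta> s \<le> (36 * K powr (p - 1)) * g s" if s: "r < s" "s < t" for s
    proof -
      have "min (t - s) 1 = t - s" using s r by simp
      then have "18 * (min (t - s) 1) powr (- (1 + 2) / 4) * \<beta> s = (36 * K powr (p - 1)) * ((t - s) powr (- (3/4)) * (s - r) powr (- \<mu>))"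
        by (simp add: \<beta>_def)
      also have "\<dots> \<le> (36 * K powr (p - 1)) * g s" by (intro mult_left_mono g(3) s) auto
      finally show ?thesis .
    qed
    show ?thesis
      unfolding wiener_def
    proof (rule infsum_le_finite_sums[OF grad_coef_summable[OF tT r(3)]])
      fix F :: "(int^2) set" assume F: "finite F"
      have "sum (grad_coef t) F \<le> (\<Sum>k\<in>F. norm (freq k) powr 1 * exp (- (t - r) * lam k) * norm (fcoef (u r) k)) + (\<Sum>k\<in>F. norm (freq k) powr 1 * norm (duhamel nl_coef r t k))"
        unfolding sum.distrib[symmetric] by (intro sum_mono order_trans[OF xle]) simp
      also have "(\<Sum>k\<in>F. norm (freq k) powr 1 * exp (- (t - r) * lam k) * norm (fcoef (u r) k)) \<le> 18 * (t - r) powr (- (1 + 1) / 4) * m"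
        by (rule smoothing_l1_short) (use tau r F bes m0 in auto)
      also have "(\<Sum>k\<in>F. norm (freq k) powr 1 * norm (duhamel nl_coef r t k)) \<le> integral {r..t} (\<lambda>s. (36 * K powr (p - 1)) * g s)"
        by (rule duhamel_estimate(2)[OF src _ _ gi gb F]) auto
      also have "\<dots> = (36 * K powr (p - 1)) * integral {r..t} g" by (rule integral_mult_right)
      also have "\<dots> \<le> (36 * K powr (p - 1)) * (16 * (t - r) powr (1 - 3/4 - \<mu>))" by (intro mult_left_mono g(2)) auto
      also have "1 - 3/4 - \<mu> = (3 - p) / 2 - 1/2" by (simp add: \<mu>_def field_simps)
      finally show "sum (grad_coef t) F \<le> 18 * (t - r) powr (- (1/2)) * m + 576 * K powr (p - 1) * (t - r) powr ((3 - p) / 2 - 1/2)" by simp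
    qed
  qed
  show "dirichlet t \<le> 2 * (t - r) powr (- (1/4)) * m + 64 * K powr (p - 1) * (t - r) powr ((3 - p) / 2 - 1/4)" (is "_ \<le> ?C")
  proof -
    obtain g where g: "g integrable_on {r..t}" "integral {r..t} g \<le> 16 * (t - r) powr (1 - 1/2 - \<mu>)"
      "\<And>s. r < s \<Longrightarrow> s < t \<Longrightarrow> (t - s) powr (- (1/2)) * (s - r) powr (- \<mu>) \<le> g s"
      using beta_integral_bound[OF r(2), of "1/2" \<mu>] \<mu> by auto
    have gi: "(\<lambda>s. (4 * K powr (p - 1)) * g s) integrable_on {r..t}" by (rule integrable_on_mult_right[OF g(1)])
    have gb: "2 * (t - s) powr (- (1/2)) * \<beta> s \<le> (4 * K powr (p - 1)) * g s" if s: "r < s" "s < t" for s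
    proof -
      have "2 * (t - s) powr (- (1/2)) * \<beta> s = (4 * K powr (p - 1)) * ((t - s) powr (- (1/2)) * (s - r) powr (- \<mu>))"
        by (simp add: \<beta>_def)
      also have "\<dots> \<le> (4 * K powr (p - 1)) * g s" by (intro mult_left_mono g(3) s) auto
      finally show ?thesis .
    qed
    have C0: "0 \<le> ?C" using m0 by simp
    have L: "L2_set (grad_coef t) F \<le> ?C" if F: "finite F" for F
    proof -
      have "L2_set (grad_coef t) F \<le> L2_set (\<lambda>k. norm (freq k) powr 1 * exp (- (t - r) * lam k) * norm (fcoef (u r) k) + norm (freq k) * norm (duhamel nl_coef r t k)) F"
        by (intro L2_set_mono xle) auto
      also have "\<dots> \<le> L2_set (\<lambda>k. norm (freq k) powr 1 * exp (- (t - r) * lam k) * norm (fcoef (u r) k)) F + L2_set (\<lambda>k. norm (freq k) * norm (duhamel nl_coef r t k)) F"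
        by (rule L2_set_triangle_ineq)
      also have "L2_set (\<lambda>k. norm (freq k) powr 1 * exp (- (t - r) * lam k) * norm (fcoef (u r) k)) F \<le> 2 * (t - r) powr (- 1 / 4) * m"
      proof -
        have "(\<Sum>k\<in>F. (norm (freq k) powr 1 * exp (- (t - r) * lam k) * norm (fcoef (u r) k))^2) \<le> (2 * (t - r) powr (- 1 / 4) * m)^2"
          by (rule smoothing_l2) (use tau F bes m0 in auto)
        then show ?thesis unfolding L2_set_def using m0 by (intro real_le_lsqrt) auto
      qed
      also have "L2_set (\<lambda>k. norm (freq k) * norm (duhamel nl_coef r t k)) F \<le> integral {r..t} (\<lambda>s. (4 * K powr (p - 1)) * g s)"
        by (rule duhamel_l2[OF src gi gb F])
      also have "\<dots> = (4 * K powr (p - 1)) * integral {r..t} g" by (rule integral_mult_right)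
      also have "\<dots> \<le> (4 * K powr (p - 1)) * (16 * (t - r) powr (1 - 1/2 - \<mu>))" by (intro mult_left_mono g(2)) auto
      also have "1 - 1/2 - \<mu> = (3 - p) / 2 - 1/4" by (simp add: \<mu>_def field_simps)
      finally show ?thesis by simp
    qed
    have "(\<Sum>\<^sub>\<infinity>k. (grad_coef t k)^2) \<le> ?C^2"
    proof (rule infsum_le_finite_sums[OF grad_coef_sq_summable[OF tT r(3)]])
      fix F :: "(int^2) set" assume F: "finite F"
      have "(L2_set (grad_coef t) F)^2 \<le> ?C^2" by (intro power_mono L F) auto
      then show "(\<Sum>k\<in>F. (grad_coef t k)^2) \<le> ?C^2" by (simp add: L2_set_def sum_nonneg)
    qed
    then show ?thesis unfolding dirichlet_def using C0 by (intro real_le_lsqrt infsum_nonneg) auto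
  qed
qed

text \<open>K = 36 m is twice the linear contribution 18 m, which leaves K/2 for the nonlinear one;
  \<open>small\<close> says that 576 K^{p-1} (Tm - r)^{(3-p)/2} is below K/2, whence 1152 = 2 *
  576.\<close>

lemma wiener_bound:
  assumes r: "0 < r" "r < Tm" "Tm - r \<le> 1" and m: "L2norm (u r) \<le> m" "0 < m"
    and small: "1152 * (36 * m) powr (p - 2) * (Tm - r) powr ((3 - p) / 2) < 1"
    and t: "r < t" "t < Tm"
  shows "wiener t \<le> 36 * m * (t - r) powr (- (1/2))"
proof -
  define K where "K = 36 * m"
  have K: "0 < K" using m by (simp add: K_def)
  define T where "T = t - r"
  have T: "0 < T" "T \<le> 1" "r + T < Tm" using t r by (auto simp: T_def)
  \<comment> \<open>The weights vanish at time 0, so phi starts from 0 however large the gradient at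
    r is.\<close>
  define \<phi> where "\<phi> \<tau> = max (\<tau> powr (1/2) * wiener (r + \<tau>)) (\<tau> powr (1/4) * dirichlet (r + \<tau>))" for \<tau>
  have "\<phi> T < K"
  proof (rule barrier[where T=T and \<phi>=\<phi> and K=K and \<tau>=T])
    have im: "(\<lambda>\<tau>. r + \<tau>) ` {0..T} \<subseteq> {r..r + T}" by auto
    have c: "continuous_on {r..r + T} wiener" "continuous_on {r..r + T} dirichlet"
      by (rule wiener_dirichlet_continuous; use r T in simp)+
    have cc: "continuous_on {0..T} (\<lambda>\<tau>. wiener (r + \<tau>))" "continuous_on {0..T} (\<lambda>\<tau>. dirichlet (r + \<tau>))"
      by (rule continuous_on_compose2[OF c(1) _ im] continuous_on_compose2[OF c(2) _ im]; intro continuous_intros)+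
    show "continuous_on {0..T} \<phi>"
      unfolding \<phi>_def by (intro continuous_intros cc continuous_on_powr') auto
    show "\<phi> 0 < K" using K by (simp add: \<phi>_def)
    show "T \<in> {0..T}" using T by simp
  next
    fix \<tau> assume tau: "0 < \<tau>" "\<tau> \<le> T" and hyp: "\<And>\<sigma>. 0 < \<sigma> \<Longrightarrow> \<sigma> < \<tau> \<Longrightarrow> \<phi> \<sigma> \<le> K"
    let ?t = "r + \<tau>"
    have tt: "r < ?t" "?t < Tm" "?t - r \<le> 1" using tau T by auto
    have w: "wiener s \<le> K * (s - r) powr (- (1/2))" and d: "dirichlet s \<le> K * (s - r) powr (- (1/4))" if s: "r < s" "s < ?t" for s
    proof -
      have z: "0 < s - r" using s by simp
      have "\<phi> (s - r) \<le> K" by (rule hyp) (use s in auto)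
      then have 1: "(s - r) powr (1/2) * wiener s \<le> K" "(s - r) powr (1/4) * dirichlet s \<le> K" by (auto simp: \<phi>_def)
      show "wiener s \<le> K * (s - r) powr (- (1/2))" "dirichlet s \<le> K * (s - r) powr (- (1/4))"
        using 1 z by (simp_all add: powr_minus field_simps)
    qed
    note st = bootstrap_step[OF r(1) tt(1,2,3) m(1) less_imp_le[OF K] w d]
    have sm: "576 * K powr (p - 1) * \<tau> powr ((3 - p) / 2) < K / 2"
    proof -
      have "\<tau> powr ((3 - p) / 2) \<le> (Tm - r) powr ((3 - p) / 2)"
        using tau T p3 by (intro powr_mono2) auto
      then have "1152 * K powr (p - 2) * \<tau> powr ((3 - p) / 2) \<le> 1152 * K powr (p - 2) * (Tm - r) powr ((3 - p) / 2)"
        by (intro mult_left_mono) auto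
      then have "1152 * K powr (p - 2) * \<tau> powr ((3 - p) / 2) < 1" using small by (simp add: K_def)
      then have "(1152 * K powr (p - 2) * \<tau> powr ((3 - p) / 2)) * K < 1 * K" using K by (intro mult_strict_right_mono) auto
      moreover have "K powr (p - 1) = K powr (p - 2) * K"
      proof -
        have "K powr (p - 2) * K powr 1 = K powr (p - 2 + 1)" by (rule powr_add[symmetric])
        then show ?thesis using K by simp
      qed
      ultimately show ?thesis by (simp add: mult_ac)
    qed
    have mul: "\<tau> powr a * \<tau> powr b = \<tau> powr (a + b)" for a b by (rule powr_add[symmetric])
    have "\<tau> powr (1/2) * wiener ?t \<le> \<tau> powr (1/2) * (18 * \<tau> powr (- (1/2)) * m + 576 * K powr (p - 1) * \<tau> powr ((3 - p) / 2 - 1/2))"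
      using st(1) by (intro mult_left_mono) auto
    also have "\<dots> = 18 * m * (\<tau> powr (1/2) * \<tau> powr (- (1/2))) + 576 * K powr (p - 1) * (\<tau> powr (1/2) * \<tau> powr ((3 - p) / 2 - 1/2))"
      by (simp add: algebra_simps)
    also have "\<dots> = 18 * m + 576 * K powr (p - 1) * \<tau> powr ((3 - p) / 2)" unfolding mul using tau by simp
    also have "\<dots> < K" using sm unfolding K_def by linarith
    finally have A: "\<tau> powr (1/2) * wiener ?t < K" .
    have "\<tau> powr (1/4) * dirichlet ?t \<le> \<tau> powr (1/4) * (2 * \<tau> powr (- (1/4)) * m + 64 * K powr (p - 1) * \<tau> powr ((3 - p) / 2 - 1/4))"
      using st(2) by (intro mult_left_mono) auto
    also have "\<dots> = 2 * m * (\<tau> powr (1/4) * \<tau> powr (- (1/4))) + 64 * K powr (p - 1) * (\<tau> powr (1/4) * \<tau> powr ((3 - p) / 2 - 1/4))"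
      by (simp add: algebra_simps)
    also have "\<dots> = 2 * m + 64 * (K powr (p - 1) * \<tau> powr ((3 - p) / 2))" unfolding mul using tau by simp
    also have "\<dots> < K"
    proof -
      have "0 \<le> K powr (p - 1) * \<tau> powr ((3 - p) / 2)" by simp
      then show ?thesis using sm m unfolding K_def mult.assoc by linarith
    qed
    finally show "\<phi> \<tau> < K" using A by (simp add: \<phi>_def)
  qed
  then have "T powr (1/2) * wiener t < K" by (simp add: \<phi>_def T_def)
  then show ?thesis using T by (simp add: K_def T_def powr_minus field_simps)
qed

text \<open>If the product were small, \<open>wiener\<close> would be bounded by a fixed M on the
  second half of the interval up to \<open>Tm\<close>. The continuation step tau for that M, taken
  less than tau before \<open>Tm\<close>, would then produce a mild solution beyond
  \<open>Tm\<close>.\<close>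

lemma L2_lower_bound:
  assumes max: "\<And>T v. mild_solution p u0 v T \<Longrightarrow> T \<le> Tm"
    and r: "0 < r" "r < Tm" "Tm - r \<le> 1" and m: "L2norm (u r) \<le> m" "0 < m"
  shows "1 \<le> 1152 * (36 * m) powr (p - 2) * (Tm - r) powr ((3 - p) / 2)"
proof (rule ccontr)
  assume "\<not> ?thesis"
  then have small: "1152 * (36 * m) powr (p - 2) * (Tm - r) powr ((3 - p) / 2) < 1" by simp
  define M where "M = 36 * m * ((Tm - r) / 2) powr (- (1/2))"
  have M: "0 < M" using m r by (simp add: M_def)
  \<comment> \<open>Solves 288 (2M)^{p-2} tau^{1/4} = 1/2, capped at 1.\<close>
  define \<tau> where "\<tau> = min 1 ((1 / (576 * (2 * M) powr (p - 2))) ^ 4)"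
  have C: "0 < 576 * (2 * M) powr (p - 2)" using M by simp
  have tau: "0 < \<tau>" "\<tau> \<le> 1" using C by (auto simp: \<tau>_def)
  have tau3: "288 * (2 * M) powr (p - 2) * \<tau> powr (1/4) \<le> 1/2"
  proof -
    let ?c = "1 / (576 * (2 * M) powr (p - 2))"
    have c: "0 < ?c" using C by simp
    have "\<tau> powr (1/4) \<le> (?c ^ 4) powr (1/4)" using tau by (intro powr_mono2) (auto simp: \<tau>_def)
    also have "\<dots> = ?c"
    proof -
      have "?c ^ 4 = ?c powr 4" using c by simp
      then show ?thesis using c by (simp only: powr_powr) simp
    qed
    finally have "288 * (2 * M) powr (p - 2) * \<tau> powr (1/4) \<le> 288 * (2 * M) powr (p - 2) * ?c" by (intro mult_left_mono) auto
    also have "\<dots> = 1/2" using M by simp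
    finally show ?thesis .
  qed
  define t where "t = max ((r + Tm) / 2) (Tm - \<tau> / 2)"
  have t: "r < t" "t < Tm" "(r + Tm) / 2 \<le> t" "Tm < t + \<tau>" "0 < t" using r tau by (auto simp: t_def less_max_iff_disj)
  have "wiener t \<le> 36 * m * (t - r) powr (- (1/2))" by (rule wiener_bound[OF r m small t(1,2)])
  also have "\<dots> \<le> M"
    unfolding M_def using m r t by (intro mult_left_mono powr_mono2') (auto simp: field_simps)
  finally have "(\<Sum>\<^sub>\<infinity>k. norm (freq k) * norm (fcoef (u t) k)) \<le> M" by (simp add: wiener_def grad_coef_def)
  from continuation[OF t(5,2) M this tau tau3] obtain v where "mild_solution p u0 v (t + \<tau>)" by blast
  from max[OF this] t(4) show False by simp
qed

end

theorem mainTheorem19: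
  fixes p :: real and u0 :: "real^2 \<Rightarrow> real" and u :: "real \<Rightarrow> real^2 \<Rightarrow> real"
  assumes "2 < p" "p < 3"
    and "H2 u0" "W1inf u0"
    and "energy p u0 < 0"
    and "{T. \<exists>v. mild_solution p u0 v T} \<noteq> {}"
    and "bdd_above {T. \<exists>v. mild_solution p u0 v T}"
    and "\<forall>T. 0 < T \<and> T < max_time p u0 \<longrightarrow> mild_solution p u0 u T"
  shows "filterlim (\<lambda>t. L2norm (u t)) at_top (at_left (max_time p u0))
     \<and> Liminf (at_left (max_time p u0))
           (\<lambda>t. ereal ((max_time p u0 - t) powr ((3 - p) / (2 * (p - 2))) * L2norm (u t))) > 0"
proof -
  let ?S = "{T. \<exists>v. mild_solution p u0 v T}"
  define Tm where "Tm = max_time p u0"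
  define \<gamma> where "\<gamma> = (3 - p) / (2 * (p - 2))"
  have \<gamma>: "0 < \<gamma>" using assms(1,2) by (simp add: \<gamma>_def)
  interpret mild_flow p u0 u Tm
    by unfold_locales (use assms Tm_def in auto)
  have max: "T \<le> Tm" if "mild_solution p u0 v T" for T v
    unfolding Tm_def max_time_def by (rule cSup_upper[OF _ assms(7)]) (use that in blast)
  obtain T1 v1 where T1: "mild_solution p u0 v1 T1" using assms(6) by blast
  have Tm: "0 < Tm" using max[OF T1] T1 by (auto simp: mild_solution_def)
  \<comment> \<open>The inequality 1 <= 1152 (36 m)^{p-2} (Tm - r)^{(3-p)/2}, raised to the power
    1/(p - 2) and solved for m.\<close>
  define c where "c = (1 / 1152) powr (1 / (p - 2)) / 36"
  have c: "0 < c" by (simp add: c_def)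
  have low: "c \<le> (Tm - r) powr \<gamma> * L2norm (u r)" if r: "0 < r" "r < Tm" "Tm - r \<le> 1" for r
  proof -
    \<comment> \<open>Stated for every positive m above the norm, since
      \<open>L2_lower_bound\<close> asks for m > 0 and positivity of the norm is itself deduced from
      this.\<close>
    have key: "c \<le> (Tm - r) powr \<gamma> * m" if m: "L2norm (u r) \<le> m" "0 < m" for m
    proof -
      let ?d = "(Tm - r) powr ((3 - p) / 2)"
      have "1 \<le> 1152 * (36 * m) powr (p - 2) * ?d" by (rule L2_lower_bound[OF _ r m]) (rule max)
      then have "1 / 1152 \<le> (36 * m) powr (p - 2) * ?d" by simp
      then have "(1 / 1152) powr (1 / (p - 2)) \<le> ((36 * m) powr (p - 2) * ?d) powr (1 / (p - 2))"
        using assms(1) by (intro powr_mono2) auto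
      also have "\<dots> = 36 * m * (Tm - r) powr \<gamma>"
      proof -
        have "((36 * m) powr (p - 2)) powr (1 / (p - 2)) = 36 * m" using assms(1) m by (simp add: powr_powr)
        moreover have "?d powr (1 / (p - 2)) = (Tm - r) powr \<gamma>" by (simp add: powr_powr \<gamma>_def)
        ultimately show ?thesis using m r by (simp add: powr_mult)
      qed
      finally show ?thesis by (simp add: c_def field_simps)
    qed
    have pos: "0 < L2norm (u r)"
    proof (rule ccontr)
      assume neg: "\<not> 0 < L2norm (u r)"
      \<comment> \<open>If the norm were not positive, every positive m would be admissible; this
        one makes the right-hand side c/2.\<close>
      let ?m = "c / (2 * (Tm - r) powr \<gamma>)"
      have "0 < (Tm - r) powr \<gamma>" using r by simp
      then have "0 < ?m" "(Tm - r) powr \<gamma> * ?m = c / 2" using c by (auto simp: field_simps)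
      with key[of ?m] neg c show False by simp
    qed
    show ?thesis by (rule key[OF order_refl pos])
  qed
  \<comment> \<open>Late enough that both 0 < r and Tm - r <= 1 hold, as the short-time estimates
    require.\<close>
  define r0 where "r0 = max (Tm / 2) (Tm - 1)"
  have r0: "r0 < Tm" "\<And>r. r0 < r \<Longrightarrow> r < Tm \<Longrightarrow> 0 < r \<and> Tm - r \<le> 1" using Tm by (auto simp: r0_def)
  have ev: "\<forall>\<^sub>F t in at_left Tm. c \<le> (Tm - t) powr \<gamma> * L2norm (u t) \<and> t < Tm"
    unfolding eventually_at_left_field using r0 low by (intro exI[of _ r0]) blast
  have "filterlim (\<lambda>t. L2norm (u t)) at_top (at_left Tm)"
  proof (rule filterlim_at_top_mono)
    have "((\<lambda>t. (Tm - t) powr \<gamma>) \<longlongrightarrow> (Tm - Tm) powr \<gamma>) (at_left Tm)"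
      using \<gamma> ev by (intro tendsto_intros tendsto_powr') (auto elim: eventually_mono)
    then have l: "((\<lambda>t. (Tm - t) powr \<gamma>) \<longlongrightarrow> 0) (at_left Tm)" using \<gamma> by simp
    have p0: "\<forall>\<^sub>F t in at_left Tm. 0 < (Tm - t) powr \<gamma>"
      using ev by eventually_elim simp
    show "filterlim (\<lambda>t. c / (Tm - t) powr \<gamma>) at_top (at_left Tm)"
      by (rule LIM_at_top_divide[OF tendsto_const c l p0])
    show "\<forall>\<^sub>F t in at_left Tm. c / (Tm - t) powr \<gamma> \<le> L2norm (u t)"
      using ev
    proof eventually_elim
      case (elim t)
      then have "0 < (Tm - t) powr \<gamma>" by simp
      then show ?case using elim by (simp add: pos_divide_le_eq mult.commute)
    qed
  qed
  moreover have "ereal c \<le> Liminf (at_left Tm) (\<lambda>t. ereal ((Tm - t) powr \<gamma> * L2norm (u t)))"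
    by (rule Liminf_bounded) (use ev in \<open>auto elim: eventually_mono\<close>)
  moreover have "0 < ereal c" using c by simp
  ultimately show ?thesis unfolding Tm_def \<gamma>_def by (intro conjI) (assumption, rule less_le_trans)
qed

end
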